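(* Consider the asymmetric generalized exclusion process on $\mathbb T_N^d$ accelerated by $N^{1+\kappa}$, started from $\mu_{N,0}$, with law $\mu_{N,t}$ at time $t$ and relative entropy $H_N(t)$ (all as defined in the context). Suppose that $H_N(0)=o(N^{d-2\alpha})$ as $N\to\infty$, that $0<\alpha<d/2$, and that $\kappa\in(0,\alpha]\cap(0,1-2\alpha)$ if $d=1$, respectively $\kappa\in(0,\alpha]\cap(0,1)$ if $d\ge2$. Then for any $t\in[0,T]$, any $\varphi\in C(\mathbb T^d)$ and any $\varepsilon>0$, $$\lim_{N\to\infty}\mu_{N,t}\bigg\{\bigg|\frac1{N^{d-\alpha}}\sum_{x\in\mathbb T_N^d}(\eta_x-\varrho_* )\,\varphi\Big(\frac xN-N^\kappa\lambda tm\Big)-\int_{\mathbb T^d}\rho^{(\alpha,\kappa)}(t,u)\varphi(u)\,du\bigg|>\varepsilon\bigg\}=0,$$ where $\rho^{(\alpha,\kappa)}(t,u)=\rho^{\rm ini}(u)$ if $\kappa<\alpha$ and $\rho^{(\alpha,\kappa)}(t,u)=\rho(t,u)$ if $\kappa=\alpha$, $\rho$ being the smooth solution of the Burgers equation $\partial_s\rho-m\cdot\nabla(\rho^2)=0$, $\rho(0,\cdot)=\rho^{\rm ini}$.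
   Context: Lattice and dynamics. Let $d\ge1$, $\mathbb T^d=(\mathbb R/\mathbb Z)^d$, $\mathbb T_N^d=\mathbb Z^d/(N\mathbb Z^d)$. Fix an integer $K>0$ and let $\Omega_N^d=\{0,1,\dots,K\}^{\mathbb T_N^d}$; for $\eta\in\Omega_N^d$, $\eta_x$ is the number of particles at $x$. Let $e_1,\dots,e_d$ be the canonical basis and $e_{i+d}=-e_i$ for $1\le i\le d$. Fix rates $p_i\ge0$, $1\le i\le 2d$, with $p_i+p_{i+d}>0$ for each $1\le i\le d$, and assume that $m=(m_i)_{1\le i\le d}$, $m_i=p_i-p_{i+d}$, is a nonzero vector. The generator is $$\mathcal L_Nf(\eta)=\sum_{i=1}^{2d}\sum_{x\in\mathbb T_N^d}c_{x,i}(\eta)\,[f(\eta^{x,x+e_i})-f(\eta)],\qquad c_{x,i}(\eta)=p_i\,\eta_x(K-\eta_{x+e_i}),$$ where $\eta^{x,y}$ is obtained from $\eta$ by moving one particle from $x$ to $y$ (so $\eta_x$ becomes $\eta_x-1$, $\eta_y$ becomes $\eta_y+1$, other coordinates unchanged). Product measures. For $\varrho\in[0,K]$ let $\nu^1_\varrho$ be the binomial law $\nu_\varrho^1(k)=\binom Kk(\varrho/K)^k(1-\varrho/K)^{K-k}$, $k=0,\dots,K$. Perturbed profile. Fix $\varrho_*\in(0,K)$, $\rho^{\rm ini}\in C^\infty(\mathbb T^d)$, $\alpha>0$, $0<\kappa\le\alpha$, and put $\lambda=K-2\varrho_*$. Let $\rho=\rho(s,u)$ be the smooth solution of the Burgers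 equation $$\partial_s\rho(s,u)-m\cdot\nabla\big(\rho^2(s,u)\big)=0,\qquad \rho(0,u)=\rho^{\rm ini}(u),\quad u\in\mathbb T^d.$$ If $\kappa=\alpha$, $T>0$ is fixed such that this solution is smooth on $[0,T]$; if $\kappa<\alpha$, $T>0$ is arbitrary. For $t\in[0,T]$ and $N$ sufficiently large set $$\varrho_N(t,u)=\varrho_*+N^{-\alpha}\rho(N^{\kappa-\alpha}t,\,u-N^\kappa\lambda tm),$$ which takes values in $(0,K)$ for $N$ large. Initial law. $\mu_{N,0}$ is a probability measure on $\Omega_N^d$ associated to the profile $\varrho_*+N^{-\alpha}\rho^{\rm ini}$: for any $\varphi\in C(\mathbb T^d)$ and $\varepsilon>0$, $$\lim_{N\to\infty}\mu_{N,0}\Big\{\Big|\frac1{N^{d-\alpha}}\sum_{x\in\mathbb T_N^d}(\eta_x-\varrho_* )\varphi(\tfrac xN)-\int_{\mathbb T^d}\rho^{\rm ini}(u)\varphi(u)\,du\Big|>\varepsilon\Big\}=0.$$ Relative entropy. Let $\eta(t)$ be the Markov process with generator $N^{1+\kappa}\mathcal L_N$ and initial law $\mu_{N,0}$, and let $\mu_{N,t}$ be the law of $\eta(t)$. Let $\nu_{N,t}(d\eta)=\bigotimes_{x\in\mathbb T_N^d}\nu^1_{\varrho_N(t,x/N)}(d\eta_x)$, $f_{N,t}=\mu_{N,t}/\nu_{N,t}$, and $H_N(t)=\sum_{\eta\in\Omega_N^d}f_{N,t}(\eta)\log f_{N,t}(\eta)\,\nu_{N,t}(\eta)$. *)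

theory Defs
  imports "HOL-Probability.Probability" "HOL-Library.Landau_Symbols"
begin

text \<open>
  Functions on the torus \<open>\<real>\<^sup>d / \<int>\<^sup>d\<close> are represented by \<open>\<int>\<^sup>d\<close>-periodic functions on
  \<^typ>\<open>real ^ 'd\<close>, and integration over the torus by Lebesgue integration over the unit cube.
\<close>

definition torus_periodic :: "(real ^ 'd \<Rightarrow> 'b) \<Rightarrow> bool" where
  "torus_periodic f \<longleftrightarrow> (\<forall>u i. f (u + axis i 1) = f u)"

definition torus_continuous :: "(real ^ 'd \<Rightarrow> real) \<Rightarrow> bool" where
  "torus_continuous f \<longleftrightarrow> continuous_on UNIV f \<and> torus_periodic f"

definition torus_integral :: "(real ^ 'd \<Rightarrow> real) \<Rightarrow> real" where
  "torus_integral f = (LINT u : cbox 0 One | lborel. f u)"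

text \<open>
  Derivatives are taken within the set, so on a set such as \<open>{0..T} \<times> UNIV\<close> they are one-sided
  at the boundary. The gradient is unique on convex sets with nonempty interior, the only sets used
  below.
\<close>

primrec Ck_on :: "nat \<Rightarrow> 'a::euclidean_space set \<Rightarrow> ('a \<Rightarrow> real) \<Rightarrow> bool" where
  "Ck_on 0 S f \<longleftrightarrow> continuous_on S f"
| "Ck_on (Suc k) S f \<longleftrightarrow>
     (\<exists>G. (\<forall>x\<in>S. (f has_derivative (\<lambda>h. h \<bullet> G x)) (at x within S)) \<and>
          (\<forall>b\<in>Basis. Ck_on k S (\<lambda>x. G x \<bullet> b)))"

definition smooth_on :: "'a::euclidean_space set \<Rightarrow> ('a \<Rightarrow> real) \<Rightarrow> bool" where
  "smooth_on S f \<longleftrightarrow> (\<forall>k. Ck_on k S f)"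

definition torus_smooth :: "(real ^ 'd \<Rightarrow> real) \<Rightarrow> bool" where
  "torus_smooth f \<longleftrightarrow> smooth_on UNIV f \<and> torus_periodic f"

definition smooth_burgers_solution ::
  "real ^ 'd \<Rightarrow> (real ^ 'd \<Rightarrow> real) \<Rightarrow> real \<Rightarrow> (real \<Rightarrow> real ^ 'd \<Rightarrow> real) \<Rightarrow> bool" where
  "smooth_burgers_solution m \<rho>ini S \<rho> \<longleftrightarrow>
     smooth_on ({0..S} \<times> UNIV) (\<lambda>(s, u). \<rho> s u) \<and>
     (\<forall>s\<in>{0..S}. torus_periodic (\<rho> s)) \<and>
     (\<forall>u. \<rho> 0 u = \<rho>ini u) \<and>
     (\<forall>s\<in>{0..S}. \<forall>u. \<exists>D G.
        ((\<lambda>r. \<rho> r u) has_real_derivative D) (at s within {0..S}) \<and>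
        GDERIV (\<lambda>v. (\<rho> s v)\<^sup>2) u :> G \<and>
        D - m \<bullet> G = 0)"

text \<open>
  Markov processes on a finite state space \<open>S\<close>. The generator is the right derivative at time
  \<open>0\<close> of the transition semigroup; since \<open>S\<close> is finite, every function on \<open>S\<close> is in its domain.
\<close>

definition markov_semigroup :: "'s set \<Rightarrow> (real \<Rightarrow> 's \<Rightarrow> 's pmf) \<Rightarrow> bool" where
  "markov_semigroup S P \<longleftrightarrow>
     (\<forall>t\<ge>0. \<forall>x\<in>S. set_pmf (P t x) \<subseteq> S) \<and>
     (\<forall>x\<in>S. P 0 x = return_pmf x) \<and>
     (\<forall>s\<ge>0. \<forall>t\<ge>0. \<forall>x\<in>S. P (s + t) x = bind_pmf (P s x) (P t))"

definition has_generator ::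
  "'s set \<Rightarrow> (real \<Rightarrow> 's \<Rightarrow> 's pmf) \<Rightarrow> (('s \<Rightarrow> real) \<Rightarrow> 's \<Rightarrow> real) \<Rightarrow> bool" where
  "has_generator S P L \<longleftrightarrow>
     (\<forall>f. \<forall>x\<in>S.
        ((\<lambda>t. (measure_pmf.expectation (P t x) f - f x) / t) \<longlongrightarrow> L f x) (at_right 0))"

definition natural_filtration ::
  "'s set \<Rightarrow> 'a measure \<Rightarrow> (real \<Rightarrow> 'a \<Rightarrow> 's) \<Rightarrow> real \<Rightarrow> 'a measure" where
  "natural_filtration S M X s =
     sigma (space M) {X r -` A \<inter> space M | r A. 0 \<le> r \<and> r \<le> s \<and> A \<subseteq> S}"

definition markov_process ::
  "'s set \<Rightarrow> (('s \<Rightarrow> real) \<Rightarrow> 's \<Rightarrow> real) \<Rightarrow> 'a measure \<Rightarrow> (real \<Rightarrow> 'a \<Rightarrow> 's) \<Rightarrow> bool" where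
  "markov_process S L M X \<longleftrightarrow>
     prob_space M \<and>
     (\<forall>t\<ge>0. X t \<in> measurable M (count_space S)) \<and>
     (\<exists>P. markov_semigroup S P \<and> has_generator S P L \<and>
        (\<forall>f s t. 0 \<le> s \<longrightarrow> s \<le> t \<longrightarrow>
           (AE \<omega> in M.
              real_cond_exp M (natural_filtration S M X s) (\<lambda>\<omega>. f (X t \<omega>)) \<omega> =
              measure_pmf.expectation (P (t - s) (X s \<omega>)) f)))"

text \<open>
  The discrete torus \<open>\<int>\<^sup>d / (N \<int>\<^sup>d)\<close> is represented by the residues in \<open>{0..<N}\<^sup>d\<close>, with addition
  reduced modulo \<open>N\<close>. Configurations are set to \<open>0\<close> off the torus, which makes them the
  functions charged by \<^const>\<open>Pi_pmf\<close> with default value \<open>0\<close>.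
\<close>

definition sites :: "nat \<Rightarrow> (int ^ 'd) set" where
  "sites N = {x. \<forall>i. x $ i \<in> {0..<int N}}"

definition wrap :: "nat \<Rightarrow> int ^ 'd \<Rightarrow> int ^ 'd" where
  "wrap N x = (\<chi> i. x $ i mod int N)"

definition rescale :: "nat \<Rightarrow> int ^ 'd \<Rightarrow> real ^ 'd" where
  "rescale N x = (\<chi> i. real_of_int (x $ i) / real N)"

definition configs :: "nat \<Rightarrow> nat \<Rightarrow> (int ^ 'd \<Rightarrow> nat) set" where
  "configs K N = PiE_dflt (sites N) 0 (\<lambda>_. {0..K})"

text \<open>
  The \<open>2d\<close> directions are indexed by \<^typ>\<open>'d + 'd\<close>: \<^term>\<open>Inl i\<close> stands for the index \<open>i\<close> and
  \<^term>\<open>Inr i\<close> for \<open>i + d\<close>.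
\<close>

fun dir :: "'d + 'd \<Rightarrow> int ^ 'd" where
  "dir (Inl i) = axis i 1"
| "dir (Inr i) = - axis i 1"

definition drift :: "('d + 'd \<Rightarrow> real) \<Rightarrow> real ^ 'd" where
  "drift p = (\<chi> i. p (Inl i) - p (Inr i))"

text \<open>The two updates are sequential, so that nothing changes if \<open>x = y\<close> (which occurs for \<open>N = 1\<close>).\<close>

definition move :: "int ^ 'd \<Rightarrow> int ^ 'd \<Rightarrow> (int ^ 'd \<Rightarrow> nat) \<Rightarrow> (int ^ 'd \<Rightarrow> nat)" where
  "move x y \<eta> = (let \<eta>' = \<eta>(x := \<eta> x - 1) in \<eta>'(y := \<eta>' y + 1))"

definition jump_rate ::
  "('d + 'd \<Rightarrow> real) \<Rightarrow> nat \<Rightarrow> nat \<Rightarrow> int ^ 'd \<Rightarrow> 'd + 'd \<Rightarrow> (int ^ 'd \<Rightarrow> nat) \<Rightarrow> real" where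
  "jump_rate p K N x i \<eta> = p i * real (\<eta> x) * (real K - real (\<eta> (wrap N (x + dir i))))"

definition generator ::
  "('d::finite + 'd \<Rightarrow> real) \<Rightarrow> nat \<Rightarrow> nat \<Rightarrow>
     ((int ^ 'd \<Rightarrow> nat) \<Rightarrow> real) \<Rightarrow> (int ^ 'd \<Rightarrow> nat) \<Rightarrow> real" where
  "generator p K N f \<eta> =
     (\<Sum>i\<in>UNIV. \<Sum>x\<in>sites N.
        jump_rate p K N x i \<eta> * (f (move x (wrap N (x + dir i)) \<eta>) - f \<eta>))"

definition product_binomial :: "nat \<Rightarrow> nat \<Rightarrow> (real ^ 'd \<Rightarrow> real) \<Rightarrow> (int ^ 'd \<Rightarrow> nat) pmf" where
  "product_binomial K N r = Pi_pmf (sites N) 0 (\<lambda>x. binomial_pmf K (r (rescale N x) / real K))"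

definition perturbed_profile ::
  "real ^ 'd \<Rightarrow> real \<Rightarrow> real \<Rightarrow> real \<Rightarrow> real \<Rightarrow> (real \<Rightarrow> real ^ 'd \<Rightarrow> real) \<Rightarrow>
     nat \<Rightarrow> real \<Rightarrow> real ^ 'd \<Rightarrow> real" where
  "perturbed_profile m lam \<rho>s \<alpha> \<kappa> \<rho> N t u =
     \<rho>s + real N powr (- \<alpha>) *
       \<rho> (real N powr (\<kappa> - \<alpha>) * t) (u - (real N powr \<kappa> * lam * t) *\<^sub>R m)"

definition rel_entropy :: "'s set \<Rightarrow> 's measure \<Rightarrow> 's pmf \<Rightarrow> real" where
  "rel_entropy S \<mu> \<nu> =
     (\<Sum>\<eta>\<in>S. let f = measure \<mu> {\<eta>} / pmf \<nu> \<eta> in f * ln f * pmf \<nu> \<eta>)"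

end

theory Submission
  imports Defs "HOL-Real_Asymp.Real_Asymp"
begin

text \<open>
  Relative entropy method. Let \<open>H\<close> be the entropy of the law with respect to the product measure
  with profile \<open>r\<^sub>x = \<varrho>\<^sub>N(t, x/N)\<close> and write \<open>\<omega>\<^sub>x = \<eta>\<^sub>x - r\<^sub>x\<close>. In the derivative of \<open>H\<close> the terms
  linear in \<open>\<omega>\<close> cancel up to a Taylor remainder because \<open>\<varrho>\<^sub>N\<close> solves the conservation law; the terms
  quadratic in \<open>\<omega>\<close> have coefficients of order \<open>N\<^bsup>\<kappa>-\<alpha>\<^esup>\<close> and form sums of products
  \<open>\<omega>\<^sub>x \<omega>\<^bsub>x+e\<^esub>\<close>, which are replaced by products of averages over cubes of side \<open>\<ell> = 2\<^sup>n \<approx> N\<^sup>b\<close>.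
  The replacement transports a point mass to the uniform mass on a cube along a flow obtained by
  repeatedly doubling the cube; its energy is \<open>O(n\<^sup>2)\<close> for \<open>d \<ge> 2\<close> and \<open>O(n\<^sup>2 \<ell>)\<close> for \<open>d = 1\<close>, and its
  cost is absorbed by the Dirichlet form. The remaining squares are bounded by \<open>H\<close> through the entropy
  inequality, since linear functionals of \<open>\<omega>\<close> are sub-Gaussian (Hoeffding) and locally dependent
  factors can be separated (Finner). For a suitable exponent \<open>b\<close>, Gronwall's inequality gives
  \<open>H = o(N\<^bsup>d-2\<alpha>\<^esup>)\<close>, which controls the second moment of the fluctuation field.

  To keep all densities positive, the argument is run from the mixture, with equal weights, of the
  initial law and the product measure; it dominates half of the initial law, and at most half of the
  initial entropy survives by convexity.
\<close>

section \<open>Entropy and exponential moments\<close>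

text \<open>The rates are bilinear and balanced by the binomial weights. Hence the reversed rate
  minus the direct rate across a bond is exactly \<open>K * (\<eta> y - \<eta> x)\<close>, so
  differences of occupation numbers can be integrated by parts, and the expansion of the entropy
  production around the profile ends at second order. Its quadratic coefficients are built from
  \<open>1 - odds\<close>, of order N^(-1-\<alpha>), and the speed N^(1+\<kappa>) raises them to
  N^(\<kappa>-\<alpha>). Bounding the quadratic terms directly by the entropy inequality would leave
  an error N^(d+\<kappa>-\<alpha>), far above the target N^(d-2\<alpha>); the cube averages gain the
  missing factor \<ell>^(-d). A larger cube makes the transport dearer, and the conditions on
  \<kappa> ensure that some exponent b meets both demands. The coefficient of the entropy must
  moreover stay bounded in N, since Gronwall's inequality exponentiates it.\<close>

definition ent :: "'s set \<Rightarrow> ('s \<Rightarrow> real) \<Rightarrow> ('s \<Rightarrow> real) \<Rightarrow> real" where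
  "ent S u v = (\<Sum>\<eta>\<in>S. u \<eta> * ln (u \<eta> / v \<eta>))"

text \<open>Gibbs variational inequality: \<open>ln q \<le> q - 1\<close> for the density
  \<open>q\<close> of the tilted law \<open>v exp F / Z\<close> with respect to \<open>u\<close>,
  averaged over \<open>u\<close>; the right-hand sides then sum to zero. Points where
  \<open>u\<close> vanishes are treated apart, so laws without full support are covered.\<close>

lemma entropy_inequality:
  fixes u v F :: "'s \<Rightarrow> real"
  assumes fin: "finite S" and u0: "\<And>\<eta>. \<eta> \<in> S \<Longrightarrow> u \<eta> \<ge> 0" and u1: "(\<Sum>\<eta>\<in>S. u \<eta>) = 1"
    and v0: "\<And>\<eta>. \<eta> \<in> S \<Longrightarrow> v \<eta> > 0"
  shows "(\<Sum>\<eta>\<in>S. u \<eta> * F \<eta>) \<le> ent S u v + ln (\<Sum>\<eta>\<in>S. v \<eta> * exp (F \<eta>))"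
proof -
  define Z where "Z = (\<Sum>\<eta>\<in>S. v \<eta> * exp (F \<eta>))"
  have "S \<noteq> {}" using u1 by auto
  then have Z: "Z > 0" unfolding Z_def using fin v0 by (intro sum_pos) auto
  have "u \<eta> * F \<eta> - u \<eta> * ln (u \<eta> / v \<eta>) - u \<eta> * ln Z \<le> v \<eta> * exp (F \<eta>) / Z - u \<eta>" if "\<eta> \<in> S" for \<eta>
  proof (cases "u \<eta> = 0")
    case True
    then show ?thesis using v0[OF that] Z by simp
  next
    case False
    then have up: "u \<eta> > 0" using u0[OF that] by simp
    have vp: "v \<eta> > 0" using v0[OF that] .
    let ?q = "v \<eta> * exp (F \<eta>) / (u \<eta> * Z)"
    have "ln ?q \<le> ?q - 1" using up vp Z by (intro ln_le_minus_one) simp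
    moreover have "ln ?q = F \<eta> - ln (u \<eta> / v \<eta>) - ln Z"
      using up vp Z by (simp add: ln_div ln_mult)
    ultimately have "u \<eta> * (F \<eta> - ln (u \<eta> / v \<eta>) - ln Z) \<le> u \<eta> * (?q - 1)"
      using up by (intro mult_left_mono) auto
    also have "\<dots> = v \<eta> * exp (F \<eta>) / Z - u \<eta>" using up Z by (simp add: field_simps)
    finally show ?thesis by (simp add: algebra_simps)
  qed
  then have "(\<Sum>\<eta>\<in>S. u \<eta> * F \<eta> - u \<eta> * ln (u \<eta> / v \<eta>) - u \<eta> * ln Z)
      \<le> (\<Sum>\<eta>\<in>S. v \<eta> * exp (F \<eta>) / Z - u \<eta>)" by (intro sum_mono) auto
  also have "\<dots> = Z / Z - 1"
    unfolding sum_subtractf u1 sum_divide_distrib[symmetric] Z_def ..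
  also have "\<dots> = 0" using Z by simp
  finally have "(\<Sum>\<eta>\<in>S. u \<eta> * F \<eta>) - (\<Sum>\<eta>\<in>S. u \<eta> * ln (u \<eta> / v \<eta>)) - (\<Sum>\<eta>\<in>S. u \<eta>) * ln Z \<le> 0"
    by (simp add: sum_subtractf sum_distrib_right)
  then show ?thesis unfolding ent_def Z_def[symmetric] u1 by simp
qed

lemma ent_nonneg:
  fixes u v :: "'s \<Rightarrow> real"
  assumes "finite S" "\<And>\<eta>. \<eta> \<in> S \<Longrightarrow> u \<eta> \<ge> 0" "(\<Sum>\<eta>\<in>S. u \<eta>) = 1"
    "\<And>\<eta>. \<eta> \<in> S \<Longrightarrow> v \<eta> > 0" "(\<Sum>\<eta>\<in>S. v \<eta>) = 1"
  shows "ent S u v \<ge> 0"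
proof -
  have "0 \<le> ent S u v + ln (\<Sum>\<eta>\<in>S. v \<eta> * exp 0)"
    using entropy_inequality[of S u v "\<lambda>_. 0"] assms(1-4) by simp
  then show ?thesis using assms(5) by simp
qed

text \<open>The square is linearised by an auxiliary Gaussian variable.\<close>

lemma subgaussian_exp_square:
  fixes w X :: "'s \<Rightarrow> real"
  assumes fin: "finite S" and w0: "\<And>\<eta>. \<eta> \<in> S \<Longrightarrow> w \<eta> \<ge> 0"
    and mgf: "\<And>t. (\<Sum>\<eta>\<in>S. w \<eta> * exp (t * X \<eta>)) \<le> exp (t\<^sup>2 * \<sigma> / 2)"
    and g: "\<gamma> \<ge> 0" "\<gamma> * \<sigma> \<le> 3 / 8"
  shows "(\<Sum>\<eta>\<in>S. w \<eta> * exp (\<gamma> * (X \<eta>)\<^sup>2)) \<le> 2"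
proof -
  \<comment> \<open>With this \<open>s\<close>, the mean of \<open>exp (s * X * g)\<close> over a
    standard Gaussian \<open>g\<close> is \<open>exp (\<gamma> * X^2)\<close>. The sum over
    \<open>S\<close> is then carried out first, under the Gaussian integral.\<close>
  define s where "s = sqrt (2 * \<gamma>)"
  have s2: "s\<^sup>2 = 2 * \<gamma>" using g by (simp add: s_def)
  have nd: "normal_density 0 1 x * exp (c * x) = exp (c\<^sup>2 / 2) * normal_density c 1 x" for c x
    by (simp add: normal_density_def power2_eq_square algebra_simps flip: exp_add)
      (simp add: field_simps)?
  have int: "integrable lborel (\<lambda>x. normal_density 0 1 x * exp (c * x))" for c
    unfolding nd by simp
  have val: "(\<integral>x. normal_density 0 1 x * exp (c * x) \<partial>lborel) = exp (c\<^sup>2 / 2)" for c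
    unfolding nd by simp
  have "(\<Sum>\<eta>\<in>S. w \<eta> * exp (\<gamma> * (X \<eta>)\<^sup>2)) =
      (\<Sum>\<eta>\<in>S. \<integral>x. w \<eta> * (normal_density 0 1 x * exp ((s * X \<eta>) * x)) \<partial>lborel)"
    by (simp add: val power_mult_distrib s2)
  also have "\<dots> = (\<integral>x. (\<Sum>\<eta>\<in>S. w \<eta> * (normal_density 0 1 x * exp ((s * X \<eta>) * x))) \<partial>lborel)"
    by (rule Bochner_Integration.integral_sum[symmetric]) (intro integrable_mult_right int)
  also have "\<dots> \<le> (\<integral>x. 2 * normal_density 0 2 x \<partial>lborel)"
  proof (rule integral_mono)
    show "integrable lborel (\<lambda>x. \<Sum>\<eta>\<in>S. w \<eta> * (normal_density 0 1 x * exp ((s * X \<eta>) * x)))"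
      by (intro Bochner_Integration.integrable_sum integrable_mult_right int)
    show "integrable lborel (\<lambda>x. 2 * normal_density 0 2 x)" by simp
    fix x :: real
    have "(\<Sum>\<eta>\<in>S. w \<eta> * (normal_density 0 1 x * exp ((s * X \<eta>) * x)))
        = normal_density 0 1 x * (\<Sum>\<eta>\<in>S. w \<eta> * exp ((s * x) * X \<eta>))"
      by (simp add: sum_distrib_left mult_ac)
    also have "\<dots> \<le> normal_density 0 1 x * exp ((s * x)\<^sup>2 * \<sigma> / 2)"
      by (intro mult_left_mono mgf normal_density_nonneg)
    also have "(s * x)\<^sup>2 * \<sigma> / 2 = (\<gamma> * \<sigma>) * x\<^sup>2" by (simp add: power_mult_distrib s2)
    also have "normal_density 0 1 x * exp ((\<gamma> * \<sigma>) * x\<^sup>2) \<le> normal_density 0 1 x * exp (3 / 8 * x\<^sup>2)"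
      using mult_right_mono[OF g(2), of "x\<^sup>2"] by (intro mult_left_mono normal_density_nonneg) auto
    \<comment> \<open>The threshold 3/8 leaves \<open>exp (- x^2 / 8)\<close>, a Gaussian of
      standard deviation 2; the quotient of the normalisations is the final bound 2.\<close>
    also have "\<dots> = 2 * normal_density 0 2 x"
    proof -
      have "sqrt (2 * pi * 2\<^sup>2) = 2 * sqrt (2 * pi)"
        by (subst real_sqrt_mult) simp
      moreover have "exp (- (x\<^sup>2 / 2)) * exp (3 / 8 * x\<^sup>2) = exp (- (x\<^sup>2 / 8))"
        by (simp flip: exp_add)
      ultimately show ?thesis by (simp add: normal_density_def)
    qed
    finally show "(\<Sum>\<eta>\<in>S. w \<eta> * (normal_density 0 1 x * exp ((s * X \<eta>) * x))) \<le> 2 * normal_density 0 2 x" .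
  qed
  also have "\<dots> = 2" by simp
  finally show ?thesis .
qed

text \<open>Weighted AM--GM, the missing weight being put on the constant \<open>1\<close>.\<close>

lemma prod_powr_le_average:
  fixes a :: "'i \<Rightarrow> real"
  assumes fin: "finite I" and a: "\<And>i. i \<in> I \<Longrightarrow> a i > 0" and m: "card I \<le> m" "m > 0"
  shows "(\<Prod>i\<in>I. a i powr (1 / m)) \<le> (\<Sum>i\<in>I. a i) / m + (1 - card I / m)"
proof -
  define A where "A = (\<Sum>i\<in>I. a i) / m + (1 - card I / m)"
  have A: "A > 0"
  proof (cases "I = {}")
    case True
    then show ?thesis by (simp add: A_def)
  next
    case False
    then show ?thesis unfolding A_def
      using fin a m by (intro add_pos_nonneg divide_pos_pos sum_pos) auto
  qed
  have sumA: "(\<Sum>i\<in>I. a i) = m * A - m + card I" using m by (simp add: A_def field_simps)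
  \<comment> \<open>The tangent of \<open>ln\<close> at the average \<open>A\<close>. The missing
    \<open>m - card I\<close> entries, all equal to 1, are treated below by the same inequality in
    the form \<open>1 - 1 / A \<le> ln A\<close>.\<close>
  have "ln (a i) \<le> ln A + (a i / A - 1)" if "i \<in> I" for i
    using ln_le_minus_one[of "a i / A"] a[OF that] A by (simp add: ln_div)
  then have "(\<Sum>i\<in>I. ln (a i)) \<le> (\<Sum>i\<in>I. ln A + (a i / A - 1))"
    by (intro sum_mono) auto
  also have "\<dots> = card I * ln A + (\<Sum>i\<in>I. a i) / A - card I"
    by (simp add: sum.distrib sum_subtractf sum_divide_distrib)
  also have "\<dots> = card I * ln A + (m - card I) * (1 - 1 / A)"
    unfolding sumA using A m by (simp add: field_simps)
  also have "(m - card I) * (1 - 1 / A) \<le> (m - card I) * ln A"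
    using ln_le_minus_one[of "1 / A"] A m by (intro mult_left_mono) (auto simp: ln_div)
  also have "card I * ln A + (m - card I) * ln A = m * ln A"
    using m by (simp add: of_nat_diff algebra_simps)
  finally have "(\<Sum>i\<in>I. ln (a i)) \<le> m * ln A" by simp
  then have "(\<Sum>i\<in>I. ln (a i) / m) \<le> ln A"
    using m by (simp add: sum_divide_distrib[symmetric] field_simps)
  moreover have "(\<Prod>i\<in>I. a i powr (1 / m)) = exp (\<Sum>i\<in>I. ln (a i) / m)"
    using fin by (subst exp_sum) (auto simp: powr_def dest!: a intro!: prod.cong)
  ultimately have "(\<Prod>i\<in>I. a i powr (1 / m)) \<le> exp (ln A)" by simp
  then show ?thesis using A by (simp add: A_def)
qed

text \<open>Divided by its mean, every factor has mean 1, and the weighted AM--GM inequality is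
  integrated. Fewer than \<open>m\<close> factors are allowed, as the constant 1 that carries the
  missing weight also has mean 1.\<close>

lemma Hoelder_pmf:
  fixes a :: "'i \<Rightarrow> 'b \<Rightarrow> real"
  assumes fin: "finite I" "finite (set_pmf q)" and a: "\<And>i b. i \<in> I \<Longrightarrow> a i b > 0" and m: "card I \<le> m" "m > 0"
  shows "measure_pmf.expectation q (\<lambda>b. \<Prod>i\<in>I. a i b powr (1 / m))
     \<le> (\<Prod>i\<in>I. measure_pmf.expectation q (a i) powr (1 / m))"
proof -
  let ?E = "measure_pmf.expectation q"
  have int: "integrable (measure_pmf q) f" for f :: "'b \<Rightarrow> real"
    using fin by (intro integrable_measure_pmf_finite)
  have E: "?E (a i) > 0" if "i \<in> I" for i
  proof -
    obtain b where b: "b \<in> set_pmf q" using set_pmf_not_empty by fast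
    have "0 < pmf q b * a i b" using b a[OF that] by (simp add: pmf_positive)
    also have "\<dots> \<le> (\<Sum>b\<in>set_pmf q. pmf q b * a i b)"
      using b fin a[OF that] by (intro member_le_sum) (auto simp: less_imp_le)
    also have "\<dots> = ?E (a i)" using fin by (subst integral_measure_pmf[where A="set_pmf q"]) auto
    finally show ?thesis .
  qed
  have "?E (\<lambda>b. \<Prod>i\<in>I. a i b powr (1 / m))
     = ?E (\<lambda>b. (\<Prod>i\<in>I. ?E (a i) powr (1 / m)) * (\<Prod>i\<in>I. (a i b / ?E (a i)) powr (1 / m)))"
    using a E by (intro Bochner_Integration.integral_cong refl)
      (auto simp: powr_divide less_imp_le prod_dividef[symmetric] prod.distrib[symmetric] intro!: prod.cong
        dest!: E)
  also have "\<dots> = (\<Prod>i\<in>I. ?E (a i) powr (1 / m)) * ?E (\<lambda>b. \<Prod>i\<in>I. (a i b / ?E (a i)) powr (1 / m))"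
    by simp
  also have "\<dots> \<le> (\<Prod>i\<in>I. ?E (a i) powr (1 / m)) * ?E (\<lambda>b. (\<Sum>i\<in>I. a i b / ?E (a i)) / m + (1 - card I / m))"
    by (intro mult_left_mono integral_mono int prod_powr_le_average fin m) (auto simp: a E prod_nonneg)
  also have "?E (\<lambda>b. (\<Sum>i\<in>I. a i b / ?E (a i)) / m + (1 - card I / m))
     = (\<Sum>i\<in>I. ?E (a i) / ?E (a i)) / m + (1 - card I / m)"
    by (simp add: int)
  also have "(\<Sum>i\<in>I. ?E (a i) / ?E (a i)) = card I"
    using E by (simp add: less_imp_neq[symmetric] cong: sum.cong)
  finally show ?thesis using m by simp
qed

text \<open>Finner's inequality, by integrating out one coordinate after the other.\<close>

lemma Finner_Pi_pmf:
  fixes G :: "'z \<Rightarrow> ('v \<Rightarrow> 'b) \<Rightarrow> real"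
  assumes V: "finite V" and Z: "finite Z" and q: "\<And>x. x \<in> V \<Longrightarrow> finite (set_pmf (q x))"
    and G: "\<And>z f. z \<in> Z \<Longrightarrow> G z f > 0"
    and dep: "\<And>z f x b. z \<in> Z \<Longrightarrow> x \<notin> \<Lambda> z \<Longrightarrow> G z (f(x := b)) = G z f"
    and m: "m > 0" "\<And>x. x \<in> V \<Longrightarrow> card {z \<in> Z. x \<in> \<Lambda> z} \<le> m"
  shows "measure_pmf.expectation (Pi_pmf V d q) (\<lambda>f. \<Prod>z\<in>Z. G z f powr (1 / m))
    \<le> (\<Prod>z\<in>Z. measure_pmf.expectation (Pi_pmf V d q) (G z) powr (1 / m))"
  using V q G dep m
proof (induction V arbitrary: G rule: finite_induct)
  case empty
  then show ?case by simp
next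
  case (insert x V)
  let ?P = "Pi_pmf V d q" and ?E = "measure_pmf.expectation"
  have finP: "finite (set_pmf ?P)"
    using insert.hyps(1) insert.prems(1) by (auto intro!: finite_subset[OF set_Pi_pmf_subset'] finite_PiE_dflt simp: o_def)
  have qx: "finite (set_pmf (q x))" using insert.prems(1) by simp
  have split: "?E (Pi_pmf (insert x V) d q) F = ?E (q x) (\<lambda>b. ?E ?P (\<lambda>f. F (f(x := b))))" for F :: "_ \<Rightarrow> real"
  proof -
    have "?E (Pi_pmf (insert x V) d q) F = ?E (pair_pmf (q x) ?P) (\<lambda>(b, f). F (f(x := b)))"
      using insert.hyps by (simp add: Pi_pmf_insert case_prod_unfold)
    also have "\<dots> = ?E (q x) (\<lambda>b. ?E ?P (\<lambda>f. F (f(x := b))))"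
      using qx finP
      by (subst integral_measure_pmf[where A="set_pmf (q x) \<times> set_pmf ?P"])
         (auto simp: integral_measure_pmf[where A="set_pmf ?P"] integral_measure_pmf[where A="set_pmf (q x)"]
           pmf_pair sum_distrib_left mult_ac sum.cartesian_product split_beta intro!: sum.cong)
    finally show ?thesis .
  qed
  define \<Phi> where "\<Phi> = (\<lambda>z b. ?E ?P (\<lambda>f. G z (f(x := b))))"
  have \<Phi>_pos: "\<Phi> z b > 0" if "z \<in> Z" for z b
  proof -
    obtain f where f: "f \<in> set_pmf ?P" using set_pmf_not_empty by fast
    have "0 < pmf ?P f * G z (f(x := b))" using f insert.prems(2)[OF that] by (simp add: pmf_positive)
    also have "\<dots> \<le> (\<Sum>f\<in>set_pmf ?P. pmf ?P f * G z (f(x := b)))"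
      using f finP insert.prems(2)[OF that] by (intro member_le_sum) (auto simp: less_imp_le)
    also have "\<dots> = \<Phi> z b" unfolding \<Phi>_def using finP
      by (subst integral_measure_pmf[where A="set_pmf ?P"]) auto
    finally show ?thesis .
  qed
  \<comment> \<open>Only the functions that see the new coordinate, at most \<open>m\<close> of
    them, enter Hoelder's inequality; the others are constants in this integration.\<close>
  let ?A = "{z \<in> Z. x \<in> \<Lambda> z}" and ?B = "{z \<in> Z. x \<notin> \<Lambda> z}"
  have ZAB: "Z = ?A \<union> ?B" "?A \<inter> ?B = {}" by auto
  have \<Phi>B: "\<Phi> z b = ?E (Pi_pmf (insert x V) d q) (G z)" if "z \<in> ?B" for z b
  proof -
    have "G z (f(x := c)) = G z f" for f c using that insert.prems(3) by blast
    then show ?thesis unfolding split by (simp add: \<Phi>_def)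
  qed
  have "?E (Pi_pmf (insert x V) d q) (\<lambda>f. \<Prod>z\<in>Z. G z f powr (1 / m))
     = ?E (q x) (\<lambda>b. ?E ?P (\<lambda>f. \<Prod>z\<in>Z. G z (f(x := b)) powr (1 / m)))" by (rule split)
  \<comment> \<open>The induction hypothesis, for the functions with coordinate \<open>x\<close>
    frozen at \<open>b\<close>.\<close>
  also have "\<dots> \<le> ?E (q x) (\<lambda>b. \<Prod>z\<in>Z. \<Phi> z b powr (1 / m))"
  proof (intro integral_mono integrable_measure_pmf_finite qx)
    fix b
    show "?E ?P (\<lambda>f. \<Prod>z\<in>Z. G z (f(x := b)) powr (1 / m)) \<le> (\<Prod>z\<in>Z. \<Phi> z b powr (1 / m))"
      unfolding \<Phi>_def
    proof (rule insert.IH)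
      fix z f y c assume "z \<in> Z" "y \<notin> \<Lambda> z"
      then show "G z ((f(y := c))(x := b)) = G z (f(x := b))"
        using insert.prems(3)[of z y "f(x := b)" c] by (cases "x = y") (metis fun_upd_upd, metis fun_upd_twist)
    qed (use insert.prems in auto)
  qed
  also have "\<dots> = ?E (q x) (\<lambda>b. (\<Prod>z\<in>?B. ?E (Pi_pmf (insert x V) d q) (G z) powr (1 / m)) * (\<Prod>z\<in>?A. \<Phi> z b powr (1 / m)))"
    by (subst ZAB(1), subst prod.union_disjoint) (auto simp: Z \<Phi>B mult_ac)
  also have "\<dots> = (\<Prod>z\<in>?B. ?E (Pi_pmf (insert x V) d q) (G z) powr (1 / m)) * ?E (q x) (\<lambda>b. \<Prod>z\<in>?A. \<Phi> z b powr (1 / m))"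
    by simp
  also have "\<dots> \<le> (\<Prod>z\<in>?B. ?E (Pi_pmf (insert x V) d q) (G z) powr (1 / m)) * (\<Prod>z\<in>?A. ?E (q x) (\<Phi> z) powr (1 / m))"
    using insert.prems(4,5) Z by (intro mult_left_mono Hoelder_pmf qx \<Phi>_pos prod_nonneg) auto
  also have "(\<Prod>z\<in>?A. ?E (q x) (\<Phi> z) powr (1 / m)) = (\<Prod>z\<in>?A. ?E (Pi_pmf (insert x V) d q) (G z) powr (1 / m))"
    by (simp add: split \<Phi>_def)
  also have "(\<Prod>z\<in>?B. ?E (Pi_pmf (insert x V) d q) (G z) powr (1 / m)) * \<dots>
     = (\<Prod>z\<in>Z. ?E (Pi_pmf (insert x V) d q) (G z) powr (1 / m))"
    by (subst (3) ZAB(1), subst prod.union_disjoint) (auto simp: Z mult_ac)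
  finally show ?case .
qed

section \<open>Product binomial measures and sub-Gaussian functionals\<close>

definition confs :: "nat \<Rightarrow> 'v set \<Rightarrow> ('v \<Rightarrow> nat) set" where
  "confs K V = PiE_dflt V 0 (\<lambda>_. {0..K})"

definition binom_weight :: "nat \<Rightarrow> 'v set \<Rightarrow> ('v \<Rightarrow> real) \<Rightarrow> ('v \<Rightarrow> nat) \<Rightarrow> real" where
  "binom_weight K V r = pmf (Pi_pmf V 0 (\<lambda>x. binomial_pmf K (r x / K)))"

definition centred :: "'v set \<Rightarrow> ('v \<Rightarrow> real) \<Rightarrow> ('v \<Rightarrow> real) \<Rightarrow> ('v \<Rightarrow> nat) \<Rightarrow> real" where
  "centred V r a \<eta> = (\<Sum>x\<in>V. a x * (real (\<eta> x) - r x))"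

lemma confs_mem: "\<eta> \<in> confs K V \<longleftrightarrow> (\<forall>x. (x \<in> V \<longrightarrow> \<eta> x \<le> K) \<and> (x \<notin> V \<longrightarrow> \<eta> x = 0))"
  by (auto simp: confs_def PiE_dflt_def)

lemma confs_le: "\<eta> \<in> confs K V \<Longrightarrow> \<eta> x \<le> K"
  by (cases "x \<in> V") (auto simp: confs_mem)

lemma finite_confs: "finite V \<Longrightarrow> finite (confs K V)"
  unfolding confs_def by (rule finite_PiE_dflt) auto

text \<open>The profile stays strictly inside (0, K), so every configuration has positive weight and
  logarithms of densities make sense.\<close>

locale binomial_product =
  fixes K :: nat and V :: "'v set" and r :: "'v \<Rightarrow> real"
  assumes K: "K > 0" and V: "finite V" and r: "\<And>x. x \<in> V \<Longrightarrow> 0 < r x \<and> r x < K"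
begin

abbreviation "\<nu> \<equiv> binom_weight K V r"
abbreviation "\<Omega> \<equiv> confs K V"

lemma finite_\<Omega>: "finite \<Omega>" by (rule finite_confs[OF V])

lemma prob_bounds: "x \<in> V \<Longrightarrow> 0 < r x / K \<and> r x / K < 1"
  using r[of x] K by simp

lemma weight_eq: "\<nu> \<eta> = (\<Prod>x\<in>V. (K choose \<eta> x) * (r x / K) ^ \<eta> x * (1 - r x / K) ^ (K - \<eta> x))" if "\<eta> \<in> \<Omega>"
proof -
  have "pmf (binomial_pmf K (r x / K)) k = (K choose k) * (r x / K) ^ k * (1 - r x / K) ^ (K - k)" if "x \<in> V" for x k
    using prob_bounds[OF that] by (intro pmf_binomial) auto
  then show ?thesis
    using that unfolding binom_weight_def by (subst pmf_Pi'[OF V]) (auto simp: confs_mem)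
qed

lemma weight_pos: "\<eta> \<in> \<Omega> \<Longrightarrow> \<nu> \<eta> > 0"
  using prob_bounds by (auto simp: weight_eq confs_mem intro!: prod_pos mult_pos_pos)

lemma set_pmf_product: "set_pmf (Pi_pmf V 0 (\<lambda>x. binomial_pmf K (r x / K))) = \<Omega>"
  using prob_bounds V unfolding confs_def
  by (subst set_Pi_pmf) (auto simp: PiE_dflt_def atMost_atLeast0)

lemma expectation_product:
  "measure_pmf.expectation (Pi_pmf V 0 (\<lambda>x. binomial_pmf K (r x / K))) F = (\<Sum>\<eta>\<in>\<Omega>. \<nu> \<eta> * F \<eta>)"
  for F :: "_ \<Rightarrow> real"
  by (subst integral_measure_pmf[OF finite_\<Omega>]) (auto simp: binom_weight_def set_pmf_product)

lemma sum_weight: "(\<Sum>\<eta>\<in>\<Omega>. \<nu> \<eta>) = 1"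
  using expectation_product[of "\<lambda>_. 1"] by simp

text \<open>Hoeffding's lemma for a variable in an interval of length \<open>K\<close>. It is
  applied with a positive parameter, so a negative \<open>l\<close> is reduced to the reflected
  variable \<open>- k\<close>, which lives in \<open>[-K, 0]\<close>.\<close>

lemma binomial_mgf:
  assumes x: "x \<in> V"
  shows "measure_pmf.expectation (binomial_pmf K (r x / K)) (\<lambda>k. exp (l * (real k - r x))) \<le> exp (l\<^sup>2 * K\<^sup>2 / 8)"
proof -
  let ?q = "r x / K" let ?M = "binomial_pmf K ?q"
  have q: "?q \<in> {0..1}" using prob_bounds[OF x] by auto
  \<comment> \<open>The mean is read off from the first moment of the Bernstein polynomials.\<close>
  have mean: "measure_pmf.expectation ?M real = r x"
    using sum_k_Bernstein[of K ?q] K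
    unfolding expectation_binomial_pmf'[OF q] Bernstein_def by (simp add: mult_ac)
  have le: "measure_pmf.expectation ?M (\<lambda>k. exp (h * (f k - measure_pmf.expectation ?M f))) \<le> exp (h\<^sup>2 * K\<^sup>2 / 8)"
    if h: "h > 0" and f: "\<And>k. k \<le> K \<Longrightarrow> f k \<in> {a..a + K}" for f :: "nat \<Rightarrow> real" and a h :: real
  proof -
    interpret interval_bounded_random_variable "measure_pmf ?M" f a "a + K"
      by unfold_locales (use f prob_bounds[OF x] in \<open>auto intro!: AE_pmfI\<close>)
    have "ennreal (measure_pmf.expectation ?M (\<lambda>k. exp (h * (f k - measure_pmf.expectation ?M f))))
       = (\<integral>\<^sup>+k. exp (h * (f k - measure_pmf.expectation ?M f)) \<partial>?M)"
      using q by (intro nn_integral_eq_integral[symmetric]) auto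
    also have "\<dots> \<le> ennreal (exp (h\<^sup>2 * (a + K - a)\<^sup>2 / 8))"
      using Hoeffdings_lemma_nn_integral[OF h] by simp
    finally show ?thesis by (subst (asm) ennreal_le_iff) auto
  qed
  consider "l = 0" | "l > 0" | "l < 0" by linarith
  then show ?thesis
  proof cases
    case 1 then show ?thesis by simp
  next
    case 2
    then show ?thesis using le[of l real 0] by (simp add: mean)
  next
    case 3
    have "measure_pmf.expectation ?M (\<lambda>k. - real k) = - r x" using mean by simp
    with 3 show ?thesis using le[of "- l" "\<lambda>k. - real k" "- real K"] by (simp add: algebra_simps)
  qed
qed

text \<open>Independence multiplies the one-site bounds. The exponent is arranged as
  \<open>t^2 * \<sigma> / 2\<close>, the form that \<open>subgaussian_exp_square\<close>
  takes.\<close>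

lemma centred_mgf:
  "(\<Sum>\<eta>\<in>\<Omega>. \<nu> \<eta> * exp (t * centred V r a \<eta>)) \<le> exp (t\<^sup>2 * (K\<^sup>2 / 4 * (\<Sum>x\<in>V. (a x)\<^sup>2)) / 2)"
proof -
  let ?b = "\<lambda>x. binomial_pmf K (r x / K)"
  have "(\<Sum>\<eta>\<in>\<Omega>. \<nu> \<eta> * exp (t * centred V r a \<eta>))
     = measure_pmf.expectation (Pi_pmf V 0 ?b) (\<lambda>\<eta>. \<Prod>x\<in>V. exp (t * a x * (real (\<eta> x) - r x)))"
    using V unfolding expectation_product
    by (simp add: centred_def exp_sum[symmetric] sum_distrib_left mult_ac)
  also have "\<dots> = (\<Prod>x\<in>V. measure_pmf.expectation (?b x) (\<lambda>k. exp (t * a x * (real k - r x))))"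
    using V by (intro expectation_prod_Pi_pmf)
      (auto intro!: integrable_binomial_pmf dest: prob_bounds)
  also have "\<dots> \<le> (\<Prod>x\<in>V. exp ((t * a x)\<^sup>2 * K\<^sup>2 / 8))"
    by (intro prod_mono conjI binomial_mgf Bochner_Integration.integral_nonneg) auto
  also have "\<dots> = exp (t\<^sup>2 * (K\<^sup>2 / 4 * (\<Sum>x\<in>V. (a x)\<^sup>2)) / 2)"
    using V by (simp add: exp_sum[symmetric] sum_distrib_left sum_distrib_right sum_divide_distrib power_mult_distrib mult_ac)
  finally show ?thesis .
qed

text \<open>The entropy inequality for \<open>\<gamma>\<close> times the sum of the squares. The
  squares share coordinates, with at most \<open>m\<close> of them at each site, so Finner's
  inequality bounds the joint exponential moment by a product of single moments to the power
  \<open>1 / m\<close>, each single moment being at most 2. The overlap thus multiplies the entropy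
  but not \<open>card Z\<close>.\<close>

lemma sum_centred_squares:
  fixes a :: "'z \<Rightarrow> 'v \<Rightarrow> real" and s :: real
  assumes u0: "\<And>\<eta>. \<eta> \<in> \<Omega> \<Longrightarrow> u \<eta> \<ge> 0" and u1: "(\<Sum>\<eta>\<in>\<Omega>. u \<eta>) = 1"
    and Z: "finite Z" and s': "s \<ge> 0" and s: "\<And>z. z \<in> Z \<Longrightarrow> (\<Sum>x\<in>V. (a z x)\<^sup>2) \<le> s"
    and m: "m > 0" "\<And>x. x \<in> V \<Longrightarrow> card {z \<in> Z. a z x \<noteq> 0} \<le> m"
  shows "(\<Sum>\<eta>\<in>\<Omega>. u \<eta> * (\<Sum>z\<in>Z. (centred V r (a z) \<eta>)\<^sup>2)) \<le> K\<^sup>2 * s * (m * ent \<Omega> u \<nu> + card Z)"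
proof (cases "s = 0")
  case True
  have "a z x = 0" if "z \<in> Z" "x \<in> V" for z x
  proof -
    have "(a z x)\<^sup>2 \<le> (\<Sum>x\<in>V. (a z x)\<^sup>2)" using that V by (intro member_le_sum) auto
    also have "\<dots> \<le> 0" using s[OF that(1)] True by simp
    finally show ?thesis by simp
  qed
  then have "(\<Sum>z\<in>Z. (centred V r (a z) \<eta>)\<^sup>2) = 0" for \<eta> by (auto simp: centred_def)
  then show ?thesis using True by simp
next
  case False
  then have s0: "s > 0" using s' by simp
  \<comment> \<open>Chosen so that \<open>m * \<gamma>\<close> times the variance bound
    \<open>K^2 / 4 * s\<close> is the threshold 3/8 of
    \<open>subgaussian_exp_square\<close>.\<close>
  define \<gamma> where "\<gamma> = 3 / (2 * m * K\<^sup>2 * s)"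
  have \<gamma>: "\<gamma> > 0" using m s0 K by (simp add: \<gamma>_def)
  let ?X = "\<lambda>z. centred V r (a z)"
  let ?E = "measure_pmf.expectation (Pi_pmf V 0 (\<lambda>x. binomial_pmf K (r x / K)))"
  have each: "?E (\<lambda>\<eta>. exp (m * \<gamma> * (?X z \<eta>)\<^sup>2)) \<le> 2" if z: "z \<in> Z" for z
    unfolding expectation_product
  proof (rule subgaussian_exp_square[OF finite_\<Omega>])
    show "0 \<le> \<nu> \<eta>" if "\<eta> \<in> \<Omega>" for \<eta> using weight_pos[OF that] by simp
    show "(\<Sum>\<eta>\<in>\<Omega>. \<nu> \<eta> * exp (t * ?X z \<eta>)) \<le> exp (t\<^sup>2 * (K\<^sup>2 / 4 * (\<Sum>x\<in>V. (a z x)\<^sup>2)) / 2)" for t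
      by (rule centred_mgf)
    show "0 \<le> real m * \<gamma>" using \<gamma> by simp
    have "real m * \<gamma> * (K\<^sup>2 / 4 * (\<Sum>x\<in>V. (a z x)\<^sup>2)) \<le> real m * \<gamma> * (K\<^sup>2 / 4 * s)"
      using s[OF z] \<gamma> by (intro mult_left_mono) auto
    also have "\<dots> = 3 / 8" using m s0 K by (simp add: \<gamma>_def)
    finally show "real m * \<gamma> * (K\<^sup>2 / 4 * (\<Sum>x\<in>V. (a z x)\<^sup>2)) \<le> 3 / 8" .
  qed
  have pos: "?E (\<lambda>\<eta>. exp (m * \<gamma> * (?X z \<eta>)\<^sup>2)) \<ge> 0" for z by (intro Bochner_Integration.integral_nonneg) auto
  have q: "finite (set_pmf (binomial_pmf K (r x / K)))" if "x \<in> V" for x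
    using prob_bounds[OF that] by (intro finite_set_pmf_binomial_pmf) auto
  have "(\<Sum>\<eta>\<in>\<Omega>. \<nu> \<eta> * exp (\<gamma> * (\<Sum>z\<in>Z. (?X z \<eta>)\<^sup>2)))
      = ?E (\<lambda>\<eta>. \<Prod>z\<in>Z. exp (m * \<gamma> * (?X z \<eta>)\<^sup>2) powr (1 / m))"
    using Z m by (simp add: expectation_product exp_sum powr_def sum_distrib_left)
  also have "\<dots> \<le> (\<Prod>z\<in>Z. ?E (\<lambda>\<eta>. exp (m * \<gamma> * (?X z \<eta>)\<^sup>2)) powr (1 / m))"
  proof (rule Finner_Pi_pmf[where \<Lambda> = "\<lambda>z. {x \<in> V. a z x \<noteq> 0}", OF V Z])
    show "finite (set_pmf (binomial_pmf K (r x / K)))" if "x \<in> V" for x using that by (rule q)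
    show "exp (m * \<gamma> * (?X z (f(x := b)))\<^sup>2) = exp (m * \<gamma> * (?X z f)\<^sup>2)"
      if "z \<in> Z" "x \<notin> {x \<in> V. a z x \<noteq> 0}" for z f x b
    proof -
      have "?X z (f(x := b)) = ?X z f"
        unfolding centred_def using that by (intro sum.cong) auto
      then show ?thesis by simp
    qed
    show "card {z \<in> Z. x \<in> {x \<in> V. a z x \<noteq> 0}} \<le> m" if "x \<in> V" for x using m(2)[OF that] that by simp
  qed (use m in auto)
  also have "\<dots> \<le> (\<Prod>z\<in>Z. 2 powr (1 / m))"
    using each pos by (intro prod_mono conjI powr_mono2) auto
  also have "\<dots> = exp (card Z * ln 2 / m)"
    by (simp add: powr_def exp_of_nat_mult[symmetric])
  finally have mgf: "(\<Sum>\<eta>\<in>\<Omega>. \<nu> \<eta> * exp (\<gamma> * (\<Sum>z\<in>Z. (?X z \<eta>)\<^sup>2))) \<le> exp (card Z * ln 2 / m)" .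
  have "\<gamma> * (\<Sum>\<eta>\<in>\<Omega>. u \<eta> * (\<Sum>z\<in>Z. (?X z \<eta>)\<^sup>2)) = (\<Sum>\<eta>\<in>\<Omega>. u \<eta> * (\<gamma> * (\<Sum>z\<in>Z. (?X z \<eta>)\<^sup>2)))"
    by (simp add: sum_distrib_left mult_ac)
  also have "\<dots> \<le> ent \<Omega> u \<nu> + ln (\<Sum>\<eta>\<in>\<Omega>. \<nu> \<eta> * exp (\<gamma> * (\<Sum>z\<in>Z. (?X z \<eta>)\<^sup>2)))"
    by (rule entropy_inequality[OF finite_\<Omega> u0 u1 weight_pos])
  also have "\<dots> \<le> ent \<Omega> u \<nu> + card Z * ln 2 / m"
  proof -
    have "\<Omega> \<noteq> {}" using sum_weight by auto
    then have "0 < (\<Sum>\<eta>\<in>\<Omega>. \<nu> \<eta> * exp (\<gamma> * (\<Sum>z\<in>Z. (?X z \<eta>)\<^sup>2)))"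
      using weight_pos finite_\<Omega> by (intro sum_pos) auto
    then show ?thesis using mgf by (simp add: ln_le_cancel_iff[symmetric] del: ln_le_cancel_iff)
  qed
  also have "\<dots> \<le> ent \<Omega> u \<nu> + card Z / m"
    using ln_2_less_1 m by (intro add_left_mono divide_right_mono mult_left_le) auto
  finally have "(\<Sum>\<eta>\<in>\<Omega>. u \<eta> * (\<Sum>z\<in>Z. (?X z \<eta>)\<^sup>2)) \<le> (ent \<Omega> u \<nu> + card Z / m) / \<gamma>"
    using \<gamma> by (simp add: field_simps)
  also have "\<dots> = 2 / 3 * (K\<^sup>2 * s * (m * ent \<Omega> u \<nu> + card Z))"
    using m s0 K by (simp add: \<gamma>_def field_simps)
  also have "\<dots> \<le> 1 * (K\<^sup>2 * s * (m * ent \<Omega> u \<nu> + card Z))"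
    using s0 ent_nonneg[OF finite_\<Omega> u0 u1 weight_pos sum_weight]
    by (intro mult_right_mono mult_nonneg_nonneg add_nonneg_nonneg) auto
  finally show ?thesis by simp
qed

end

section \<open>Entropy production\<close>

text \<open>The body of \<open>move\<close> for an arbitrary type of sites;
  \<open>move_eq_hop\<close> identifies the two.\<close>

definition hop :: "'v \<Rightarrow> 'v \<Rightarrow> ('v \<Rightarrow> nat) \<Rightarrow> 'v \<Rightarrow> nat" where
  "hop x y \<eta> = (let \<eta>' = \<eta>(x := \<eta> x - 1) in \<eta>'(y := \<eta>' y + 1))"

lemma hop_apply: "x \<noteq> y \<Longrightarrow> hop x y \<eta> z = (if z = y then \<eta> y + 1 else if z = x then \<eta> x - 1 else \<eta> z)"
  by (simp add: hop_def Let_def)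

lemma hop_in_confs:
  "\<eta> \<in> confs K V \<Longrightarrow> x \<in> V \<Longrightarrow> y \<in> V \<Longrightarrow> x \<noteq> y \<Longrightarrow> \<eta> y < K \<Longrightarrow> hop x y \<eta> \<in> confs K V"
  by (auto simp: confs_mem hop_apply le_diff_conv intro: le_trans[OF diff_le_self])

lemma Suc_choose_mult: "j < n \<Longrightarrow> (n choose Suc j) * Suc j = (n choose j) * (n - j)"
  using binomial_absorption[of j n] binomial_absorb_comp[of n j] by (simp add: mult.commute)

text \<open>The ratio of consecutive binomial weights, partly freed of denominators; it is detailed
  balance at a single site.\<close>

lemma binomial_term_step:
  fixes q :: real
  assumes "j < n" "q < 1"
  shows "(n choose Suc j) * q ^ Suc j * (1 - q) ^ (n - Suc j) * Suc j
       = (n choose j) * q ^ j * (1 - q) ^ (n - j) * (real n - real j) * (q / (1 - q))"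
proof -
  have c: "real (n choose Suc j) * real (Suc j) = real (n choose j) * (real n - real j)"
    using Suc_choose_mult[OF assms(1)] assms(1)
    by (metis of_nat_mult of_nat_diff less_imp_le)
  have "n - j = Suc (n - Suc j)" using assms by simp
  then have p: "(1 - q) ^ (n - j) = (1 - q) * (1 - q) ^ (n - Suc j)" by simp
  have "(n choose Suc j) * q ^ Suc j * (1 - q) ^ (n - Suc j) * Suc j
      = (real (n choose Suc j) * real (Suc j)) * (q * q ^ j * (1 - q) ^ (n - Suc j))"
    by (simp only: power_Suc mult_ac)
  also have "\<dots> = (n choose j) * q ^ j * (1 - q) ^ (n - j) * (real n - real j) * (q / (1 - q))"
    unfolding c p using assms by simp
  finally show ?thesis .
qed

context binomial_product
begin

text \<open>The quotient of the fugacities \<open>r / (K - r)\<close> at the two sites. It is 1 for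
  equal densities and measures the failure of reversibility of the bond.\<close>

definition odds :: "'v \<Rightarrow> 'v \<Rightarrow> real" where
  "odds x y = (r x / (K - r x)) / (r y / (K - r y))"

lemma odds_pos: "x \<in> V \<Longrightarrow> y \<in> V \<Longrightarrow> odds x y > 0"
  using r[of x] r[of y] by (simp add: odds_def)

text \<open>Detailed balance up to the factor \<open>odds\<close>: the step between consecutive
  binomial weights is taken downwards at \<open>x\<close> and upwards at \<open>y\<close>, and all
  other factors agree.\<close>

lemma weight_hop:
  assumes xy: "x \<in> V" "y \<in> V" "x \<noteq> y" and \<eta>: "\<eta> \<in> \<Omega>" "\<eta> x > 0" "\<eta> y < K"
  shows "\<nu> \<eta> * (real (\<eta> x) * (K - real (\<eta> y)))
    = \<nu> (hop x y \<eta>) * ((K - real (hop x y \<eta> x)) * real (hop x y \<eta> y) * odds x y)"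
proof -
  define w where "w = (\<lambda>z k. real (K choose k) * (r z / K) ^ k * (1 - r z / K) ^ (K - k))"
  have ratio: "(r z / K) / (1 - r z / K) = r z / (K - r z)" if "z \<in> V" for z
    using r[OF that] K by (simp add: field_simps)
  have step: "w z (Suc j) * Suc j = w z j * (K - real j) * (r z / (K - r z))" if "z \<in> V" "j < K" for z j
    unfolding w_def using binomial_term_step[OF that(2), of "r z / K"] prob_bounds[OF that(1)] ratio[OF that(1)] by simp
  let ?\<eta>' = "hop x y \<eta>"
  have \<eta>': "?\<eta>' \<in> \<Omega>" using hop_in_confs \<eta> xy by metis
  obtain j where j: "\<eta> x = Suc j" using \<eta> by (cases "\<eta> x") auto
  have jK: "j < K" using confs_le[OF \<eta>(1), of x] j by simp
  have split: "\<nu> \<zeta> = w x (\<zeta> x) * w y (\<zeta> y) * (\<Prod>z\<in>V - {x, y}. w z (\<zeta> z))" if "\<zeta> \<in> \<Omega>" for \<zeta>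
  proof -
    have "\<nu> \<zeta> = (\<Prod>z\<in>V. w z (\<zeta> z))" using weight_eq[OF that] by (simp add: w_def)
    also have "\<dots> = w x (\<zeta> x) * (w y (\<zeta> y) * (\<Prod>z\<in>V - {x} - {y}. w z (\<zeta> z)))"
      using V xy by (subst prod.remove[of V x], simp, simp, subst prod.remove[of "V - {x}" y]) auto
    also have "V - {x} - {y} = V - {x, y}" by auto
    finally show ?thesis by (simp add: mult.assoc)
  qed
  have rest: "(\<Prod>z\<in>V - {x, y}. w z (?\<eta>' z)) = (\<Prod>z\<in>V - {x, y}. w z (\<eta> z))"
    using xy by (intro prod.cong) (auto simp: hop_apply)
  have x1: "w x (\<eta> x) * \<eta> x = w x (?\<eta>' x) * (K - real (?\<eta>' x)) * (r x / (K - r x))"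
    using step[OF xy(1) jK] xy by (simp add: hop_apply j)
  have y1: "w y (\<eta> y) * (K - real (\<eta> y)) = w y (?\<eta>' y) * ?\<eta>' y / (r y / (K - r y))"
    using step[OF xy(2) \<eta>(3)] xy r[OF xy(2)] by (simp add: hop_apply field_simps)
  have "\<nu> \<eta> * (real (\<eta> x) * (K - real (\<eta> y)))
    = (w x (\<eta> x) * \<eta> x) * (w y (\<eta> y) * (K - real (\<eta> y))) * (\<Prod>z\<in>V - {x, y}. w z (\<eta> z))"
    unfolding split[OF \<eta>(1)] by simp
  also have "\<dots> = \<nu> ?\<eta>' * ((K - real (?\<eta>' x)) * real (?\<eta>' y) * odds x y)"
    unfolding split[OF \<eta>'] x1 y1 rest odds_def by simp
  finally show ?thesis .
qed

text \<open>\<open>hop x y\<close> is a bijection from the configurations with a particle at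
  \<open>x\<close> and room at \<open>y\<close> onto those with a particle at \<open>y\<close> and
  room at \<open>x\<close>, with inverse \<open>hop y x\<close>. Elsewhere the rates vanish, so both
  sums may run over all of \<open>\<Omega>\<close>.\<close>

lemma change_of_variables:
  fixes G :: "('v \<Rightarrow> nat) \<Rightarrow> real"
  assumes xy: "x \<in> V" "y \<in> V" "x \<noteq> y"
  shows "(\<Sum>\<eta>\<in>\<Omega>. \<nu> \<eta> * (real (\<eta> x) * (K - real (\<eta> y))) * G (hop x y \<eta>))
    = (\<Sum>\<eta>\<in>\<Omega>. \<nu> \<eta> * ((K - real (\<eta> x)) * real (\<eta> y) * odds x y) * G \<eta>)"
proof -
  let ?A = "{\<eta> \<in> \<Omega>. \<eta> x > 0 \<and> \<eta> y < K}" and ?B = "{\<eta> \<in> \<Omega>. \<eta> y > 0 \<and> \<eta> x < K}"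
  have "(\<Sum>\<eta>\<in>\<Omega>. \<nu> \<eta> * (real (\<eta> x) * (K - real (\<eta> y))) * G (hop x y \<eta>))
     = (\<Sum>\<eta>\<in>?A. \<nu> \<eta> * (real (\<eta> x) * (K - real (\<eta> y))) * G (hop x y \<eta>))"
    using finite_\<Omega> by (intro sum.mono_neutral_right) (auto dest: confs_le[of _ K V y] simp: not_less le_antisym)
  also have "\<dots> = (\<Sum>\<eta>\<in>?B. \<nu> \<eta> * ((K - real (\<eta> x)) * real (\<eta> y) * odds x y) * G \<eta>)"
  proof (rule sum.reindex_bij_witness[where i = "hop y x" and j = "hop x y"])
    fix \<eta> assume \<eta>: "\<eta> \<in> ?A"
    then have "\<eta> x > 0" by simp
    show "hop y x (hop x y \<eta>) = \<eta>" using \<open>\<eta> x > 0\<close> xy by (auto simp: hop_apply fun_eq_iff)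
    have "\<eta> x - 1 < K" using \<open>\<eta> x > 0\<close> \<eta> confs_le[of \<eta> K V x] by auto
    then show "hop x y \<eta> \<in> ?B" using \<eta> xy hop_in_confs[of \<eta> K V x y] by (auto simp: hop_apply)
    show "\<nu> (hop x y \<eta>) * ((K - real (hop x y \<eta> x)) * real (hop x y \<eta> y) * odds x y) * G (hop x y \<eta>)
       = \<nu> \<eta> * (real (\<eta> x) * (K - real (\<eta> y))) * G (hop x y \<eta>)"
      using \<eta> weight_hop[OF xy, of \<eta>] by simp
  next
    fix \<eta> assume \<eta>: "\<eta> \<in> ?B"
    then have "\<eta> y > 0" by simp
    show "hop x y (hop y x \<eta>) = \<eta>" using \<open>\<eta> y > 0\<close> xy by (auto simp: hop_apply fun_eq_iff)
    have "\<eta> y - 1 < K" using \<open>\<eta> y > 0\<close> \<eta> confs_le[of \<eta> K V y] by auto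
    then show "hop y x \<eta> \<in> ?A" using \<eta> xy hop_in_confs[of \<eta> K V y x] by (auto simp: hop_apply)
  qed
  also have "\<dots> = (\<Sum>\<eta>\<in>\<Omega>. \<nu> \<eta> * ((K - real (\<eta> x)) * real (\<eta> y) * odds x y) * G \<eta>)"
    using finite_\<Omega> by (intro sum.mono_neutral_left) (auto dest: confs_le[of _ K V x] simp: not_less le_antisym)
  finally show ?thesis .
qed

text \<open>The Dirichlet form of the square root of the density, directed (jumps from
  \<open>x\<close> to \<open>y\<close> only) and without the factor \<open>p\<close>.\<close>

definition dirichlet :: "(('v \<Rightarrow> nat) \<Rightarrow> real) \<Rightarrow> 'v \<Rightarrow> 'v \<Rightarrow> real" where
  "dirichlet u x y = (\<Sum>\<eta>\<in>\<Omega>. \<nu> \<eta> * (real (\<eta> x) * (K - real (\<eta> y))) *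
     (sqrt (u (hop x y \<eta>) / \<nu> (hop x y \<eta>)) - sqrt (u \<eta> / \<nu> \<eta>))\<^sup>2)"

lemma rate_nonneg: "\<eta> \<in> \<Omega> \<Longrightarrow> 0 \<le> real (\<eta> x) * (K - real (\<eta> y))"
  using confs_le[of \<eta> K V y] by simp

lemma rate_le: "\<eta> \<in> \<Omega> \<Longrightarrow> real (\<eta> x) * (K - real (\<eta> y)) \<le> K\<^sup>2"
  using confs_le[of \<eta> K V x] confs_le[of \<eta> K V y] unfolding power2_eq_square of_nat_mult by (intro mult_mono) auto

lemma dirichlet_nonneg: "dirichlet u x y \<ge> 0"
  unfolding dirichlet_def
  by (rule sum_nonneg, rule mult_nonneg_nonneg, rule mult_nonneg_nonneg, rule less_imp_le[OF weight_pos])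
    (auto intro: rate_nonneg)

text \<open>Pointwise, \<open>a (ln b - ln a) \<le> 2 \<surd>a (\<surd>b - \<surd>a) = - (\<surd>b - \<surd>a)\<^sup>2 + (b - a)\<close>.\<close>

lemma log_increment_le:
  fixes a b :: real
  assumes "a > 0" "b > 0"
  shows "a * (ln b - ln a) \<le> - (sqrt b - sqrt a)\<^sup>2 + (b - a)"
proof -
  have "ln (sqrt b / sqrt a) \<le> sqrt b / sqrt a - 1"
    using assms by (intro ln_le_minus_one) simp
  then have "(ln b - ln a) \<le> 2 * (sqrt b / sqrt a - 1)"
    using assms by (simp add: ln_div ln_sqrt)
  then have "a * (ln b - ln a) \<le> a * (2 * (sqrt b / sqrt a - 1))"
    using assms by (intro mult_left_mono) auto
  also have "\<dots> = 2 * (sqrt a * sqrt b - a)"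
    using assms by (simp add: field_simps)
  also have "\<dots> = - (sqrt b - sqrt a)\<^sup>2 + (b - a)"
    using assms by (simp add: power2_diff)
  finally show ?thesis .
qed

text \<open>The logarithmic inequality leaves the Dirichlet form and a plain increment of the
  density. A change of variables moves this increment onto the rates, where it becomes the adjoint
  of the bond generator applied to the constant 1.\<close>

lemma entropy_production:
  assumes xy: "x \<in> V" "y \<in> V" "x \<noteq> y" and u: "\<And>\<eta>. \<eta> \<in> \<Omega> \<Longrightarrow> u \<eta> > 0"
  shows "(\<Sum>\<eta>\<in>\<Omega>. u \<eta> * (real (\<eta> x) * (K - real (\<eta> y))) *
            (ln (u (hop x y \<eta>) / \<nu> (hop x y \<eta>)) - ln (u \<eta> / \<nu> \<eta>)))
    \<le> - dirichlet u x y + (\<Sum>\<eta>\<in>\<Omega>. u \<eta> * ((K - real (\<eta> x)) * real (\<eta> y) * odds x y - real (\<eta> x) * (K - real (\<eta> y))))"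
proof -
  define f where "f = (\<lambda>\<eta>. u \<eta> / \<nu> \<eta>)"
  have uf: "u \<eta> = \<nu> \<eta> * f \<eta>" "f \<eta> > 0" if "\<eta> \<in> \<Omega>" for \<eta>
    using u[OF that] weight_pos[OF that] by (auto simp: f_def)
  let ?c = "\<lambda>\<eta>. real (\<eta> x) * (K - real (\<eta> y))"
  have "(\<Sum>\<eta>\<in>\<Omega>. u \<eta> * ?c \<eta> * (ln (f (hop x y \<eta>)) - ln (f \<eta>)))
     \<le> (\<Sum>\<eta>\<in>\<Omega>. \<nu> \<eta> * ?c \<eta> * (- (sqrt (f (hop x y \<eta>)) - sqrt (f \<eta>))\<^sup>2 + (f (hop x y \<eta>) - f \<eta>)))"
  proof (intro sum_mono)
    fix \<eta> assume \<eta>: "\<eta> \<in> \<Omega>"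
    show "u \<eta> * ?c \<eta> * (ln (f (hop x y \<eta>)) - ln (f \<eta>))
       \<le> \<nu> \<eta> * ?c \<eta> * (- (sqrt (f (hop x y \<eta>)) - sqrt (f \<eta>))\<^sup>2 + (f (hop x y \<eta>) - f \<eta>))"
    \<comment> \<open>If \<open>y\<close> is full, the hop leaves \<open>\<Omega>\<close>, where
      nothing is known about the sign of \<open>u\<close>, but the rate vanishes. An empty
      \<open>x\<close> is harmless: truncated subtraction keeps the result in
      \<open>\<Omega>\<close>.\<close>
    proof (cases "\<eta> y < K")
      case True
      have "f (hop x y \<eta>) > 0" by (intro uf hop_in_confs \<eta> xy True)
      then have "\<nu> \<eta> * ?c \<eta> * (f \<eta> * (ln (f (hop x y \<eta>)) - ln (f \<eta>)))
         \<le> \<nu> \<eta> * ?c \<eta> * (- (sqrt (f (hop x y \<eta>)) - sqrt (f \<eta>))\<^sup>2 + (f (hop x y \<eta>) - f \<eta>))"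
        using uf[OF \<eta>] rate_nonneg[OF \<eta>] weight_pos[OF \<eta>]
        by (intro mult_left_mono log_increment_le) (auto simp: less_imp_le)
      then show ?thesis unfolding uf(1)[OF \<eta>] by (simp add: mult_ac)
    next
      case False
      then show ?thesis using confs_le[OF \<eta>, of y] by (simp add: not_less)
    qed
  qed
  also have "\<dots> = - dirichlet u x y + ((\<Sum>\<eta>\<in>\<Omega>. \<nu> \<eta> * ?c \<eta> * f (hop x y \<eta>)) - (\<Sum>\<eta>\<in>\<Omega>. \<nu> \<eta> * ?c \<eta> * f \<eta>))"
    unfolding dirichlet_def f_def by (simp add: algebra_simps sum.distrib sum_subtractf sum_negf)
  also have "(\<Sum>\<eta>\<in>\<Omega>. \<nu> \<eta> * ?c \<eta> * f (hop x y \<eta>)) - (\<Sum>\<eta>\<in>\<Omega>. \<nu> \<eta> * ?c \<eta> * f \<eta>)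
     = (\<Sum>\<eta>\<in>\<Omega>. u \<eta> * ((K - real (\<eta> x)) * real (\<eta> y) * odds x y - ?c \<eta>))"
    unfolding change_of_variables[OF xy] sum_subtractf[symmetric] using uf(1)
    by (intro sum.cong) (auto simp: algebra_simps)
  finally show ?thesis by (simp add: f_def)
qed

text \<open>Exact, since the rates are bilinear in the two occupation numbers; there is no constant
  term because the two rates agree at \<open>\<eta> = r\<close>. The variables
  \<open>K * \<omega> / (r * (K - r))\<close> are the derivatives of the logarithmic weight in the
  density, which is why the time derivative of the profile can cancel the linear part.\<close>

lemma flux_expansion:
  fixes \<eta> \<omega> :: "'v \<Rightarrow> real"
  assumes xy: "x \<in> V" "y \<in> V"
  defines "\<omega> \<equiv> \<lambda>z. \<eta> z - r z"
  shows "(K - \<eta> x) * \<eta> y * odds x y - \<eta> x * (K - \<eta> y)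
    = r x * (K - r y) * (K * \<omega> y / (r y * (K - r y)) - K * \<omega> x / (r x * (K - r x))) + (1 - odds x y) * (\<omega> x * \<omega> y)"
proof -
  define a b where "a = r x" and "b = r y"
  have ab: "a > 0" "b > 0" "K - a > 0" "K - b > 0" using r[OF xy(1)] r[OF xy(2)] by (auto simp: a_def b_def)
  define s t where "s = \<omega> x" and "t = \<omega> y"
  have e: "\<eta> x = a + s" "\<eta> y = b + t" by (auto simp: a_def b_def s_def t_def \<omega>_def)
  define A B where "A = K - a" and "B = K - b"
  have K': "K = A + a" "K = B + b" by (auto simp: A_def B_def)
  have pos: "A > 0" "B > 0" using ab by (auto simp: A_def B_def)
  have o: "odds x y = a * B / (A * b)"
    unfolding odds_def a_def[symmetric] b_def[symmetric] A_def B_def by simp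
  \<comment> \<open>Rescaled deviations that clear the denominators of \<open>odds\<close>, after
    which the identities are polynomial.\<close>
  define s' t' where "s' = s / A" and "t' = t / b"
  have st: "s = A * s'" "t = b * t'" using pos ab by (auto simp: s'_def t'_def)
  have "K - \<eta> x = A - s" "K - \<eta> y = B - t" using e K' by auto
  then have "(K - \<eta> x) * \<eta> y * odds x y - \<eta> x * (K - \<eta> y) = (A - s) * (b + t) * (a * B / (A * b)) - (a + s) * (B - t)"
    unfolding \<open>K - \<eta> x = A - s\<close> \<open>K - \<eta> y = B - t\<close> unfolding e o by simp
  also have "(A - s) * (b + t) * (a * B / (A * b)) = (1 - s') * (1 + t') * (a * B)"
  proof -
    have "(A - s) * (b + t) = (1 - s') * (1 + t') * (A * b)" unfolding st by algebra
    then show ?thesis using pos ab by simp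
  qed
  also have "\<dots> - (a + s) * (B - t) = a * ((B + b) * t') - B * ((A + a) * s') + (s * t - a * B * (s' * t'))"
    unfolding st by algebra
  also have "a * ((B + b) * t') = r x * (K - r y) * (K * \<omega> y / (r y * (K - r y)))"
    unfolding a_def[symmetric] b_def[symmetric] s_def[symmetric] t_def[symmetric] A_def[symmetric] B_def[symmetric] K'(2)[symmetric]
    using pos ab by (simp add: t'_def)
  also have "B * ((A + a) * s') = r x * (K - r y) * (K * \<omega> x / (r x * (K - r x)))"
    unfolding a_def[symmetric] b_def[symmetric] s_def[symmetric] t_def[symmetric] A_def[symmetric] B_def[symmetric] K'(1)[symmetric]
    using pos ab by (simp add: s'_def)
  also have "s * t - a * B * (s' * t') = (1 - odds x y) * (\<omega> x * \<omega> y)"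
    unfolding o s_def[symmetric] t_def[symmetric] s'_def t'_def by (simp add: algebra_simps)
  finally show ?thesis by (simp add: algebra_simps)
qed

text \<open>By \<open>(K - \<eta> x) * \<eta> y - \<eta> x * (K - \<eta> y) = K * (\<eta> y - \<eta>
  x)\<close> the left-hand side contains a difference of reversed and direct rates. As
  \<open>h\<close> does not see the hop, a change of variables turns it into an increment of the
  density, hence a product \<open>(s - t) * (s + t)\<close> of square roots, which is split between
  the Dirichlet form and \<open>h^2\<close>. The term with \<theta> pays for replacing
  \<open>odds\<close> by 1.\<close>

lemma integration_by_parts:
  fixes h :: "('v \<Rightarrow> nat) \<Rightarrow> real" and A \<theta> :: real
  assumes xy: "x \<in> V" "y \<in> V" "x \<noteq> y" and u: "\<And>\<eta>. \<eta> \<in> \<Omega> \<Longrightarrow> u \<eta> > 0"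
    and h: "\<And>\<eta>. h (hop x y \<eta>) = h \<eta>" and A: "A > 0"
    and \<theta>: "\<bar>odds x y - 1\<bar> \<le> \<theta>" "\<theta> \<le> 1"
  shows "K * (\<Sum>\<eta>\<in>\<Omega>. u \<eta> * h \<eta> * (real (\<eta> y) - real (\<eta> x)))
    \<le> A / 2 * dirichlet u x y + 3 * K\<^sup>2 / A * (\<Sum>\<eta>\<in>\<Omega>. u \<eta> * (h \<eta>)\<^sup>2) + K\<^sup>2 * \<theta> * (\<Sum>\<eta>\<in>\<Omega>. u \<eta> * \<bar>h \<eta>\<bar>)"
proof -
  define f where "f = (\<lambda>\<eta>. u \<eta> / \<nu> \<eta>)"
  have uf: "u \<eta> = \<nu> \<eta> * f \<eta>" "f \<eta> > 0" if "\<eta> \<in> \<Omega>" for \<eta>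
    using u[OF that] weight_pos[OF that] by (auto simp: f_def)
  let ?c = "\<lambda>\<eta>. real (\<eta> x) * (K - real (\<eta> y))" and ?d = "\<lambda>\<eta>. (K - real (\<eta> x)) * real (\<eta> y)" and ?R = "odds x y"
  have D: "dirichlet u x y = (\<Sum>\<eta>\<in>\<Omega>. \<nu> \<eta> * ?c \<eta> * (sqrt (f (hop x y \<eta>)) - sqrt (f \<eta>))\<^sup>2)"
    by (simp add: dirichlet_def f_def)
  have ring: "p * (a * s + q * b * (t' + t)) = a * (p * s) + b * (p * (q * t') + p * (q * t))" for p a s q b t' t :: real
    by (simp add: algebra_simps)
  have cv1: "(\<Sum>\<eta>\<in>\<Omega>. \<nu> \<eta> * ?c \<eta> * (h \<eta> * f (hop x y \<eta>))) = (\<Sum>\<eta>\<in>\<Omega>. u \<eta> * h \<eta> * (?d \<eta> * ?R))"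
    using change_of_variables[OF xy, of "\<lambda>\<eta>. h \<eta> * f \<eta>"] uf(1) by (simp add: h mult_ac cong: sum.cong)
  have cv2: "(\<Sum>\<eta>\<in>\<Omega>. \<nu> \<eta> * ?c \<eta> * ((h \<eta>)\<^sup>2 * f (hop x y \<eta>))) = (\<Sum>\<eta>\<in>\<Omega>. u \<eta> * (h \<eta>)\<^sup>2 * (?d \<eta> * ?R))"
    using change_of_variables[OF xy, of "\<lambda>\<eta>. (h \<eta>)\<^sup>2 * f \<eta>"] uf(1) by (simp add: h mult_ac cong: sum.cong)
  have d: "0 \<le> ?d \<eta>" "?d \<eta> \<le> K\<^sup>2" if "\<eta> \<in> \<Omega>" for \<eta>
    using rate_nonneg[OF that, of y x] rate_le[OF that, of y x] by (auto simp: mult.commute)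
  have "K * (\<Sum>\<eta>\<in>\<Omega>. u \<eta> * h \<eta> * (real (\<eta> y) - real (\<eta> x)))
      = (\<Sum>\<eta>\<in>\<Omega>. u \<eta> * h \<eta> * (?d \<eta> * ?R)) - (\<Sum>\<eta>\<in>\<Omega>. u \<eta> * h \<eta> * ?c \<eta>)
       - (?R - 1) * (\<Sum>\<eta>\<in>\<Omega>. u \<eta> * h \<eta> * ?d \<eta>)"
    unfolding sum_distrib_left sum_subtractf[symmetric] by (intro sum.cong) (auto simp: algebra_simps)
  moreover have "(\<Sum>\<eta>\<in>\<Omega>. u \<eta> * h \<eta> * ?c \<eta>) = (\<Sum>\<eta>\<in>\<Omega>. \<nu> \<eta> * ?c \<eta> * (h \<eta> * f \<eta>))"
    using uf(1) by (intro sum.cong) (auto simp: mult_ac)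
  moreover have "(\<Sum>\<eta>\<in>\<Omega>. u \<eta> * h \<eta> * (?d \<eta> * ?R)) - (\<Sum>\<eta>\<in>\<Omega>. \<nu> \<eta> * ?c \<eta> * (h \<eta> * f \<eta>))
     = (\<Sum>\<eta>\<in>\<Omega>. \<nu> \<eta> * ?c \<eta> * (h \<eta> * (f (hop x y \<eta>) - f \<eta>)))"
    unfolding cv1[symmetric] sum_subtractf[symmetric] by (intro sum.cong) (auto simp: algebra_simps)
  ultimately have identity: "K * (\<Sum>\<eta>\<in>\<Omega>. u \<eta> * h \<eta> * (real (\<eta> y) - real (\<eta> x)))
      = (\<Sum>\<eta>\<in>\<Omega>. \<nu> \<eta> * ?c \<eta> * (h \<eta> * (f (hop x y \<eta>) - f \<eta>))) - (?R - 1) * (\<Sum>\<eta>\<in>\<Omega>. u \<eta> * h \<eta> * ?d \<eta>)"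
    by linarith
  have "(\<Sum>\<eta>\<in>\<Omega>. \<nu> \<eta> * ?c \<eta> * (h \<eta> * (f (hop x y \<eta>) - f \<eta>)))
     \<le> (\<Sum>\<eta>\<in>\<Omega>. \<nu> \<eta> * ?c \<eta> * (A / 2 * (sqrt (f (hop x y \<eta>)) - sqrt (f \<eta>))\<^sup>2 + (h \<eta>)\<^sup>2 * (1 / A) * (f (hop x y \<eta>) + f \<eta>)))"
  proof (intro sum_mono)
    fix \<eta> assume \<eta>: "\<eta> \<in> \<Omega>"
    show "\<nu> \<eta> * ?c \<eta> * (h \<eta> * (f (hop x y \<eta>) - f \<eta>))
       \<le> \<nu> \<eta> * ?c \<eta> * (A / 2 * (sqrt (f (hop x y \<eta>)) - sqrt (f \<eta>))\<^sup>2 + (h \<eta>)\<^sup>2 * (1 / A) * (f (hop x y \<eta>) + f \<eta>))"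
    proof (cases "\<eta> y < K")
      case True
      have f': "f (hop x y \<eta>) > 0" by (intro uf hop_in_confs \<eta> xy True)
      define s t where "s = sqrt (f (hop x y \<eta>))" and "t = sqrt (f \<eta>)"
      have st: "f (hop x y \<eta>) = s\<^sup>2" "f \<eta> = t\<^sup>2" using f' uf[OF \<eta>] by (auto simp: s_def t_def)
      \<comment> \<open>These two squares add up to the difference between the two sides of the
        desired inequality.\<close>
      have "0 \<le> (A * (s - t) - h \<eta> * (s + t))\<^sup>2 / (2 * A) + (h \<eta>)\<^sup>2 * (s - t)\<^sup>2 / (2 * A)"
        using A by simp
      also have "\<dots> = A / 2 * (s - t)\<^sup>2 + (h \<eta>)\<^sup>2 / A * (s\<^sup>2 + t\<^sup>2) - h \<eta> * (s\<^sup>2 - t\<^sup>2)"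
      proof -
        have "(A * (s - t) - h \<eta> * (s + t))\<^sup>2 + (h \<eta>)\<^sup>2 * (s - t)\<^sup>2
            = 2 * A * (A / 2 * (s - t)\<^sup>2 - h \<eta> * (s\<^sup>2 - t\<^sup>2)) + 2 * ((h \<eta>)\<^sup>2 * (s\<^sup>2 + t\<^sup>2))"
          by (simp add: power2_eq_square algebra_simps)
        then show ?thesis using A unfolding add_divide_distrib[symmetric] by (simp add: add_divide_distrib)
      qed
      finally have "h \<eta> * (f (hop x y \<eta>) - f \<eta>) \<le> A / 2 * (s - t)\<^sup>2 + (h \<eta>)\<^sup>2 * (1 / A) * (f (hop x y \<eta>) + f \<eta>)"
        by (simp add: st)
      then show ?thesis using rate_nonneg[OF \<eta>] weight_pos[OF \<eta>] unfolding s_def t_def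
        by (intro mult_left_mono) (auto simp: less_imp_le)
    next
      case False
      then show ?thesis using confs_le[OF \<eta>, of y] by (simp add: not_less)
    qed
  qed
  also have "\<dots> = (\<Sum>\<eta>\<in>\<Omega>. A / 2 * (\<nu> \<eta> * ?c \<eta> * (sqrt (f (hop x y \<eta>)) - sqrt (f \<eta>))\<^sup>2)
      + 1 / A * (\<nu> \<eta> * ?c \<eta> * ((h \<eta>)\<^sup>2 * f (hop x y \<eta>)) + \<nu> \<eta> * ?c \<eta> * ((h \<eta>)\<^sup>2 * f \<eta>)))"
    by (intro sum.cong refl ring)
  also have "\<dots> = A / 2 * dirichlet u x y
      + 1 / A * ((\<Sum>\<eta>\<in>\<Omega>. \<nu> \<eta> * ?c \<eta> * ((h \<eta>)\<^sup>2 * f (hop x y \<eta>))) + (\<Sum>\<eta>\<in>\<Omega>. \<nu> \<eta> * ?c \<eta> * ((h \<eta>)\<^sup>2 * f \<eta>)))"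
    by (simp only: D sum.distrib sum_distrib_left[symmetric])
  also have "(\<Sum>\<eta>\<in>\<Omega>. \<nu> \<eta> * ?c \<eta> * ((h \<eta>)\<^sup>2 * f (hop x y \<eta>))) + (\<Sum>\<eta>\<in>\<Omega>. \<nu> \<eta> * ?c \<eta> * ((h \<eta>)\<^sup>2 * f \<eta>))
     = (\<Sum>\<eta>\<in>\<Omega>. u \<eta> * (h \<eta>)\<^sup>2 * (?d \<eta> * ?R + ?c \<eta>))"
    unfolding cv2 sum.distrib[symmetric] using uf(1) by (intro sum.cong) (auto simp: algebra_simps)
  finally have incr: "(\<Sum>\<eta>\<in>\<Omega>. \<nu> \<eta> * ?c \<eta> * (h \<eta> * (f (hop x y \<eta>) - f \<eta>)))
     \<le> A / 2 * dirichlet u x y + 1 / A * (\<Sum>\<eta>\<in>\<Omega>. u \<eta> * (h \<eta>)\<^sup>2 * (?d \<eta> * ?R + ?c \<eta>))" .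
  \<comment> \<open>Since \<open>odds\<close> is at most 2 by \<open>\<theta> \<le> 1\<close>, the
    bracket is at most 2 + 1 times \<open>K^2\<close>.\<close>
  have "(\<Sum>\<eta>\<in>\<Omega>. u \<eta> * (h \<eta>)\<^sup>2 * (?d \<eta> * ?R + ?c \<eta>)) \<le> (\<Sum>\<eta>\<in>\<Omega>. u \<eta> * (h \<eta>)\<^sup>2 * (3 * K\<^sup>2))"
  proof (intro sum_mono mult_left_mono)
    fix \<eta> assume \<eta>: "\<eta> \<in> \<Omega>"
    have "?d \<eta> * ?R \<le> real (K\<^sup>2) * 2" using d[OF \<eta>] \<theta> odds_pos[OF xy(1,2)] by (intro mult_mono) auto
    then show "?d \<eta> * ?R + ?c \<eta> \<le> 3 * K\<^sup>2" using rate_le[OF \<eta>, of x y] by simp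
    show "0 \<le> u \<eta> * (h \<eta>)\<^sup>2" using u[OF \<eta>] by simp
  qed
  also have "\<dots> = 3 * K\<^sup>2 * (\<Sum>\<eta>\<in>\<Omega>. u \<eta> * (h \<eta>)\<^sup>2)" by (simp add: sum_distrib_left mult_ac)
  finally have "1 / A * (\<Sum>\<eta>\<in>\<Omega>. u \<eta> * (h \<eta>)\<^sup>2 * (?d \<eta> * ?R + ?c \<eta>)) \<le> 1 / A * (3 * K\<^sup>2 * (\<Sum>\<eta>\<in>\<Omega>. u \<eta> * (h \<eta>)\<^sup>2))"
    using A by (intro mult_left_mono) auto
  with incr identity have main: "K * (\<Sum>\<eta>\<in>\<Omega>. u \<eta> * h \<eta> * (real (\<eta> y) - real (\<eta> x)))
     \<le> A / 2 * dirichlet u x y + 1 / A * (3 * K\<^sup>2 * (\<Sum>\<eta>\<in>\<Omega>. u \<eta> * (h \<eta>)\<^sup>2)) - (?R - 1) * (\<Sum>\<eta>\<in>\<Omega>. u \<eta> * h \<eta> * ?d \<eta>)"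
    by linarith
  have "- ((?R - 1) * (\<Sum>\<eta>\<in>\<Omega>. u \<eta> * h \<eta> * ?d \<eta>)) \<le> \<bar>?R - 1\<bar> * \<bar>\<Sum>\<eta>\<in>\<Omega>. u \<eta> * h \<eta> * ?d \<eta>\<bar>"
    by (simp add: abs_mult[symmetric])
  also have "\<dots> \<le> \<theta> * (\<Sum>\<eta>\<in>\<Omega>. u \<eta> * \<bar>h \<eta>\<bar> * K\<^sup>2)"
  proof (intro mult_mono \<theta> order_trans[OF sum_abs] sum_mono)
    fix \<eta> assume \<eta>: "\<eta> \<in> \<Omega>"
    have "\<bar>u \<eta> * h \<eta> * ?d \<eta>\<bar> = u \<eta> * \<bar>h \<eta>\<bar> * ?d \<eta>"
      using u[OF \<eta>] abs_of_nonneg[OF d(1)[OF \<eta>]] unfolding abs_mult[of "u \<eta> * h \<eta>"] abs_mult[of "u \<eta>"] by simp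
    also have "\<dots> \<le> u \<eta> * \<bar>h \<eta>\<bar> * K\<^sup>2" using u[OF \<eta>] d[OF \<eta>] by (intro mult_left_mono) auto
    finally show "\<bar>u \<eta> * h \<eta> * ?d \<eta>\<bar> \<le> u \<eta> * \<bar>h \<eta>\<bar> * K\<^sup>2" .
  qed (use \<theta> in auto)
  also have "\<dots> = K\<^sup>2 * \<theta> * (\<Sum>\<eta>\<in>\<Omega>. u \<eta> * \<bar>h \<eta>\<bar>)" by (simp add: sum_distrib_left mult_ac)
  finally show ?thesis using main by simp
qed

end

section \<open>Transport from a point to a cube\<close>

text \<open>Unequal sides occur at intermediate stages, when a cube is doubled one direction at a
  time.\<close>

definition int_box :: "('d \<Rightarrow> nat) \<Rightarrow> (int ^ 'd::finite) set" where
  "int_box L = {w. \<forall>i. w $ i \<in> {0..<int (L i)}}"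

lemma sites_eq_int_box: "sites l = int_box (\<lambda>_. l)"
  by (simp add: sites_def int_box_def)

lemma int_box_bij: "bij_betw vec_lambda (PiE UNIV (\<lambda>i. {0..<int (L i)})) (int_box L)"
  by (rule bij_betwI[where g = "vec_nth"]) (auto simp: int_box_def PiE_def)

lemma finite_int_box [simp]: "finite (int_box L)"
  using bij_betw_finite[OF int_box_bij[of L]] by (auto intro: finite_PiE)

lemma card_int_box: "card (int_box L) = (\<Prod>i\<in>UNIV. L i)"
  using bij_betw_same_card[OF int_box_bij[of L]] by (simp add: card_PiE)

lemma finite_sites [simp]: "finite (sites N :: (int ^ 'd::finite) set)"
  by (simp add: sites_eq_int_box)

lemma card_sites: "card (sites N :: (int ^ 'd::finite) set) = N ^ CARD('d)"
  by (simp add: sites_eq_int_box card_int_box)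

definition avg :: "'a set \<Rightarrow> ('a \<Rightarrow> real) \<Rightarrow> real" where
  "avg B g = (\<Sum>w\<in>B. g w) / card B"

text \<open>\<open>has_flow B B' S c\<close>: the uniform mass on \<open>B\<close> can be transported to the uniform mass on \<open>B'\<close>
  along the bonds starting in \<open>S\<close> by a flow of \<open>L\<^sup>2\<close>-norm at most \<open>c\<close>; the divergence equation is
  stated in its dual form.\<close>

definition has_flow :: "(int ^ 'd::finite) set \<Rightarrow> (int ^ 'd) set \<Rightarrow> (int ^ 'd) set \<Rightarrow> real \<Rightarrow> bool" where
  "has_flow B B' S c \<longleftrightarrow> (\<exists>\<phi>. L2_set (\<lambda>jv. \<phi> (fst jv) (snd jv)) (UNIV \<times> S) \<le> c \<and>
     (\<forall>g. avg B g - avg B' g = (\<Sum>j\<in>UNIV. \<Sum>v\<in>S. \<phi> j v * (g v - g (v + axis j 1)))))"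

lemma has_flow_refl: "has_flow B B S 0"
  unfolding has_flow_def by (rule exI[of _ "\<lambda>_ _. 0"]) (simp add: case_prod_beta L2_set_def)

text \<open>Flows add up and Minkowski's inequality adds their norms; this is why
  \<open>has_flow\<close> bounds the norm and not its square.\<close>

lemma has_flow_trans:
  assumes "has_flow B B' S c" "has_flow B' B'' S c'"
  shows "has_flow B B'' S (c + c')"
proof -
  obtain \<phi> \<psi> where \<phi>: "L2_set (\<lambda>jv. \<phi> (fst jv) (snd jv)) (UNIV \<times> S) \<le> c"
     "\<And>g. avg B g - avg B' g = (\<Sum>j\<in>UNIV. \<Sum>v\<in>S. \<phi> j v * (g v - g (v + axis j 1)))"
   and \<psi>: "L2_set (\<lambda>jv. \<psi> (fst jv) (snd jv)) (UNIV \<times> S) \<le> c'"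
     "\<And>g. avg B' g - avg B'' g = (\<Sum>j\<in>UNIV. \<Sum>v\<in>S. \<psi> j v * (g v - g (v + axis j 1)))"
    using assms unfolding has_flow_def by blast
  have "L2_set (\<lambda>jv. \<phi> (fst jv) (snd jv) + \<psi> (fst jv) (snd jv)) (UNIV \<times> S) \<le> c + c'"
    using L2_set_triangle_ineq[of "\<lambda>jv. \<phi> (fst jv) (snd jv)" "\<lambda>jv. \<psi> (fst jv) (snd jv)" "UNIV \<times> S"] \<phi>(1) \<psi>(1)
    by simp
  moreover have "avg B g - avg B'' g = (\<Sum>j\<in>UNIV. \<Sum>v\<in>S. (\<phi> j v + \<psi> j v) * (g v - g (v + axis j 1)))" for g
    using \<phi>(2)[of g] \<psi>(2)[of g] by (simp add: distrib_right sum.distrib)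
  ultimately show ?thesis unfolding has_flow_def by (intro exI[of _ "\<lambda>j v. \<phi> j v + \<psi> j v"]) auto
qed

lemma has_flow_mono:
  assumes "has_flow B B' S c" "S \<subseteq> S'" "finite S'" "c \<le> c'"
  shows "has_flow B B' S' c'"
proof -
  obtain \<phi> where \<phi>: "L2_set (\<lambda>jv. \<phi> (fst jv) (snd jv)) (UNIV \<times> S) \<le> c"
     "\<And>g. avg B g - avg B' g = (\<Sum>j\<in>UNIV. \<Sum>v\<in>S. \<phi> j v * (g v - g (v + axis j 1)))"
    using assms unfolding has_flow_def by blast
  define \<psi> where "\<psi> = (\<lambda>j v. if v \<in> S then \<phi> j v else 0)"
  have "(\<Sum>(j, v)\<in>UNIV \<times> S'. (\<psi> j v)\<^sup>2) = (\<Sum>(j, v)\<in>UNIV \<times> S. (\<phi> j v)\<^sup>2)"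
    using assms(2,3) by (intro sum.mono_neutral_cong_right) (auto simp: \<psi>_def split: if_splits)
  then have "L2_set (\<lambda>jv. \<psi> (fst jv) (snd jv)) (UNIV \<times> S') \<le> c'"
    using \<phi>(1) assms(4) by (simp add: L2_set_def case_prod_beta)
  moreover have "(\<Sum>v\<in>S. \<phi> j v * (g v - g (v + axis j 1))) = (\<Sum>v\<in>S'. \<psi> j v * (g v - g (v + axis j 1)))" for j g
    using assms(2,3) by (intro sum.mono_neutral_cong_left) (auto simp: \<psi>_def)
  ultimately show ?thesis unfolding has_flow_def using \<phi>(2) by (intro exI[of _ \<psi>]) auto
qed

text \<open>Each point sends half of its mass in a straight line to its translate by
  \<open>L j\<close>. A bond is used by at most \<open>L j\<close> of these paths, each carrying
  mass \<open>1 / (2 * card B)\<close>, and the paths run along bonds of one direction starting in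
  the doubled box, which has \<open>2 * card B\<close> points. This bounds the energy.\<close>

lemma double_side_flow:
  fixes L :: "'d::finite \<Rightarrow> nat"
  assumes L: "\<And>i. L i > 0"
  shows "has_flow (int_box L) (int_box (L(j := 2 * L j))) (int_box (L(j := 2 * L j))) (sqrt ((L j)\<^sup>2 / card (int_box L)))"
proof -
  define a where "a = L j"
  define B where "B = int_box L"
  define B' where "B' = int_box (L(j := 2 * L j))"
  let ?e = "axis j 1 :: int ^ 'd"
  have sh: "(r *s ?e) $ i = (if i = j then r else 0)" for r i by (simp add: axis_def)
  have cB: "card B > 0" using L unfolding B_def card_int_box by (simp add: prod_pos)
  have BB: "B' = B \<union> (\<lambda>w. w + int a *s ?e) ` B" "B \<inter> (\<lambda>w. w + int a *s ?e) ` B = {}"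
  proof -
    have "v \<in> B' \<longleftrightarrow> v \<in> B \<or> v - int a *s ?e \<in> B" for v
    proof -
      have "v \<in> B' \<longleftrightarrow> (\<forall>i. i \<noteq> j \<longrightarrow> v $ i \<in> {0..<int (L i)}) \<and> v $ j \<in> {0..<2 * int a}"
        by (auto simp: B'_def int_box_def a_def)
      moreover have "v \<in> B \<longleftrightarrow> (\<forall>i. i \<noteq> j \<longrightarrow> v $ i \<in> {0..<int (L i)}) \<and> v $ j \<in> {0..<int a}"
        by (auto simp: B_def int_box_def a_def)
      moreover have "v - int a *s ?e \<in> B \<longleftrightarrow> (\<forall>i. i \<noteq> j \<longrightarrow> v $ i \<in> {0..<int (L i)}) \<and> v $ j \<in> {int a..<2 * int a}"
        using sh[of "int a"] by (auto simp: B_def int_box_def a_def)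
      ultimately show ?thesis by auto
    qed
    moreover have "v \<in> (\<lambda>w. w + int a *s ?e) ` B \<longleftrightarrow> v - int a *s ?e \<in> B" for v
      by (auto simp: image_iff) (metis diff_add_cancel)
    ultimately show "B' = B \<union> (\<lambda>w. w + int a *s ?e) ` B" by blast
    have "v - int a *s ?e \<notin> B" if "v \<in> B" for v
    proof
      assume "v - int a *s ?e \<in> B"
      then have "(v - int a *s ?e) $ j \<in> {0..<int (L j)}" unfolding B_def int_box_def by blast
      then have "0 \<le> (v - int a *s ?e) $ j" by simp
      moreover have "v $ j < int a" using that by (auto simp: B_def int_box_def a_def)
      ultimately show False using sh[of "int a" j] by simp
    qed
    then show "B \<inter> (\<lambda>w. w + int a *s ?e) ` B = {}"
      by (metis (no_types, lifting) add_diff_cancel_right' disjoint_iff imageE)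
  qed
  have fin: "finite B" "finite B'" by (auto simp: B_def B'_def)
  have inj: "inj_on (\<lambda>w. w + int a *s ?e) B" by (auto simp: inj_on_def)
  have cB': "card B' = 2 * card B"
    unfolding BB(1) using BB(2) fin inj by (simp add: card_Un_disjoint card_image)
  define \<phi> where "\<phi> = (\<lambda>i v. if i = j then real (card {r. r < a \<and> v - int r *s ?e \<in> B}) / (2 * card B) else 0)"
  have \<phi>_le: "0 \<le> \<phi> i v" "\<phi> i v \<le> a / (2 * card B)" for i v
  proof -
    have "card {r. r < a \<and> v - int r *s ?e \<in> B} \<le> card {..<a}" by (intro card_mono) auto
    then show "0 \<le> \<phi> i v" "\<phi> i v \<le> a / (2 * card B)"
      by (auto simp: \<phi>_def intro!: divide_right_mono)
  qed
  have "(\<Sum>(i, v)\<in>UNIV \<times> B'. (\<phi> i v)\<^sup>2) = (\<Sum>i\<in>UNIV. if i = j then \<Sum>v\<in>B'. (\<phi> j v)\<^sup>2 else 0)"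
    unfolding sum.cartesian_product[symmetric] by (intro sum.cong) (auto simp: \<phi>_def)
  also have "\<dots> = (\<Sum>v\<in>B'. (\<phi> j v)\<^sup>2)" by simp
  also have "\<dots> \<le> (\<Sum>v\<in>B'. (a / (2 * card B))\<^sup>2)" using \<phi>_le by (intro sum_mono power_mono) auto
  also have "\<dots> \<le> a\<^sup>2 / card B" using cB by (simp add: cB' field_simps power2_eq_square)
  finally have norm: "L2_set (\<lambda>jv. \<phi> (fst jv) (snd jv)) (UNIV \<times> B') \<le> sqrt (a\<^sup>2 / card B)"
    by (simp add: L2_set_def case_prod_beta)
  have "avg B g - avg B' g = (\<Sum>i\<in>UNIV. \<Sum>v\<in>B'. \<phi> i v * (g v - g (v + axis i 1)))" for g
  proof -
    define F where "F = (\<lambda>v. g v - g (v + ?e))"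
    have tele: "g w - g (w + int a *s ?e) = (\<Sum>r<a. F (w + int r *s ?e))" for w
    proof -
      have "(\<Sum>r<a. F (w + int r *s ?e)) = (\<Sum>r<a. g (w + int r *s ?e) - g (w + int (Suc r) *s ?e))"
        by (intro sum.cong) (auto simp: F_def vector_sadd_rdistrib add_ac)
      also have "\<dots> = g (w + int 0 *s ?e) - g (w + int a *s ?e)" by (rule sum_lessThan_telescope')
      finally show ?thesis by simp
    qed
    have shift: "(\<Sum>w\<in>B. F (w + int r *s ?e)) = (\<Sum>v\<in>B'. if v - int r *s ?e \<in> B then F v else 0)" if "r < a" for r
    proof -
      have sub: "(\<lambda>w. w + int r *s ?e) ` B \<subseteq> B'"
      proof
        fix v assume "v \<in> (\<lambda>w. w + int r *s ?e) ` B"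
        then obtain w where w: "w \<in> B" "v = w + int r *s ?e" by auto
        have "v $ i \<in> {0..<int ((L(j := 2 * L j)) i)}" for i
        proof -
          have "w $ i \<in> {0..<int (L i)}" using w(1) unfolding B_def int_box_def by blast
          moreover have "v $ i = w $ i + (if i = j then int r else 0)" using w(2) sh[of "int r" i] by simp
          ultimately show ?thesis using that by (auto simp: a_def)
        qed
        then show "v \<in> B'" unfolding B'_def int_box_def by blast
      qed
      have "(\<Sum>w\<in>B. F (w + int r *s ?e)) = (\<Sum>v\<in>(\<lambda>w. w + int r *s ?e) ` B. F v)"
        by (subst sum.reindex) (auto simp: inj_on_def)
      also have "\<dots> = (\<Sum>v\<in>B'. if v - int r *s ?e \<in> B then F v else 0)"
        using sub fin by (intro sum.mono_neutral_cong_left) (auto simp: image_iff, metis diff_add_cancel)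
      finally show ?thesis .
    qed
    have "(\<Sum>w\<in>B'. g w) = (\<Sum>w\<in>B. g w) + (\<Sum>w\<in>B. g (w + int a *s ?e))"
      unfolding BB(1) using BB(2) fin inj by (simp add: sum.union_disjoint sum.reindex)
    then have "avg B g - avg B' g = (\<Sum>w\<in>B. g w - g (w + int a *s ?e)) / (2 * card B)"
      using cB by (simp add: avg_def cB' sum_subtractf field_simps)
    also have "(\<Sum>w\<in>B. g w - g (w + int a *s ?e)) = (\<Sum>r<a. \<Sum>w\<in>B. F (w + int r *s ?e))"
      unfolding tele by (rule sum.swap)
    also have "\<dots> = (\<Sum>v\<in>B'. \<Sum>r<a. if v - int r *s ?e \<in> B then F v else 0)"
      by (subst sum.swap) (simp add: shift)
    also have "\<dots> = (\<Sum>v\<in>B'. real (card {r. r < a \<and> v - int r *s ?e \<in> B}) * F v)"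
      by (intro sum.cong refl) (simp add: sum.If_cases lessThan_def Int_def)
    also have "\<dots> / (2 * card B) = (\<Sum>v\<in>B'. \<phi> j v * F v)"
      by (simp add: \<phi>_def sum_divide_distrib)
    also have "\<dots> = (\<Sum>i\<in>UNIV. if i = j then (\<Sum>v\<in>B'. \<phi> j v * F v) else 0)" by simp
    also have "\<dots> = (\<Sum>i\<in>UNIV. \<Sum>v\<in>B'. \<phi> i v * (g v - g (v + axis i 1)))"
      by (intro sum.cong) (auto simp: \<phi>_def F_def)
    finally show ?thesis .
  qed
  then show ?thesis
    unfolding has_flow_def using norm unfolding B_def B'_def a_def by blast
qed

text \<open>The directions are doubled one after the other. The side being doubled is still
  \<open>l\<close> and the current box has at least \<open>l^d\<close> points, so no step costs more
  than the first one.\<close>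

lemma double_cube_flow:
  assumes l: "l > 0"
  shows "has_flow (sites l :: (int ^ 'd::finite) set) (sites (2 * l)) (sites (2 * l)) (CARD('d) * sqrt (l\<^sup>2 / l ^ CARD('d)))"
proof -
  let ?s = "sqrt (l\<^sup>2 / l ^ CARD('d))"
  define L where "L = (\<lambda>J i. if i \<in> (J :: 'd set) then 2 * l else l)"
  have "has_flow (sites l) (int_box (L J)) (sites (2 * l)) (card J * ?s)" if "finite J" for J
    using that
  proof (induction J)
    case empty
    have "sites l = int_box (L {})" by (simp add: L_def sites_eq_int_box)
    then show ?case using has_flow_refl by simp
  next
    case (insert j J)
    have upd: "L (insert j J) = (L J)(j := 2 * L J j)" using insert.hyps by (auto simp: L_def)
    have "has_flow (int_box (L J)) (int_box (L (insert j J))) (int_box (L (insert j J)))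
        (sqrt ((L J j)\<^sup>2 / card (int_box (L J))))"
      unfolding upd using l by (intro double_side_flow) (auto simp: L_def)
    moreover have "int_box (L (insert j J)) \<subseteq> sites (2 * l)"
    proof
      fix w assume w: "w \<in> int_box (L (insert j J))"
      have "w $ i \<in> {0..<int (2 * l)}" for i
      proof -
        have "w $ i \<in> {0..<int (L (insert j J) i)}" using w by (simp add: int_box_def)
        moreover have "L (insert j J) i \<le> 2 * l" by (simp add: L_def)
        ultimately show ?thesis by auto
      qed
      then show "w \<in> sites (2 * l)" by (simp add: sites_def)
    qed
    moreover have "sqrt ((L J j)\<^sup>2 / card (int_box (L J))) \<le> ?s"
    proof -
      have "l ^ CARD('d) \<le> card (int_box (L J))"
        unfolding card_int_box prod_constant[symmetric] by (intro prod_mono) (auto simp: L_def)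
      then have "real (l ^ CARD('d)) \<le> card (int_box (L J))" by linarith
      moreover have "L J j = l" using insert.hyps by (simp add: L_def)
      ultimately show ?thesis using l by (intro real_sqrt_le_mono) (auto intro!: divide_left_mono simp: card_int_box prod_pos L_def)
    qed
    ultimately have "has_flow (int_box (L J)) (int_box (L (insert j J))) (sites (2 * l)) ?s"
      using has_flow_mono[OF _ _ finite_sites] by blast
    from has_flow_trans[OF insert.IH this] show ?case
      using insert.hyps by (simp add: distrib_right add.commute)
  qed
  from this[of UNIV] show ?thesis by (simp add: L_def sites_eq_int_box)
qed

text \<open>Doubling the side \<open>l\<close> has norm of order \<open>sqrt (l^2 / l^d)\<close>.
  For d at least 2 this is bounded, so only the number \<open>n\<close> of scales counts; for d = 1
  it is at most of the order of the last scale.\<close>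

lemma point_to_cube_flow:
  fixes n :: nat
  defines "b \<equiv> (if CARD('d) = 1 then 2 ^ n else 1) :: real"
  shows "has_flow (sites 1 :: (int ^ 'd::finite) set) (sites (2 ^ n)) (sites (2 ^ n)) (n * CARD('d) * sqrt b)"
proof -
  have step: "sqrt (real ((2 ^ k)\<^sup>2) / (2 ^ k) ^ CARD('d)) \<le> sqrt b" if "k \<le> n" for k
  proof (rule real_sqrt_le_mono)
    show "real ((2 ^ k)\<^sup>2) / (2 ^ k) ^ CARD('d) \<le> b"
    proof (cases "CARD('d) = 1")
      case True
      then show ?thesis using that by (simp add: b_def power2_eq_square power_increasing)
    next
      case False
      then have "CARD('d) \<ge> 2" using zero_less_card_finite[where 'a='d] by linarith
      then have "(2 ^ k)\<^sup>2 \<le> (2 ^ k :: real) ^ CARD('d)" by (intro power_increasing) auto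
      then show ?thesis using False by (simp add: b_def)
    qed
  qed
  have "has_flow (sites 1 :: (int ^ 'd) set) (sites (2 ^ k)) (sites (2 ^ k)) (k * (CARD('d) * sqrt b))" if "k \<le> n" for k
    using that
  proof (induction k)
    case 0
    then show ?case using has_flow_refl by simp
  next
    case (Suc k)
    have sub: "sites (2 ^ k) \<subseteq> (sites (2 * 2 ^ k) :: (int ^ 'd) set)"
    proof
      fix w :: "int ^ 'd" assume "w \<in> sites (2 ^ k)"
      then have "0 \<le> w $ i \<and> w $ i < 2 ^ k" for i by (simp add: sites_def)
      then have "0 \<le> w $ i \<and> w $ i < 2 * 2 ^ k" for i by (smt (verit))
      then show "w \<in> sites (2 * 2 ^ k)" by (simp add: sites_def)
    qed
    have "has_flow (sites 1 :: (int ^ 'd) set) (sites (2 ^ k)) (sites (2 * 2 ^ k)) (k * (CARD('d) * sqrt b))"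
      using Suc sub by (intro has_flow_mono[OF Suc.IH]) auto
    moreover have "has_flow (sites (2 ^ k) :: (int ^ 'd) set) (sites (2 * 2 ^ k)) (sites (2 * 2 ^ k)) (CARD('d) * sqrt b)"
      by (rule has_flow_mono[OF double_cube_flow[of "2 ^ k"]]) (use step[of k] Suc in auto)
    ultimately show ?case
      using has_flow_trans by (fastforce simp: distrib_right add.commute)
  qed
  from this[of n] show ?thesis by (simp add: mult.assoc)
qed

lemma cube_flow:
  obtains \<phi> :: "'d::finite \<Rightarrow> int ^ 'd \<Rightarrow> real"
  where "(\<Sum>j\<in>UNIV. \<Sum>v\<in>sites (2 ^ n). (\<phi> j v)\<^sup>2) \<le> (n * CARD('d))\<^sup>2 * (if CARD('d) = 1 then 2 ^ n else 1 :: real)"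
    and "\<And>g. g 0 - avg (sites (2 ^ n)) g = (\<Sum>j\<in>UNIV. \<Sum>v\<in>sites (2 ^ n). \<phi> j v * (g v - g (v + axis j 1)))"
proof -
  define b :: real where "b = (if CARD('d) = 1 then 2 ^ n else 1)"
  have b: "b \<ge> 0" by (simp add: b_def)
  obtain \<phi> :: "'d \<Rightarrow> int ^ 'd \<Rightarrow> real" where \<phi>: "L2_set (\<lambda>jv. \<phi> (fst jv) (snd jv)) (UNIV \<times> sites (2 ^ n)) \<le> n * CARD('d) * sqrt b"
    "\<And>g. avg (sites 1) g - avg (sites (2 ^ n)) g = (\<Sum>j\<in>UNIV. \<Sum>v\<in>sites (2 ^ n). \<phi> j v * (g v - g (v + axis j 1)))"
    using point_to_cube_flow[of n, where 'd='d] unfolding has_flow_def b_def by blast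
  \<comment> \<open>The cube of side 1 is the origin alone, so averaging over it is evaluation at
    0.\<close>
  have "(sites 1 :: (int ^ 'd) set) = {0}"
  proof -
    have "w = 0" if "\<forall>i. 0 \<le> w $ i \<and> w $ i < 1" for w :: "int ^ 'd"
      using that by (auto simp: vec_eq_iff intro!: antisym)  (smt (verit))
    then show ?thesis by (auto simp: sites_def)
  qed
  then have "avg (sites 1) g = g 0" for g :: "int ^ 'd \<Rightarrow> real" by (simp add: avg_def)
  moreover have "(\<Sum>j\<in>UNIV. \<Sum>v\<in>sites (2 ^ n). (\<phi> j v)\<^sup>2) = (L2_set (\<lambda>jv. \<phi> (fst jv) (snd jv)) (UNIV \<times> sites (2 ^ n)))\<^sup>2"
    by (simp add: L2_set_def sum_nonneg sum.cartesian_product case_prod_beta)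
  moreover have "\<dots> \<le> (n * CARD('d) * sqrt b)\<^sup>2" using \<phi>(1) by (intro power_mono) auto
  ultimately show ?thesis using that[of \<phi>] \<phi>(2) b by (simp add: power_mult_distrib b_def)
qed

section \<open>Replacement by cube averages\<close>

text \<open>The displacement \<open>w\<close> stays an unreduced vector, so that successive shifts
  add up and only the endpoint is wrapped.\<close>

definition tshift :: "nat \<Rightarrow> int ^ 'd \<Rightarrow> int ^ 'd \<Rightarrow> int ^ 'd" where
  "tshift N x w = wrap N (x + w)"

lemma wrap_nth [simp]: "wrap N x $ i = x $ i mod int N"
  by (simp add: wrap_def)

lemma wrap_in_sites: "N > 0 \<Longrightarrow> wrap N x \<in> sites N"
  by (simp add: sites_def)

lemma wrap_sites: "x \<in> sites N \<Longrightarrow> wrap N x = x"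
  by (auto simp: vec_eq_iff sites_def)

lemma tshift_in_sites: "N > 0 \<Longrightarrow> tshift N x w \<in> sites N"
  by (simp add: tshift_def wrap_in_sites)

lemma tshift_shift [simp]: "tshift N (tshift N x w) w' = tshift N x (w + w')"
  by (simp add: tshift_def vec_eq_iff mod_add_left_eq add.assoc)

lemma tshift_0 [simp]: "x \<in> sites N \<Longrightarrow> tshift N x 0 = x"
  by (simp add: tshift_def wrap_sites)

lemma tshift_eq_iff: "tshift N x w = tshift N x w' \<longleftrightarrow> (\<forall>i. int N dvd w $ i - w' $ i)"
  by (simp add: tshift_def vec_eq_iff mod_eq_dvd_iff)

lemma sum_tshift:
  fixes F :: "int ^ 'd::finite \<Rightarrow> real"
  assumes "N > 0"
  shows "(\<Sum>x\<in>sites N. F (tshift N x w)) = (\<Sum>x\<in>sites N. F x)"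
  by (rule sum.reindex_bij_witness[where i = "\<lambda>x. tshift N x (- w)" and j = "\<lambda>x. tshift N x w"])
    (use assms in \<open>auto simp: tshift_in_sites\<close>)

lemma abs_less_dvd_0: "\<bar>a\<bar> < int N \<Longrightarrow> int N dvd a \<Longrightarrow> a = 0"
  using zdvd_not_zless[of "\<bar>a\<bar>" "int N"] by (cases "a = 0") auto

lemma avg_power2_le: "finite B \<Longrightarrow> (avg B g)\<^sup>2 \<le> avg B (\<lambda>w. (g w)\<^sup>2)"
proof (cases "B = {}")
  case False
  assume B: "finite B"
  then have c: "card B > 0" using False by (simp add: card_gt_0_iff)
  have "(\<Sum>w\<in>B. g w * 1)\<^sup>2 \<le> (\<Sum>w\<in>B. (g w)\<^sup>2) * (\<Sum>w\<in>B. 1\<^sup>2)" by (rule Cauchy_Schwarz_ineq_sum)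
  then show ?thesis using c by (simp add: avg_def power_divide field_simps power2_eq_square)
qed (simp add: avg_def)

text \<open>The static data at one time. The single parameter \<epsilon> bounds both the gradient of
  the profile and the defect of reversibility; \<open>p0\<close> bounds from below the larger of the
  two rates of each axis, since the other one may vanish; \<open>size\<close> lets two cubes and a
  bond fit without wrapping around the torus.\<close>

locale torus_model = binomial_product K "sites N" r
  for K N :: nat and r :: "int ^ 'd::finite \<Rightarrow> real" +
  fixes p :: "'d + 'd \<Rightarrow> real" and n :: nat and \<epsilon> p0 :: real
  assumes p_nonneg: "\<And>i. p i \<ge> 0"
    and p0: "p0 > 0" "\<And>j. p (Inl j) \<ge> p0 \<or> p (Inr j) \<ge> p0"
    and size: "2 * 2 ^ n + 2 \<le> N"
    and eps: "0 < \<epsilon>" "\<epsilon> \<le> 1"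
    and grad: "\<And>x i. x \<in> sites N \<Longrightarrow> \<bar>r x - r (tshift N x (dir i))\<bar> \<le> \<epsilon>"
    and odds: "\<And>x i. x \<in> sites N \<Longrightarrow> \<bar>odds x (tshift N x (dir i)) - 1\<bar> \<le> \<epsilon>"
begin

abbreviation "V \<equiv> sites N :: (int ^ 'd) set"
abbreviation "cube \<equiv> sites (2 ^ n) :: (int ^ 'd) set"
abbreviation "e j \<equiv> (axis j 1 :: int ^ 'd)"
abbreviation "om \<eta> x \<equiv> real (\<eta> x) - r x"

definition P where "P = (\<Sum>i\<in>UNIV. p i)"

lemma N: "N > 0" "N \<ge> 4"
proof -
  have "(1::nat) \<le> 2 ^ n" by simp
  then show "N \<ge> 4" using size by linarith
  then show "N > 0" by simp
qed

lemma p_le_P: "p i \<le> P" "p (Inl j) + p (Inr j) \<le> P" "P \<ge> 0"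
proof -
  show "p i \<le> P" unfolding P_def by (rule member_le_sum) (auto simp: p_nonneg)
  have "(\<Sum>i\<in>{Inl j, Inr j}. p i) \<le> P" unfolding P_def by (intro sum_mono2) (auto simp: p_nonneg)
  then show "p (Inl j) + p (Inr j) \<le> P" by simp
  show "P \<ge> 0" unfolding P_def by (intro sum_nonneg) (auto simp: p_nonneg)
qed

lemma cube_card: "card cube = (2 ^ n) ^ CARD('d)" "card cube > 0"
  by (simp_all add: card_sites)

text \<open>\<open>sum_centred_squares\<close> for the translates of one window. The map
  \<open>s\<close> preserves coordinate distances and the cube is shorter than the torus, so every
  window embeds into the torus, and each site lies in at most \<open>card cube\<close>
  windows.\<close>

lemma local_squares:
  fixes c \<psi> :: "_ \<Rightarrow> real" and s :: "int ^ 'd \<Rightarrow> int ^ 'd"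
  assumes u0: "\<And>\<eta>. \<eta> \<in> \<Omega> \<Longrightarrow> u \<eta> \<ge> 0" and u1: "(\<Sum>\<eta>\<in>\<Omega>. u \<eta>) = 1"
    and inj: "\<And>w w' i. w \<in> cube \<Longrightarrow> w' \<in> cube \<Longrightarrow> \<bar>s w $ i - s w' $ i\<bar> = \<bar>w $ i - w' $ i\<bar>"
    and c: "\<And>x. x \<in> V \<Longrightarrow> \<bar>c x\<bar> \<le> b" and b: "b \<ge> 0"
  shows "(\<Sum>\<eta>\<in>\<Omega>. u \<eta> * (\<Sum>z\<in>V. (\<Sum>w\<in>cube. \<psi> w * (c (tshift N z (s w)) * om \<eta> (tshift N z (s w))))\<^sup>2))
     \<le> K\<^sup>2 * (b\<^sup>2 * (\<Sum>w\<in>cube. (\<psi> w)\<^sup>2)) * (card cube * ent \<Omega> u \<nu> + card V)"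
proof -
  have injz: "inj_on (\<lambda>w. tshift N z (s w)) cube" for z
  proof (rule inj_onI)
    fix w w' assume w: "w \<in> cube" "w' \<in> cube" and "tshift N z (s w) = tshift N z (s w')"
    then have d: "int N dvd s w $ i - s w' $ i" for i by (simp add: tshift_eq_iff)
    have "w $ i = w' $ i" for i
    proof -
      have "w $ i \<in> {0..<int (2 ^ n)}" "w' $ i \<in> {0..<int (2 ^ n)}" using w unfolding sites_def by blast+
      moreover have "int (2 ^ n) \<le> int N" using size by linarith
      ultimately have "\<bar>w $ i - w' $ i\<bar> < int N" unfolding atLeastLessThan_iff by linarith
      then have "s w $ i - s w' $ i = 0" using abs_less_dvd_0[OF _ d[of i]] inj[OF w] by simp
      then show ?thesis using inj[OF w, of i] by simp
    qed
    then show "w = w'" by (simp add: vec_eq_iff)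
  qed
  \<comment> \<open>The coefficient of \<open>x\<close> is that of the unique displacement in the
    window leading from \<open>z\<close> to \<open>x\<close>, and 0 if there is none.\<close>
  define a where "a = (\<lambda>z x. if x \<in> (\<lambda>w. tshift N z (s w)) ` cube
     then \<psi> (the_inv_into cube (\<lambda>w. tshift N z (s w)) x) * c x else 0)"
  have sumV: "(\<Sum>x\<in>V. F x (a z x)) = (\<Sum>w\<in>cube. F (tshift N z (s w)) (\<psi> w * c (tshift N z (s w))))"
    if "\<And>x. F x 0 = 0" for F :: "_ \<Rightarrow> real \<Rightarrow> real" and z
  proof -
    have "(\<Sum>x\<in>V. F x (a z x)) = (\<Sum>x\<in>(\<lambda>w. tshift N z (s w)) ` cube. F x (a z x))"
      using that N by (intro sum.mono_neutral_right) (auto simp: a_def tshift_in_sites)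
    also have "\<dots> = (\<Sum>w\<in>cube. F (tshift N z (s w)) (\<psi> w * c (tshift N z (s w))))"
    proof (subst sum.reindex[OF injz], intro sum.cong refl)
      fix w assume w: "w \<in> cube"
      have "the_inv_into cube (\<lambda>w. tshift N z (s w)) (tshift N z (s w)) = w"
        using the_inv_into_f_f[OF injz w] .
      then show "((\<lambda>x. F x (a z x)) \<circ> (\<lambda>w. tshift N z (s w))) w = F (tshift N z (s w)) (\<psi> w * c (tshift N z (s w)))"
        using w by (simp add: a_def)
    qed
    finally show ?thesis .
  qed
  have "(\<Sum>\<eta>\<in>\<Omega>. u \<eta> * (\<Sum>z\<in>V. (centred V r (a z) \<eta>)\<^sup>2))
     \<le> K\<^sup>2 * (b\<^sup>2 * (\<Sum>w\<in>cube. (\<psi> w)\<^sup>2)) * (card cube * ent \<Omega> u \<nu> + card V)"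
  proof (rule sum_centred_squares[where u = u and a = a and Z = V and m = "card cube"])
    show "finite V" "0 \<le> b\<^sup>2 * (\<Sum>w\<in>cube. (\<psi> w)\<^sup>2)" by (auto intro!: mult_nonneg_nonneg sum_nonneg)
    show "(\<Sum>x\<in>V. (a z x)\<^sup>2) \<le> b\<^sup>2 * (\<Sum>w\<in>cube. (\<psi> w)\<^sup>2)" for z
    proof -
      have "(\<Sum>x\<in>V. (a z x)\<^sup>2) = (\<Sum>w\<in>cube. (\<psi> w * c (tshift N z (s w)))\<^sup>2)"
        by (rule sumV) simp
      also have "\<dots> \<le> (\<Sum>w\<in>cube. (\<psi> w)\<^sup>2 * b\<^sup>2)"
      proof (rule sum_mono)
        fix w
        have "(c (tshift N z (s w)))\<^sup>2 \<le> b\<^sup>2"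
          using c[OF tshift_in_sites[OF N(1)]] by (metis abs_le_square_iff abs_of_nonneg b)
        then show "(\<psi> w * c (tshift N z (s w)))\<^sup>2 \<le> (\<psi> w)\<^sup>2 * b\<^sup>2"
          unfolding power_mult_distrib by (intro mult_left_mono) auto
      qed
      finally show ?thesis by (simp add: sum_distrib_left mult.commute)
    qed
    show "card {z \<in> V. a z x \<noteq> 0} \<le> card cube" for x
    proof -
      have "{z \<in> V. a z x \<noteq> 0} \<subseteq> (\<lambda>w. tshift N x (- s w)) ` cube"
      proof
        fix z assume z: "z \<in> {z \<in> V. a z x \<noteq> 0}"
        then obtain w where "w \<in> cube" "x = tshift N z (s w)" by (auto simp: a_def split: if_splits)
        then show "z \<in> (\<lambda>w. tshift N x (- s w)) ` cube" using z by (intro image_eqI[of _ _ w]) auto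
      qed
      then show ?thesis by (intro order_trans[OF card_mono card_image_le]) auto
    qed
  qed (use cube_card u0 u1 in simp_all)
  moreover have "centred V r (a z) \<eta> = (\<Sum>w\<in>cube. \<psi> w * (c (tshift N z (s w)) * om \<eta> (tshift N z (s w))))" for z \<eta>
    unfolding centred_def using sumV[of "\<lambda>x b. b * (real (\<eta> x) - r x)" z] by (simp add: mult.assoc)
  ultimately show ?thesis by simp
qed

text \<open>\<open>integration_by_parts\<close> in whichever direction has rate at least
  \<open>p0\<close>, with the parameter \<open>A = 2 * K * p0\<close>: after division by
  \<open>K\<close> the cost is \<open>p0\<close> times the Dirichlet form of that direction, which
  the entropy production supplies in full. Passing from \<open>\<eta>\<close> to \<open>om\<close>
  adds the gradient of the profile, at most \<epsilon>.\<close>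

lemma bond_estimate:
  assumes u: "\<And>\<eta>. \<eta> \<in> \<Omega> \<Longrightarrow> u \<eta> > 0" and u1: "(\<Sum>\<eta>\<in>\<Omega>. u \<eta>) = 1" and z: "z \<in> V"
    and h: "\<And>\<eta>. h (hop z (tshift N z (e j)) \<eta>) = h \<eta>" "\<And>\<eta>. h (hop (tshift N z (e j)) z \<eta>) = h \<eta>"
  shows "(\<Sum>\<eta>\<in>\<Omega>. u \<eta> * (h \<eta> * (om \<eta> z - om \<eta> (tshift N z (e j)))))
    \<le> p (Inl j) * dirichlet u z (tshift N z (e j)) + p (Inr j) * dirichlet u (tshift N z (e j)) z
      + (3 / (2 * p0) + (K + 1)) * (\<Sum>\<eta>\<in>\<Omega>. u \<eta> * (h \<eta>)\<^sup>2) + (K + 1) * \<epsilon>\<^sup>2"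
proof -
  define y where "y = tshift N z (e j)"
  have yV: "y \<in> V" unfolding y_def using N by (simp add: tshift_in_sites)
  have z_eq: "z = tshift N y (- e j)" using z by (simp add: y_def)
  have zy: "z \<noteq> y"
  proof
    assume "z = y"
    then have "tshift N z 0 = tshift N z (e j)" using z by (simp add: y_def)
    then have "int N dvd (0 :: int ^ 'd) $ j - e j $ j" by (simp only: tshift_eq_iff)
    then show False using N by (auto simp: axis_def)
  qed
  let ?Eh = "\<Sum>\<eta>\<in>\<Omega>. u \<eta> * \<bar>h \<eta>\<bar>" and ?Eh2 = "\<Sum>\<eta>\<in>\<Omega>. u \<eta> * (h \<eta>)\<^sup>2"
  let ?D = "p (Inl j) * dirichlet u z y + p (Inr j) * dirichlet u y z"
  have Kp: "real K > 0" using K by simp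
  have main: "(\<Sum>\<eta>\<in>\<Omega>. u \<eta> * h \<eta> * (real (\<eta> z) - real (\<eta> y))) \<le> ?D + 3 / (2 * p0) * ?Eh2 + K * \<epsilon> * ?Eh"
  proof -
    have step: "(\<Sum>\<eta>\<in>\<Omega>. u \<eta> * h' \<eta> * (real (\<eta> b) - real (\<eta> a)))
        \<le> p0 * dirichlet u a b + 3 / (2 * p0) * (\<Sum>\<eta>\<in>\<Omega>. u \<eta> * (h' \<eta>)\<^sup>2) + K * \<epsilon> * (\<Sum>\<eta>\<in>\<Omega>. u \<eta> * \<bar>h' \<eta>\<bar>)"
      if ab: "a \<in> V" "b \<in> V" "a \<noteq> b" and h': "\<And>\<eta>. h' (hop a b \<eta>) = h' \<eta>" and o: "\<bar>odds a b - 1\<bar> \<le> \<epsilon>" for a b h'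
    proof -
      have "K * (\<Sum>\<eta>\<in>\<Omega>. u \<eta> * h' \<eta> * (real (\<eta> b) - real (\<eta> a)))
         \<le> (2 * K * p0) / 2 * dirichlet u a b + 3 * K\<^sup>2 / (2 * K * p0) * (\<Sum>\<eta>\<in>\<Omega>. u \<eta> * (h' \<eta>)\<^sup>2)
           + K\<^sup>2 * \<epsilon> * (\<Sum>\<eta>\<in>\<Omega>. u \<eta> * \<bar>h' \<eta>\<bar>)"
        using Kp p0 by (intro integration_by_parts ab u h' o eps(2)) auto
      also have "\<dots> = K * (p0 * dirichlet u a b + 3 / (2 * p0) * (\<Sum>\<eta>\<in>\<Omega>. u \<eta> * (h' \<eta>)\<^sup>2) + K * \<epsilon> * (\<Sum>\<eta>\<in>\<Omega>. u \<eta> * \<bar>h' \<eta>\<bar>))"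
        using Kp p0 by (simp add: field_simps power2_eq_square)
      finally show ?thesis using Kp by (simp only: mult_le_cancel_left_pos)
    qed
    have Dnn: "0 \<le> p (Inl j) * dirichlet u z y" "0 \<le> p (Inr j) * dirichlet u y z"
      by (auto intro!: mult_nonneg_nonneg p_nonneg dirichlet_nonneg)
    from p0(2)[of j] show ?thesis
    proof
      assume pj: "p (Inl j) \<ge> p0"
      have "\<bar>odds z y - 1\<bar> \<le> \<epsilon>" using odds[OF z, of "Inl j"] by (simp add: y_def)
      \<comment> \<open>\<open>step\<close> controls the occupation of the target minus that of the
        source, so jumps from \<open>z\<close> to \<open>y\<close> are used with
        \<open>- h\<close>.\<close>
      from step[OF z yV zy, of "\<lambda>\<eta>. - h \<eta>", OF _ this] h(1)
      have "(\<Sum>\<eta>\<in>\<Omega>. u \<eta> * - h \<eta> * (real (\<eta> y) - real (\<eta> z))) \<le> p0 * dirichlet u z y + 3 / (2 * p0) * ?Eh2 + K * \<epsilon> * ?Eh"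
        by (simp add: y_def)
      moreover have "(\<Sum>\<eta>\<in>\<Omega>. u \<eta> * - h \<eta> * (real (\<eta> y) - real (\<eta> z))) = (\<Sum>\<eta>\<in>\<Omega>. u \<eta> * h \<eta> * (real (\<eta> z) - real (\<eta> y)))"
        by (intro sum.cong) (auto simp: algebra_simps)
      moreover have "p0 * dirichlet u z y \<le> p (Inl j) * dirichlet u z y" by (intro mult_right_mono pj dirichlet_nonneg)
      ultimately show ?thesis using Dnn by linarith
    next
      assume pj: "p (Inr j) \<ge> p0"
      have "\<bar>odds y z - 1\<bar> \<le> \<epsilon>" using odds[OF yV, of "Inr j"] z_eq by simp
      from step[OF yV z zy[symmetric], of h, OF _ this] h(2)
      have "(\<Sum>\<eta>\<in>\<Omega>. u \<eta> * h \<eta> * (real (\<eta> z) - real (\<eta> y))) \<le> p0 * dirichlet u y z + 3 / (2 * p0) * ?Eh2 + K * \<epsilon> * ?Eh"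
        by (simp add: y_def)
      moreover have "p0 * dirichlet u y z \<le> p (Inr j) * dirichlet u y z" by (intro mult_right_mono pj dirichlet_nonneg)
      ultimately show ?thesis using Dnn by linarith
    qed
  qed
  have "(\<Sum>\<eta>\<in>\<Omega>. u \<eta> * (h \<eta> * (om \<eta> z - om \<eta> y)))
      = (\<Sum>\<eta>\<in>\<Omega>. u \<eta> * h \<eta> * (real (\<eta> z) - real (\<eta> y))) - (r z - r y) * (\<Sum>\<eta>\<in>\<Omega>. u \<eta> * h \<eta>)"
    unfolding sum_distrib_left sum_subtractf[symmetric] by (intro sum.cong) (auto simp: algebra_simps)
  moreover have "- ((r z - r y) * (\<Sum>\<eta>\<in>\<Omega>. u \<eta> * h \<eta>)) \<le> \<epsilon> * ?Eh"
  proof -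
    have "- ((r z - r y) * (\<Sum>\<eta>\<in>\<Omega>. u \<eta> * h \<eta>)) \<le> \<bar>r z - r y\<bar> * \<bar>\<Sum>\<eta>\<in>\<Omega>. u \<eta> * h \<eta>\<bar>"
      unfolding abs_mult[symmetric] by (rule abs_ge_minus_self)
    also have "\<dots> \<le> \<epsilon> * ?Eh"
    proof (rule mult_mono)
      show "\<bar>r z - r y\<bar> \<le> \<epsilon>" using grad[OF z, of "Inl j"] by (simp add: y_def)
      show "\<bar>\<Sum>\<eta>\<in>\<Omega>. u \<eta> * h \<eta>\<bar> \<le> ?Eh"
        using u by (intro order_trans[OF sum_abs] sum_mono) (auto simp: abs_mult abs_of_pos)
    qed (use eps in auto)
    finally show ?thesis .
  qed
  moreover have "\<epsilon> * ?Eh \<le> ?Eh2 + \<epsilon>\<^sup>2"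
  proof -
    have "\<epsilon> * ?Eh = (\<Sum>\<eta>\<in>\<Omega>. u \<eta> * (\<epsilon> * \<bar>h \<eta>\<bar>))" by (simp add: sum_distrib_left mult_ac)
    also have "\<dots> \<le> (\<Sum>\<eta>\<in>\<Omega>. u \<eta> * ((h \<eta>)\<^sup>2 + \<epsilon>\<^sup>2))"
    proof (intro sum_mono mult_left_mono)
      fix \<eta> assume "\<eta> \<in> \<Omega>" then show "0 \<le> u \<eta>" using u by (simp add: less_imp_le)
      have "2 * (\<epsilon> * \<bar>h \<eta>\<bar>) \<le> \<epsilon>\<^sup>2 + \<bar>h \<eta>\<bar>\<^sup>2" using sum_squares_bound[of \<epsilon> "\<bar>h \<eta>\<bar>"] by simp
      moreover have "0 \<le> \<epsilon> * \<bar>h \<eta>\<bar>" using eps by simp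
      ultimately show "\<epsilon> * \<bar>h \<eta>\<bar> \<le> (h \<eta>)\<^sup>2 + \<epsilon>\<^sup>2" by simp
    qed
    also have "\<dots> = ?Eh2 + \<epsilon>\<^sup>2" using u1 by (simp add: distrib_left sum.distrib sum_distrib_right[symmetric])
    finally show ?thesis .
  qed
  then have "(real K + 1) * (\<epsilon> * ?Eh) \<le> (real K + 1) * (?Eh2 + \<epsilon>\<^sup>2)" by (intro mult_left_mono) auto
  moreover have "(real K + 1) * (\<epsilon> * ?Eh) = real K * \<epsilon> * ?Eh + \<epsilon> * ?Eh" by (simp add: distrib_right mult.assoc)
  moreover have "(3 / (2 * p0) + real (K + 1)) * ?Eh2 + real (K + 1) * \<epsilon>\<^sup>2 = 3 / (2 * p0) * ?Eh2 + (real K + 1) * (?Eh2 + \<epsilon>\<^sup>2)"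
    by (simp add: distrib_right distrib_left)
  ultimately show ?thesis using main unfolding y_def[symmetric] by linarith
qed

end

lemma avg_sum_swap: "avg B (\<lambda>w. \<Sum>z\<in>Z. F w z) = (\<Sum>z\<in>Z. avg B (\<lambda>w. F w z))"
  unfolding avg_def by (subst sum.swap) (simp add: sum_divide_distrib)

lemma avg_mult_right: "avg B (\<lambda>w. F w * a) = avg B F * a"
  by (simp add: avg_def sum_distrib_right[symmetric])

lemma avg_mult_left: "avg B (\<lambda>w. a * F w) = a * avg B F"
  by (simp add: avg_def sum_distrib_left[symmetric])

lemma avg_diff: "avg B (\<lambda>w. F w - G w) = avg B F - avg B G"
  by (simp add: avg_def sum_subtractf diff_divide_distrib)

lemma avg_const: "finite B \<Longrightarrow> B \<noteq> {} \<Longrightarrow> avg B (\<lambda>_. a) = a"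
  by (simp add: avg_def card_gt_0_iff)

lemma power2_sum_le_card:
  fixes f :: "'i::finite \<Rightarrow> real"
  shows "(\<Sum>i\<in>UNIV. f i)\<^sup>2 \<le> CARD('i) * (\<Sum>i\<in>UNIV. (f i)\<^sup>2)"
  using Cauchy_Schwarz_ineq_sum[of f "\<lambda>_. 1" UNIV] by (simp add: mult.commute)

context torus_model
begin

lemma cube_ne: "cube \<noteq> {}"
  using cube_card(2) by (auto simp: card_gt_0_iff)

lemma sum_tshift_subst:
  fixes F :: "int ^ 'd \<Rightarrow> int ^ 'd \<Rightarrow> real"
  shows "(\<Sum>x\<in>V. F x (tshift N x a)) = (\<Sum>z\<in>V. F (tshift N z (- a)) z)"
  using sum_tshift[OF N(1), of "\<lambda>x. F x (tshift N x a)" "- a"] by (simp cong: sum.cong)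

text \<open>Each term of the sum over \<open>x\<close> is translated so that its bond starts at
  \<open>z\<close>. All gradients across one bond are thereby gathered, and their common weight is
  \<open>f\<close> summed against the flow over the reflected window.\<close>

lemma transport_identity:
  fixes F f :: "int ^ 'd \<Rightarrow> real"
  shows "(\<Sum>x\<in>V. f x * (\<Sum>j\<in>UNIV. \<Sum>w\<in>cube. \<phi> j w * (F (tshift N x (b + w)) - F (tshift N x (b + (w + e j))))))
    = (\<Sum>j\<in>UNIV. \<Sum>z\<in>V. (F z - F (tshift N z (e j))) * (\<Sum>w\<in>cube. \<phi> j w * f (tshift N z (- b - w))))"
proof -
  have "(\<Sum>x\<in>V. f x * (F (tshift N x (b + w)) - F (tshift N x (b + (w + e j)))))
     = (\<Sum>z\<in>V. f (tshift N z (- b - w)) * (F z - F (tshift N z (e j))))" for j w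
  proof -
    have "(\<Sum>x\<in>V. f x * (F (tshift N x (b + w)) - F (tshift N x (b + (w + e j)))))
      = (\<Sum>x\<in>V. f x * (F (tshift N x (b + w)) - F (tshift N (tshift N x (b + w)) (e j))))"
      by (simp add: add.assoc)
    also have "\<dots> = (\<Sum>z\<in>V. f (tshift N z (- (b + w))) * (F z - F (tshift N z (e j))))"
      by (rule sum_tshift_subst[of "\<lambda>x z. f x * (F z - F (tshift N z (e j)))"])
    finally show ?thesis by simp
  qed
  note key = this
  have "(\<Sum>x\<in>V. f x * (\<Sum>j\<in>UNIV. \<Sum>w\<in>cube. \<phi> j w * (F (tshift N x (b + w)) - F (tshift N x (b + (w + e j))))))
     = (\<Sum>j\<in>UNIV. \<Sum>w\<in>cube. \<phi> j w * (\<Sum>x\<in>V. f x * (F (tshift N x (b + w)) - F (tshift N x (b + (w + e j))))))"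
    unfolding sum_distrib_left by (subst sum.swap, rule sum.cong[OF refl], subst sum.swap) (simp add: mult_ac)
  also have "\<dots> = (\<Sum>j\<in>UNIV. \<Sum>w\<in>cube. \<phi> j w * (\<Sum>z\<in>V. f (tshift N z (- b - w)) * (F z - F (tshift N z (e j)))))"
    unfolding key ..
  also have "\<dots> = (\<Sum>j\<in>UNIV. \<Sum>z\<in>V. (F z - F (tshift N z (e j))) * (\<Sum>w\<in>cube. \<phi> j w * f (tshift N z (- b - w))))"
    unfolding sum_distrib_left by (rule sum.cong[OF refl], subst sum.swap) (simp add: mult_ac)
  finally show ?thesis .
qed

text \<open>The flow is applied twice, so that the remaining term is a product of two cube averages.\<close>

lemma block_decomposition:
  fixes \<omega> f :: "int ^ 'd \<Rightarrow> real" and i :: 'd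
  assumes flow: "\<And>g. g 0 - avg cube g = (\<Sum>j\<in>UNIV. \<Sum>v\<in>cube. \<phi> j v * (g v - g (v + e j)))"
  defines "h \<equiv> \<lambda>j z. \<Sum>w\<in>cube. \<phi> j w * f (tshift N z (- e i - w))"
  shows "(\<Sum>x\<in>V. f x * \<omega> (tshift N x (e i)))
    = (\<Sum>j\<in>UNIV. \<Sum>z\<in>V. (\<omega> z - \<omega> (tshift N z (e j))) * (h j z + avg cube (\<lambda>v. h j (tshift N z (- v)))))
      + (\<Sum>z\<in>V. avg cube (\<lambda>w. f (tshift N z (- e i - w))) * avg cube (\<lambda>v. \<omega> (tshift N z v)))"
proof -
  define \<omega>' where "\<omega>' = (\<lambda>z. avg cube (\<lambda>v. \<omega> (tshift N z v)))"
  define T where "T = (\<lambda>F x. \<Sum>j\<in>UNIV. \<Sum>w\<in>cube. \<phi> j w * (F (tshift N x (e i + w)) - F (tshift N x (e i + (w + e j)))) :: real)"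
  \<comment> \<open>First use of the flow, replacing \<omega> by its cube average
    \<open>\<omega>'\<close>; the next fact repeats it on \<open>\<omega>'\<close>, so that the
    second averaging can be passed on to \<open>f\<close>.\<close>
  have 1: "\<omega> (tshift N x (e i)) = \<omega>' (tshift N x (e i)) + T \<omega> x" for x
    using flow[of "\<lambda>w. \<omega> (tshift N x (e i + w))"] by (simp add: T_def \<omega>'_def)
  have 2: "\<omega>' (tshift N x (e i)) = avg cube (\<lambda>w. \<omega>' (tshift N x (e i + w))) + T \<omega>' x" for x
    using flow[of "\<lambda>w. \<omega>' (tshift N x (e i + w))"] by (simp add: T_def)
  have "(\<Sum>x\<in>V. f x * \<omega> (tshift N x (e i)))
     = (\<Sum>x\<in>V. f x * T \<omega> x) + (\<Sum>x\<in>V. f x * T \<omega>' x) + (\<Sum>x\<in>V. f x * avg cube (\<lambda>w. \<omega>' (tshift N x (e i + w))))"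
    unfolding 1 2 by (simp add: distrib_left sum.distrib)
  moreover have "(\<Sum>x\<in>V. f x * T \<omega> x) = (\<Sum>j\<in>UNIV. \<Sum>z\<in>V. (\<omega> z - \<omega> (tshift N z (e j))) * h j z)"
    unfolding T_def h_def by (rule transport_identity)
  moreover have "(\<Sum>x\<in>V. f x * T \<omega>' x) = (\<Sum>j\<in>UNIV. \<Sum>z\<in>V. (\<omega> z - \<omega> (tshift N z (e j))) * avg cube (\<lambda>v. h j (tshift N z (- v))))"
  proof -
    \<comment> \<open>The averaging inside \<open>\<omega>'\<close> is handed to the weight by
      translation, hence with the reversed displacement.\<close>
    have "(\<Sum>z\<in>V. (\<omega>' z - \<omega>' (tshift N z (e j))) * h j z)
       = (\<Sum>z\<in>V. (\<omega> z - \<omega> (tshift N z (e j))) * avg cube (\<lambda>v. h j (tshift N z (- v))))" for j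
    proof -
      have "\<omega>' z - \<omega>' (tshift N z (e j)) = avg cube (\<lambda>v. \<omega> (tshift N z v) - \<omega> (tshift N (tshift N z v) (e j)))" for z
        unfolding \<omega>'_def avg_diff by (simp add: add.commute)
      then have "(\<Sum>z\<in>V. (\<omega>' z - \<omega>' (tshift N z (e j))) * h j z)
         = avg cube (\<lambda>v. \<Sum>z\<in>V. (\<omega> (tshift N z v) - \<omega> (tshift N (tshift N z v) (e j))) * h j z)"
        unfolding avg_sum_swap by (simp add: avg_mult_right)
      also have "\<dots> = avg cube (\<lambda>v. \<Sum>z\<in>V. (\<omega> z - \<omega> (tshift N z (e j))) * h j (tshift N z (- v)))"
        by (subst sum_tshift_subst[of "\<lambda>z y. (\<omega> y - \<omega> (tshift N y (e j))) * h j z"]) (rule refl)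
      finally show ?thesis unfolding avg_sum_swap by (simp add: avg_mult_left)
    qed
    then show ?thesis unfolding T_def transport_identity by (simp add: h_def)
  qed
  moreover have "(\<Sum>x\<in>V. f x * avg cube (\<lambda>w. \<omega>' (tshift N x (e i + w))))
     = (\<Sum>z\<in>V. avg cube (\<lambda>w. f (tshift N z (- e i - w))) * \<omega>' z)"
  proof -
    have "(\<Sum>x\<in>V. f x * avg cube (\<lambda>w. \<omega>' (tshift N x (e i + w)))) = avg cube (\<lambda>w. \<Sum>x\<in>V. f x * \<omega>' (tshift N x (e i + w)))"
      unfolding avg_sum_swap by (simp add: avg_mult_left)
    also have "\<dots> = avg cube (\<lambda>w. \<Sum>z\<in>V. f (tshift N z (- (e i + w))) * \<omega>' z)"
      by (subst sum_tshift_subst[of "\<lambda>x z. f x * \<omega>' z"]) (rule refl)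
    finally show ?thesis unfolding avg_sum_swap by (simp add: avg_mult_right)
  qed
  ultimately show ?thesis by (simp add: \<omega>'_def distrib_left sum.distrib)
qed

text \<open>The weights on the bond from \<open>z\<close> to \<open>z + e j\<close> involve only
  sites \<open>z - a\<close> with \<open>a\<close> as assumed here: strictly behind both ends in
  direction \<open>i\<close> and, by \<open>size\<close>, too close to meet them around the torus.
  This yields the invariance under hops that integration by parts requires.\<close>

lemma tshift_avoids:
  assumes a: "1 \<le> a $ i" "a $ i < 2 * 2 ^ n"
  shows "tshift N z (- a) \<noteq> tshift N z 0" "tshift N z (- a) \<noteq> tshift N z (e j)"
proof -
  have sz: "2 * 2 ^ n + 2 \<le> int N"
  proof -
    have "int (2 * 2 ^ n + 2) \<le> int N" by (rule of_nat_mono[OF size])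
    then show ?thesis by simp
  qed
  have e01: "e j $ i = 0 \<or> e j $ i = 1" by (auto simp: axis_def)
  show "tshift N z (- a) \<noteq> tshift N z 0"
  proof
    assume "tshift N z (- a) = tshift N z 0"
    then have "int N dvd (- a) $ i - 0 $ i" by (simp only: tshift_eq_iff)
    moreover have "\<bar>(- a) $ i - 0 $ i\<bar> < int N" using a sz by simp
    ultimately have "(- a) $ i - 0 $ i = 0" by (rule abs_less_dvd_0[rotated])
    then show False using a by simp
  qed
  show "tshift N z (- a) \<noteq> tshift N z (e j)"
  proof
    assume "tshift N z (- a) = tshift N z (e j)"
    then have "int N dvd (- a) $ i - e j $ i" by (simp only: tshift_eq_iff)
    moreover have "\<bar>(- a) $ i - e j $ i\<bar> < int N" using a sz e01 by auto
    ultimately have "(- a) $ i - e j $ i = 0" by (rule abs_less_dvd_0[rotated])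
    then show False using a e01 by auto
  qed
qed

lemma hop_unaffected:
  assumes a: "1 \<le> a $ i" "a $ i < 2 * 2 ^ n" and z: "z \<in> V"
  shows "hop z (tshift N z (e j)) \<eta> (tshift N z (- a)) = \<eta> (tshift N z (- a))"
    "hop (tshift N z (e j)) z \<eta> (tshift N z (- a)) = \<eta> (tshift N z (- a))"
  using tshift_avoids[OF a, of z] z by (auto simp: hop_def Let_def)

text \<open>Two uses of the flow leave bond terms and products of cube averages. The bond terms go
  into \<open>D\<close> and into squares of the weights, of size \<open>\<epsilon>^2 * G\<close>
  times the bracket by \<open>local_squares\<close>; the products carry \<epsilon> and
  \<open>1 / card cube\<close>. The three summands of \<open>C\<close> come from these squares, from
  the \<open>\<epsilon>^2\<close> lost on each bond, and from the averages.\<close>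

lemma quadratic_estimate:
  fixes c \<phi> :: "'d \<Rightarrow> int ^ 'd \<Rightarrow> real" and G H D C :: real
  assumes u: "\<And>\<eta>. \<eta> \<in> \<Omega> \<Longrightarrow> u \<eta> > 0" and u1: "(\<Sum>\<eta>\<in>\<Omega>. u \<eta>) = 1"
    and c: "\<And>i x. x \<in> V \<Longrightarrow> \<bar>c i x\<bar> \<le> P * \<epsilon>"
    and flow: "\<And>g. g 0 - avg cube g = (\<Sum>j\<in>UNIV. \<Sum>v\<in>cube. \<phi> j v * (g v - g (v + e j)))"
    and G: "(\<Sum>j\<in>UNIV. \<Sum>v\<in>cube. (\<phi> j v)\<^sup>2) \<le> G"
  defines "H \<equiv> ent \<Omega> u \<nu>" and "D \<equiv> (\<Sum>i\<in>UNIV. \<Sum>x\<in>V. p i * dirichlet u x (tshift N x (dir i)))"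
    and "C \<equiv> (3 / (2 * p0) + (K + 1)) * 4 * (real CARD('d))\<^sup>2 * K\<^sup>2 * P\<^sup>2 + (K + 1) * CARD('d) + CARD('d) * K\<^sup>2 * (P\<^sup>2 + 1)"
  shows "(\<Sum>\<eta>\<in>\<Omega>. u \<eta> * (\<Sum>i\<in>UNIV. \<Sum>x\<in>V. c i x * (om \<eta> x * om \<eta> (tshift N x (e i)))))
    \<le> D + C * (\<epsilon>\<^sup>2 * (G + 1) * (card cube * H + card V) + \<epsilon> * (H + card V / card cube))"
proof -
  have u0: "\<And>\<eta>. \<eta> \<in> \<Omega> \<Longrightarrow> u \<eta> \<ge> 0" using u by (simp add: less_imp_le)
  have H0: "H \<ge> 0" unfolding H_def by (rule ent_nonneg[OF finite_\<Omega> u0 u1 weight_pos sum_weight])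
  have P\<epsilon>: "P * \<epsilon> \<ge> 0" using p_le_P(3) eps by simp
  let ?Eu = "\<lambda>F. \<Sum>\<eta>\<in>\<Omega>. u \<eta> * F \<eta> :: real"
  have Eu_mono: "?Eu F \<le> ?Eu F'" if "\<And>\<eta>. \<eta> \<in> \<Omega> \<Longrightarrow> F \<eta> \<le> F' \<eta>" for F F' :: "_ \<Rightarrow> real"
    using that u0 by (intro sum_mono mult_left_mono) auto
  have Eu_sum: "?Eu (\<lambda>\<eta>. \<Sum>a\<in>A. F a \<eta>) = (\<Sum>a\<in>A. ?Eu (F a))" for A :: "'z set" and F
    unfolding sum_distrib_left by (rule sum.swap)
  define M where "M = card cube * H + card V"
  have M0: "M \<ge> 0" using H0 by (simp add: M_def)
  define h where "h = (\<lambda>i j z \<eta>. \<Sum>w\<in>cube. \<phi> j w * (c i (tshift N z (- e i - w)) * om \<eta> (tshift N z (- e i - w))))"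
  define h' where "h' = (\<lambda>i j z \<eta>. avg cube (\<lambda>v. h i j (tshift N z (- v)) \<eta>))"
  define A where "A = (\<lambda>i z \<eta>. avg cube (\<lambda>w. c i (tshift N z (- e i - w)) * om \<eta> (tshift N z (- e i - w))))"
  define B where "B = (\<lambda>z \<eta>. avg cube (\<lambda>w. om \<eta> (tshift N z w)))"
  define h'' where "h'' = (\<lambda>j z \<eta>. \<Sum>i\<in>UNIV. h i j z \<eta> + h' i j z \<eta>)"
  have decomp: "(\<Sum>i\<in>UNIV. \<Sum>x\<in>V. c i x * (om \<eta> x * om \<eta> (tshift N x (e i))))
     = (\<Sum>j\<in>UNIV. \<Sum>z\<in>V. h'' j z \<eta> * (om \<eta> z - om \<eta> (tshift N z (e j)))) + (\<Sum>i\<in>UNIV. \<Sum>z\<in>V. A i z \<eta> * B z \<eta>)" for \<eta>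
  proof -
    have "(\<Sum>x\<in>V. c i x * (om \<eta> x * om \<eta> (tshift N x (e i))))
       = (\<Sum>j\<in>UNIV. \<Sum>z\<in>V. (om \<eta> z - om \<eta> (tshift N z (e j))) * (h i j z \<eta> + h' i j z \<eta>)) + (\<Sum>z\<in>V. A i z \<eta> * B z \<eta>)" for i
      using block_decomposition[OF flow, of "\<lambda>x. c i x * om \<eta> x" "om \<eta>" i]
      by (simp add: h_def h'_def A_def B_def mult.assoc)
    then have "(\<Sum>i\<in>UNIV. \<Sum>x\<in>V. c i x * (om \<eta> x * om \<eta> (tshift N x (e i))))
       = (\<Sum>i\<in>UNIV. \<Sum>j\<in>UNIV. \<Sum>z\<in>V. (om \<eta> z - om \<eta> (tshift N z (e j))) * (h i j z \<eta> + h' i j z \<eta>)) + (\<Sum>i\<in>UNIV. \<Sum>z\<in>V. A i z \<eta> * B z \<eta>)"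
      by (simp add: sum.distrib)
    moreover have "(\<Sum>i\<in>UNIV. \<Sum>j\<in>UNIV. \<Sum>z\<in>V. (om \<eta> z - om \<eta> (tshift N z (e j))) * (h i j z \<eta> + h' i j z \<eta>))
       = (\<Sum>j\<in>UNIV. \<Sum>z\<in>V. h'' j z \<eta> * (om \<eta> z - om \<eta> (tshift N z (e j))))"
      unfolding h''_def sum_distrib_right
      by (subst sum.swap, rule sum.cong[OF refl], subst sum.swap) (simp add: mult.commute)
    ultimately show ?thesis by simp
  qed
  have sq: "?Eu (\<lambda>\<eta>. \<Sum>z\<in>V. (h i j z \<eta>)\<^sup>2) \<le> K\<^sup>2 * ((P * \<epsilon>)\<^sup>2 * (\<Sum>w\<in>cube. (\<phi> j w)\<^sup>2)) * M" for i j
    unfolding h_def M_def H_def by (rule local_squares[OF u0 u1 _ c P\<epsilon>]) auto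
  \<comment> \<open>Jensen's inequality and translation invariance: averaging does not increase the
    sum of the squares.\<close>
  have h'_sq: "(\<Sum>z\<in>V. (h' i j z \<eta>)\<^sup>2) \<le> (\<Sum>z\<in>V. (h i j z \<eta>)\<^sup>2)" for i j \<eta>
  proof -
    have "(\<Sum>z\<in>V. (h' i j z \<eta>)\<^sup>2) \<le> (\<Sum>z\<in>V. avg cube (\<lambda>v. (h i j (tshift N z (- v)) \<eta>)\<^sup>2))"
      unfolding h'_def by (intro sum_mono avg_power2_le) simp
    also have "\<dots> = avg cube (\<lambda>v. \<Sum>z\<in>V. (h i j (tshift N z (- v)) \<eta>)\<^sup>2)" by (rule avg_sum_swap[symmetric])
    also have "\<dots> = avg cube (\<lambda>v. \<Sum>z\<in>V. (h i j z \<eta>)\<^sup>2)"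
      by (subst sum_tshift[OF N(1), of "\<lambda>z. (h i j z \<eta>)\<^sup>2"]) (rule refl)
    also have "\<dots> = (\<Sum>z\<in>V. (h i j z \<eta>)\<^sup>2)" by (intro avg_const cube_ne) simp
    finally show ?thesis .
  qed
  \<comment> \<open>The factor 4 d: d from squaring the sum over \<open>i\<close>, and 2 + 2 from
    squaring \<open>h + h'\<close>, the part of \<open>h'\<close> being dominated by that of
    \<open>h\<close>.\<close>
  have h''_sq: "(\<Sum>j\<in>UNIV. \<Sum>z\<in>V. (h'' j z \<eta>)\<^sup>2) \<le> 4 * CARD('d) * (\<Sum>i\<in>UNIV. \<Sum>j\<in>UNIV. \<Sum>z\<in>V. (h i j z \<eta>)\<^sup>2)" for \<eta>
  proof -
    have "(h'' j z \<eta>)\<^sup>2 \<le> CARD('d) * (\<Sum>i\<in>UNIV. 2 * (h i j z \<eta>)\<^sup>2 + 2 * (h' i j z \<eta>)\<^sup>2)" for j z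
      unfolding h''_def
    proof (rule order_trans[OF power2_sum_le_card], intro mult_left_mono sum_mono)
      fix i show "(h i j z \<eta> + h' i j z \<eta>)\<^sup>2 \<le> 2 * (h i j z \<eta>)\<^sup>2 + 2 * (h' i j z \<eta>)\<^sup>2"
        using zero_le_power2[of "h i j z \<eta> - h' i j z \<eta>"] by (simp add: power2_sum power2_diff)
    qed simp
    then have "(\<Sum>j\<in>UNIV. \<Sum>z\<in>V. (h'' j z \<eta>)\<^sup>2) \<le> (\<Sum>j\<in>UNIV. \<Sum>z\<in>V. CARD('d) * (\<Sum>i\<in>UNIV. 2 * (h i j z \<eta>)\<^sup>2 + 2 * (h' i j z \<eta>)\<^sup>2))"
      by (intro sum_mono)
    also have "\<dots> = CARD('d) * (\<Sum>i\<in>UNIV. \<Sum>j\<in>UNIV. \<Sum>z\<in>V. 2 * (h i j z \<eta>)\<^sup>2 + 2 * (h' i j z \<eta>)\<^sup>2)"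
      unfolding sum_distrib_left[symmetric]
      by (subst (2) sum.swap, subst (3) sum.swap) (rule refl)
    also have "\<dots> = CARD('d) * (\<Sum>i\<in>UNIV. \<Sum>j\<in>UNIV. 2 * (\<Sum>z\<in>V. (h i j z \<eta>)\<^sup>2) + 2 * (\<Sum>z\<in>V. (h' i j z \<eta>)\<^sup>2))"
      by (simp add: sum.distrib sum_distrib_left)
    also have "\<dots> \<le> CARD('d) * (\<Sum>i\<in>UNIV. \<Sum>j\<in>UNIV. 4 * (\<Sum>z\<in>V. (h i j z \<eta>)\<^sup>2))"
    proof (intro mult_left_mono sum_mono)
      fix i j
      show "2 * (\<Sum>z\<in>V. (h i j z \<eta>)\<^sup>2) + 2 * (\<Sum>z\<in>V. (h' i j z \<eta>)\<^sup>2) \<le> 4 * (\<Sum>z\<in>V. (h i j z \<eta>)\<^sup>2)"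
        using h'_sq[of i j \<eta>] by linarith
    qed simp
    also have "\<dots> = 4 * CARD('d) * (\<Sum>i\<in>UNIV. \<Sum>j\<in>UNIV. \<Sum>z\<in>V. (h i j z \<eta>)\<^sup>2)"
      by (simp add: sum_distrib_left[symmetric])
    finally show ?thesis .
  qed
  have energy: "?Eu (\<lambda>\<eta>. \<Sum>j\<in>UNIV. \<Sum>z\<in>V. (h'' j z \<eta>)\<^sup>2) \<le> 4 * (real CARD('d))\<^sup>2 * K\<^sup>2 * P\<^sup>2 * (\<epsilon>\<^sup>2 * G * M)"
  proof -
    have "?Eu (\<lambda>\<eta>. \<Sum>j\<in>UNIV. \<Sum>z\<in>V. (h'' j z \<eta>)\<^sup>2) \<le> ?Eu (\<lambda>\<eta>. 4 * CARD('d) * (\<Sum>i\<in>UNIV. \<Sum>j\<in>UNIV. \<Sum>z\<in>V. (h i j z \<eta>)\<^sup>2))"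
      by (rule Eu_mono) (rule h''_sq)
    also have "\<dots> = 4 * CARD('d) * (\<Sum>i\<in>UNIV. \<Sum>j\<in>UNIV. ?Eu (\<lambda>\<eta>. \<Sum>z\<in>V. (h i j z \<eta>)\<^sup>2))"
      unfolding Eu_sum[symmetric] by (simp add: sum_distrib_left mult_ac)
    also have "\<dots> \<le> 4 * CARD('d) * (\<Sum>i\<in>(UNIV :: 'd set). \<Sum>j\<in>UNIV. K\<^sup>2 * ((P * \<epsilon>)\<^sup>2 * (\<Sum>w\<in>cube. (\<phi> j w)\<^sup>2)) * M)"
      by (rule mult_left_mono, rule sum_mono, rule sum_mono, rule sq) simp
    also have "\<dots> = 4 * (real CARD('d))\<^sup>2 * K\<^sup>2 * P\<^sup>2 * \<epsilon>\<^sup>2 * M * (\<Sum>j\<in>UNIV. \<Sum>w\<in>cube. (\<phi> j w)\<^sup>2)"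
      by (simp add: sum_distrib_left[symmetric] sum_distrib_right[symmetric] power2_eq_square mult_ac)
    also have "\<dots> \<le> 4 * (real CARD('d))\<^sup>2 * K\<^sup>2 * P\<^sup>2 * \<epsilon>\<^sup>2 * M * G"
      using G M0 by (intro mult_left_mono) auto
    finally show ?thesis by (simp add: mult_ac)
  qed
  have bonds: "?Eu (\<lambda>\<eta>. h'' j z \<eta> * (om \<eta> z - om \<eta> (tshift N z (e j))))
     \<le> p (Inl j) * dirichlet u z (tshift N z (e j)) + p (Inr j) * dirichlet u (tshift N z (e j)) z
      + (3 / (2 * p0) + (K + 1)) * ?Eu (\<lambda>\<eta>. (h'' j z \<eta>)\<^sup>2) + (K + 1) * \<epsilon>\<^sup>2" if z: "z \<in> V" for j z
  proof (rule bond_estimate[OF u u1 z])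
    have bounds: "1 \<le> (e i + w) $ i" "(e i + w) $ i < 2 * 2 ^ n" "1 \<le> (v + (e i + w)) $ i" "(v + (e i + w)) $ i < 2 * 2 ^ n"
      if "w \<in> cube" "v \<in> cube" for i w v
    proof -
      have "w $ i \<in> {0..<int (2 ^ n)}" "v $ i \<in> {0..<int (2 ^ n)}" using that unfolding sites_def by blast+
      then have "0 \<le> w $ i" "w $ i < 2 ^ n" "0 \<le> v $ i" "v $ i < 2 ^ n" by auto
      moreover have "e i $ i = 1" by (simp add: axis_def)
      ultimately show "1 \<le> (e i + w) $ i" "(e i + w) $ i < 2 * 2 ^ n" "1 \<le> (v + (e i + w)) $ i" "(v + (e i + w)) $ i < 2 * 2 ^ n"
        by simp_all
    qed
    \<comment> \<open>\<open>h\<close> is the case \<open>v = 0\<close> of the shifted weights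
      averaged in \<open>h'\<close>, so one argument covers both.\<close>
    have b0: "0 \<in> cube" by (simp add: sites_def)
    have agree: "h'' j z \<zeta> = h'' j z \<eta>"
      if ag: "\<And>i v w. v \<in> cube \<Longrightarrow> w \<in> cube \<Longrightarrow> \<zeta> (tshift N z (- (v + (e i + w)))) = \<eta> (tshift N z (- (v + (e i + w))))" for \<zeta> \<eta>
    proof -
      have shifted: "h i j (tshift N z (- v)) \<zeta> = h i j (tshift N z (- v)) \<eta>" if "v \<in> cube" for i v
        unfolding h_def
      proof (rule sum.cong[OF refl])
        fix w assume "w \<in> cube"
        have "tshift N (tshift N z (- v)) (- e i - w) = tshift N z (- (v + (e i + w)))" by simp
        then show "\<phi> j w * (c i (tshift N (tshift N z (- v)) (- e i - w)) * om \<zeta> (tshift N (tshift N z (- v)) (- e i - w)))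
            = \<phi> j w * (c i (tshift N (tshift N z (- v)) (- e i - w)) * om \<eta> (tshift N (tshift N z (- v)) (- e i - w)))"
          using ag[OF \<open>v \<in> cube\<close> \<open>w \<in> cube\<close>, of i] by (simp only:)
      qed
      have "h' i j z \<zeta> = h' i j z \<eta>" for i
        unfolding h'_def avg_def using shifted by (simp cong: sum.cong)
      moreover have "h i j z \<zeta> = h i j z \<eta>" for i
        using shifted[OF b0, of i] z by simp
      ultimately show ?thesis unfolding h''_def by simp
    qed
    show "h'' j z (hop z (tshift N z (e j)) \<eta>) = h'' j z \<eta>" for \<eta>
      by (rule agree, rule hop_unaffected(1)[OF _ _ z, of _ ]) (use bounds in blast)+
    show "h'' j z (hop (tshift N z (e j)) z \<eta>) = h'' j z \<eta>" for \<eta>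
      by (rule agree, rule hop_unaffected(2)[OF _ _ z]) (use bounds in blast)+
  qed
  \<comment> \<open>Jumps against an axis, indexed here by the lower end of the bond, are reindexed
    by their starting point, as in \<open>D\<close>.\<close>
  have D_eq: "(\<Sum>j\<in>UNIV. \<Sum>z\<in>V. p (Inl j) * dirichlet u z (tshift N z (e j)) + p (Inr j) * dirichlet u (tshift N z (e j)) z) = D"
  proof -
    have "(\<Sum>z\<in>V. dirichlet u (tshift N z (e j)) z) = (\<Sum>y\<in>V. dirichlet u y (tshift N y (- e j)))" for j
      using sum_tshift_subst[of "\<lambda>x y. dirichlet u y x" "e j"] sum_tshift_subst[of "\<lambda>x y. dirichlet u x y" "- e j"] by simp
    then have "(\<Sum>z\<in>V. p (Inr j) * dirichlet u (tshift N z (e j)) z) = (\<Sum>y\<in>V. p (Inr j) * dirichlet u y (tshift N y (- e j)))" for j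
      by (simp add: sum_distrib_left[symmetric])
    then show ?thesis unfolding D_def UNIV_Plus_UNIV[symmetric] by (subst sum.Plus) (simp_all add: sum.distrib)
  qed
  have split3: "(\<Sum>j\<in>UNIV. \<Sum>z\<in>V. a j z + k * b j z + q) = (\<Sum>j\<in>UNIV. \<Sum>z\<in>V. a j z) + k * (\<Sum>j\<in>UNIV. \<Sum>z\<in>V. b j z) + q * (CARD('d) * card V)"
    for a b :: "'d \<Rightarrow> int ^ 'd \<Rightarrow> real" and k q
    by (simp add: sum.distrib sum_distrib_left mult_ac)
  have part1: "?Eu (\<lambda>\<eta>. \<Sum>j\<in>UNIV. \<Sum>z\<in>V. h'' j z \<eta> * (om \<eta> z - om \<eta> (tshift N z (e j))))
     \<le> D + (3 / (2 * p0) + (K + 1)) * (4 * (real CARD('d))\<^sup>2 * K\<^sup>2 * P\<^sup>2 * (\<epsilon>\<^sup>2 * G * M)) + (K + 1) * \<epsilon>\<^sup>2 * (CARD('d) * card V)"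
  proof -
    have "?Eu (\<lambda>\<eta>. \<Sum>j\<in>UNIV. \<Sum>z\<in>V. h'' j z \<eta> * (om \<eta> z - om \<eta> (tshift N z (e j))))
       \<le> (\<Sum>j\<in>UNIV. \<Sum>z\<in>V. (p (Inl j) * dirichlet u z (tshift N z (e j)) + p (Inr j) * dirichlet u (tshift N z (e j)) z)
      + (3 / (2 * p0) + (K + 1)) * ?Eu (\<lambda>\<eta>. (h'' j z \<eta>)\<^sup>2) + (K + 1) * \<epsilon>\<^sup>2)"
      unfolding Eu_sum by (intro sum_mono bonds)
    also have "\<dots> = D + (3 / (2 * p0) + (K + 1)) * ?Eu (\<lambda>\<eta>. \<Sum>j\<in>UNIV. \<Sum>z\<in>V. (h'' j z \<eta>)\<^sup>2) + (K + 1) * \<epsilon>\<^sup>2 * (CARD('d) * card V)"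
      unfolding split3 D_eq Eu_sum ..
    also have "\<dots> \<le> D + (3 / (2 * p0) + (K + 1)) * (4 * (real CARD('d))\<^sup>2 * K\<^sup>2 * P\<^sup>2 * (\<epsilon>\<^sup>2 * G * M)) + (K + 1) * \<epsilon>\<^sup>2 * (CARD('d) * card V)"
      using energy p0 by (intro add_mono mult_left_mono) auto
    finally show ?thesis .
  qed
  have part2: "?Eu (\<lambda>\<eta>. \<Sum>z\<in>V. A i z \<eta> * B z \<eta>) \<le> K\<^sup>2 * (P\<^sup>2 + 1) * (\<epsilon> * (H + card V / card cube))" for i
  proof -
    define \<psi> where "\<psi> = (\<lambda>w :: int ^ 'd. 1 / real (card cube))"
    have psi: "(\<Sum>w\<in>cube. (\<psi> w)\<^sup>2) = 1 / card cube"
      using cube_card(2) by (simp add: \<psi>_def power2_eq_square)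
    have A_eq: "A i z \<eta> = (\<Sum>w\<in>cube. \<psi> w * (c i (tshift N z (- e i - w)) * om \<eta> (tshift N z (- e i - w))))" for z \<eta>
      by (simp add: A_def avg_def \<psi>_def sum_divide_distrib)
    have B_eq: "B z \<eta> = (\<Sum>w\<in>cube. \<psi> w * (1 * om \<eta> (tshift N z w)))" for z \<eta>
      by (simp add: B_def avg_def \<psi>_def sum_divide_distrib)
    have a: "?Eu (\<lambda>\<eta>. \<Sum>z\<in>V. (A i z \<eta>)\<^sup>2) \<le> K\<^sup>2 * ((P * \<epsilon>)\<^sup>2 * (1 / card cube)) * M"
      unfolding A_eq psi[symmetric] M_def H_def by (rule local_squares[OF u0 u1 _ c P\<epsilon>]) auto
    have b: "?Eu (\<lambda>\<eta>. \<Sum>z\<in>V. (B z \<eta>)\<^sup>2) \<le> K\<^sup>2 * (1\<^sup>2 * (1 / card cube)) * M"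
      unfolding B_eq psi[symmetric] M_def H_def by (rule local_squares[OF u0 u1]) auto
    \<comment> \<open>\<open>A\<close> carries a factor \<epsilon> from the coefficients
      \<open>c\<close>, so the weights \<open>1 / \<epsilon>\<close> and \<epsilon> make both terms
      of order \<epsilon>.\<close>
    have ab: "A i z \<eta> * B z \<eta> \<le> 1 / \<epsilon> * (A i z \<eta>)\<^sup>2 + \<epsilon> * (B z \<eta>)\<^sup>2" for z \<eta>
    proof -
      define x where "x = A i z \<eta> / \<epsilon>"
      have x: "A i z \<eta> = \<epsilon> * x" using eps by (simp add: x_def)
      have "x * B z \<eta> \<le> x\<^sup>2 + (B z \<eta>)\<^sup>2"
        using sum_squares_bound[of x "B z \<eta>"] zero_le_power2[of x] zero_le_power2[of "B z \<eta>"] by linarith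
      then have "\<epsilon> * (x * B z \<eta>) \<le> \<epsilon> * (x\<^sup>2 + (B z \<eta>)\<^sup>2)" using eps by (intro mult_left_mono) auto
      also have "\<dots> = 1 / \<epsilon> * (A i z \<eta>)\<^sup>2 + \<epsilon> * (B z \<eta>)\<^sup>2"
        unfolding x using eps by (simp add: power2_eq_square distrib_left)
      finally show ?thesis by (simp add: x)
    qed
    have "?Eu (\<lambda>\<eta>. \<Sum>z\<in>V. A i z \<eta> * B z \<eta>) \<le> ?Eu (\<lambda>\<eta>. 1 / \<epsilon> * (\<Sum>z\<in>V. (A i z \<eta>)\<^sup>2) + \<epsilon> * (\<Sum>z\<in>V. (B z \<eta>)\<^sup>2))"
      unfolding sum_distrib_left sum.distrib[symmetric] by (intro sum_mono Eu_mono ab mult_left_mono u0)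
    also have "\<dots> = 1 / \<epsilon> * ?Eu (\<lambda>\<eta>. \<Sum>z\<in>V. (A i z \<eta>)\<^sup>2) + \<epsilon> * ?Eu (\<lambda>\<eta>. \<Sum>z\<in>V. (B z \<eta>)\<^sup>2)"
      unfolding sum_distrib_left[of "1 / \<epsilon>" _ \<Omega>] sum_distrib_left[of "\<epsilon>" _ \<Omega>] sum.distrib[symmetric]
      by (intro sum.cong refl) (simp add: distrib_left)
    also have "\<dots> \<le> 1 / \<epsilon> * (K\<^sup>2 * ((P * \<epsilon>)\<^sup>2 * (1 / card cube)) * M) + \<epsilon> * (K\<^sup>2 * (1\<^sup>2 * (1 / card cube)) * M)"
      using eps by (intro add_mono mult_left_mono a b) auto
    also have "\<dots> = K\<^sup>2 * (P\<^sup>2 + 1) * (\<epsilon> * (M / card cube))"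
      using eps by (simp add: power2_eq_square distrib_left distrib_right add_divide_distrib mult_ac)
    also have "M / card cube = H + card V / card cube"
      using cube_card(2) cube_ne by (simp add: M_def add_divide_distrib)
    finally show ?thesis .
  qed
  define Y1 Y2 where "Y1 = \<epsilon>\<^sup>2 * (G + 1) * M" and "Y2 = \<epsilon> * (H + card V / card cube)"
  have G0: "G \<ge> 0" using order_trans[OF _ G] by (simp add: sum_nonneg)
  have Y: "Y1 \<ge> 0" "Y2 \<ge> 0" using G0 M0 H0 eps by (auto simp: Y1_def Y2_def)
  have y1: "\<epsilon>\<^sup>2 * G * M \<le> Y1" "\<epsilon>\<^sup>2 * card V \<le> Y1"
  proof -
    show "\<epsilon>\<^sup>2 * G * M \<le> Y1" unfolding Y1_def using M0 by (intro mult_right_mono mult_left_mono) auto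
    have "card V \<le> M" unfolding M_def using H0 by simp
    then have "\<epsilon>\<^sup>2 * 1 * card V \<le> \<epsilon>\<^sup>2 * (G + 1) * M" using G0 by (intro mult_mono mult_left_mono) auto
    then show "\<epsilon>\<^sup>2 * card V \<le> Y1" by (simp add: Y1_def)
  qed
  have "?Eu (\<lambda>\<eta>. \<Sum>i\<in>UNIV. \<Sum>x\<in>V. c i x * (om \<eta> x * om \<eta> (tshift N x (e i))))
     = ?Eu (\<lambda>\<eta>. \<Sum>j\<in>UNIV. \<Sum>z\<in>V. h'' j z \<eta> * (om \<eta> z - om \<eta> (tshift N z (e j)))) + (\<Sum>i\<in>UNIV. ?Eu (\<lambda>\<eta>. \<Sum>z\<in>V. A i z \<eta> * B z \<eta>))"
    unfolding decomp Eu_sum[symmetric] by (simp add: distrib_left sum.distrib)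
  also have "\<dots> \<le> (D + (3 / (2 * p0) + (K + 1)) * (4 * (real CARD('d))\<^sup>2 * K\<^sup>2 * P\<^sup>2 * (\<epsilon>\<^sup>2 * G * M)) + (K + 1) * \<epsilon>\<^sup>2 * (CARD('d) * card V))
      + (\<Sum>i\<in>(UNIV :: 'd set). K\<^sup>2 * (P\<^sup>2 + 1) * (\<epsilon> * (H + card V / card cube)))"
    by (intro add_mono part1 sum_mono part2)
  also have "\<dots> = D + ((3 / (2 * p0) + (K + 1)) * 4 * (real CARD('d))\<^sup>2 * K\<^sup>2 * P\<^sup>2) * (\<epsilon>\<^sup>2 * G * M) + ((K + 1) * CARD('d)) * (\<epsilon>\<^sup>2 * card V)
      + (CARD('d) * K\<^sup>2 * (P\<^sup>2 + 1)) * Y2"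
    by (simp only: sum_constant Y2_def of_nat_mult mult_ac)
  also have "\<dots> \<le> D + ((3 / (2 * p0) + (K + 1)) * 4 * (real CARD('d))\<^sup>2 * K\<^sup>2 * P\<^sup>2) * (Y1 + Y2) + ((K + 1) * CARD('d)) * (Y1 + Y2)
      + (CARD('d) * K\<^sup>2 * (P\<^sup>2 + 1)) * (Y1 + Y2)"
    using y1 Y p0 by (intro add_mono mult_left_mono order_refl) auto
  also have "\<dots> = D + C * (Y1 + Y2)" unfolding C_def by (simp add: distrib_right)
  finally show ?thesis by (simp add: Y1_def Y2_def M_def)
qed

end

section \<open>Entropy production of the exclusion generator\<close>

lemma move_eq_hop: "move = hop"
  by (intro ext) (simp add: move_def hop_def)

context torus_model
begin

text \<open>The generator applied to the occupation number of \<open>x\<close>, evaluated with the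
  profile in place of the occupation numbers.\<close>

definition flux :: "int ^ 'd \<Rightarrow> real" where
  "flux x = (\<Sum>i\<in>UNIV. p i * (r (tshift N x (- dir i)) * (K - r x) - r x * (K - r (tshift N x (dir i)))))"

lemma tshift_dir_neq: "x \<in> V \<Longrightarrow> x \<noteq> tshift N x (dir i)"
proof
  assume x: "x \<in> V" and "x = tshift N x (dir i)"
  then have "tshift N x 0 = tshift N x (dir i)" by simp
  then have d: "int N dvd (0 :: int ^ 'd) $ k - dir i $ k" for k by (simp only: tshift_eq_iff)
  show False
  proof (cases i)
    case (Inl j)
    then show ?thesis using d[of j] N by (auto simp: axis_def)
  next
    case (Inr j)
    then show ?thesis using d[of j] N by (auto simp: axis_def)
  qed
qed

text \<open>The Dirichlet forms cancel exactly: the jumps produce \<open>- D\<close> and the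
  quadratic terms cost at most \<open>D\<close>. A summation by parts gathers the linear terms site
  by site, with \<open>flux\<close> as coefficient.\<close>

lemma entropy_production_estimate:
  fixes \<phi> :: "'d \<Rightarrow> int ^ 'd \<Rightarrow> real" and G H C :: real
  assumes u: "\<And>\<eta>. \<eta> \<in> \<Omega> \<Longrightarrow> u \<eta> > 0" and u1: "(\<Sum>\<eta>\<in>\<Omega>. u \<eta>) = 1"
    and flow: "\<And>g. g 0 - avg cube g = (\<Sum>j\<in>UNIV. \<Sum>v\<in>cube. \<phi> j v * (g v - g (v + e j)))"
    and G: "(\<Sum>j\<in>UNIV. \<Sum>v\<in>cube. (\<phi> j v)\<^sup>2) \<le> G"
  defines "H \<equiv> ent \<Omega> u \<nu>"
    and "C \<equiv> (3 / (2 * p0) + (K + 1)) * 4 * (real CARD('d))\<^sup>2 * K\<^sup>2 * P\<^sup>2 + (K + 1) * CARD('d) + CARD('d) * K\<^sup>2 * (P\<^sup>2 + 1)"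
  shows "(\<Sum>\<eta>\<in>\<Omega>. u \<eta> * generator p K N (\<lambda>\<eta>. ln (u \<eta> / \<nu> \<eta>)) \<eta>)
    \<le> (\<Sum>\<eta>\<in>\<Omega>. u \<eta> * (\<Sum>x\<in>V. flux x * (K * om \<eta> x / (r x * (K - r x)))))
      + C * (\<epsilon>\<^sup>2 * (G + 1) * (card cube * H + card V) + \<epsilon> * (H + card V / card cube))"
proof -
  let ?t = "\<lambda>x i. tshift N x (dir i)"
  let ?Eu = "\<lambda>F. \<Sum>\<eta>\<in>\<Omega>. u \<eta> * F \<eta> :: real"
  let ?rate = "\<lambda>\<eta> x y. real (\<eta> x) * (K - real (\<eta> y))"
  let ?g = "\<lambda>\<eta> x y. (K - real (\<eta> x)) * real (\<eta> y) * odds x y - real (\<eta> x) * (K - real (\<eta> y))"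
  let ?oh = "\<lambda>\<eta> x. K * om \<eta> x / (r x * (K - r x))"
  have Eu_sum: "?Eu (\<lambda>\<eta>. \<Sum>a\<in>A. F a \<eta>) = (\<Sum>a\<in>A. ?Eu (F a))" for A :: "'z set" and F
    unfolding sum_distrib_left by (rule sum.swap)
  have tV: "?t x i \<in> V" for x i by (rule tshift_in_sites[OF N(1)])
  have lift: "(\<Sum>i\<in>UNIV. \<Sum>x\<in>V. p i * (- d i x + ?Eu (\<lambda>\<eta>. g \<eta> i x))) = - (\<Sum>i\<in>UNIV. \<Sum>x\<in>V. p i * d i x) + ?Eu (\<lambda>\<eta>. \<Sum>i\<in>UNIV. \<Sum>x\<in>V. p i * g \<eta> i x)"
    for d :: "'d + 'd \<Rightarrow> int ^ 'd \<Rightarrow> real" and g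
    unfolding Eu_sum by (simp add: sum.distrib sum_subtractf sum_negf right_diff_distrib sum_distrib_left mult_ac)
  define D where "D = (\<Sum>i\<in>UNIV. \<Sum>x\<in>V. p i * dirichlet u x (?t x i))"
  \<comment> \<open>The two directed bonds between \<open>x\<close> and \<open>x + e j\<close>
    involve the same product of deviations, so their coefficients are merged.\<close>
  define c where "c = (\<lambda>j x. p (Inl j) * (1 - odds x (tshift N x (e j))) + p (Inr j) * (1 - odds (tshift N x (e j)) x))"
  have "?Eu (generator p K N (\<lambda>\<eta>. ln (u \<eta> / \<nu> \<eta>)))
     = (\<Sum>i\<in>UNIV. \<Sum>x\<in>V. p i * ?Eu (\<lambda>\<eta>. ?rate \<eta> x (?t x i) * (ln (u (hop x (?t x i) \<eta>) / \<nu> (hop x (?t x i) \<eta>)) - ln (u \<eta> / \<nu> \<eta>))))"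
    unfolding generator_def jump_rate_def move_eq_hop tshift_def Eu_sum sum_distrib_left[of "p _"]
    by (simp add: mult_ac)
  also have "\<dots> \<le> (\<Sum>i\<in>UNIV. \<Sum>x\<in>V. p i * (- dirichlet u x (?t x i) + ?Eu (\<lambda>\<eta>. ?g \<eta> x (?t x i))))"
  proof (intro sum_mono mult_left_mono p_nonneg)
    fix i x assume x: "x \<in> V"
    show "?Eu (\<lambda>\<eta>. ?rate \<eta> x (?t x i) * (ln (u (hop x (?t x i) \<eta>) / \<nu> (hop x (?t x i) \<eta>)) - ln (u \<eta> / \<nu> \<eta>)))
       \<le> - dirichlet u x (?t x i) + ?Eu (\<lambda>\<eta>. ?g \<eta> x (?t x i))"
      using entropy_production[where u = u, OF x tV[of x i] tshift_dir_neq[OF x] u] by (simp add: mult.assoc)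
  qed
  also have "\<dots> = - D + ?Eu (\<lambda>\<eta>. \<Sum>i\<in>UNIV. \<Sum>x\<in>V. p i * ?g \<eta> x (?t x i))"
    unfolding D_def by (rule lift)
  finally have prod: "?Eu (generator p K N (\<lambda>\<eta>. ln (u \<eta> / \<nu> \<eta>)))
     \<le> - D + ?Eu (\<lambda>\<eta>. \<Sum>i\<in>UNIV. \<Sum>x\<in>V. p i * ?g \<eta> x (?t x i))" .
  have expand: "(\<Sum>i\<in>UNIV. \<Sum>x\<in>V. p i * ?g \<eta> x (?t x i))
     = (\<Sum>x\<in>V. flux x * ?oh \<eta> x) + (\<Sum>j\<in>UNIV. \<Sum>x\<in>V. c j x * (om \<eta> x * om \<eta> (tshift N x (e j))))" for \<eta>
  proof -
    have lin: "(\<Sum>x\<in>V. r x * (K - r (?t x i)) * (?oh \<eta> (?t x i) - ?oh \<eta> x))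
       = (\<Sum>x\<in>V. (r (tshift N x (- dir i)) * (K - r x) - r x * (K - r (?t x i))) * ?oh \<eta> x)" for i
      using sum_tshift_subst[of "\<lambda>x y. r x * (K - r y) * ?oh \<eta> y" "dir i"]
      by (simp only: right_diff_distrib left_diff_distrib sum_subtractf)
    have "(\<Sum>x\<in>V. p i * ?g \<eta> x (?t x i)) = p i * (\<Sum>x\<in>V. r x * (K - r (?t x i)) * (?oh \<eta> (?t x i) - ?oh \<eta> x))
        + p i * (\<Sum>x\<in>V. (1 - odds x (?t x i)) * (om \<eta> x * om \<eta> (?t x i)))" for i
      unfolding sum_distrib_left sum.distrib[symmetric] distrib_left[symmetric]
    proof (rule sum.cong[OF refl])
      fix x assume x: "x \<in> V"
      show "p i * ?g \<eta> x (?t x i) = p i * (r x * (K - r (?t x i)) * (?oh \<eta> (?t x i) - ?oh \<eta> x)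
         + (1 - odds x (?t x i)) * (om \<eta> x * om \<eta> (?t x i)))"
        using flux_expansion[OF x tV[of x i], of "\<lambda>z. real (\<eta> z)"] by (simp only:)
    qed
    then have "(\<Sum>i\<in>UNIV. \<Sum>x\<in>V. p i * ?g \<eta> x (?t x i))
       = (\<Sum>i\<in>UNIV. p i * (\<Sum>x\<in>V. (r (tshift N x (- dir i)) * (K - r x) - r x * (K - r (?t x i))) * ?oh \<eta> x))
        + (\<Sum>i\<in>UNIV. p i * (\<Sum>x\<in>V. (1 - odds x (?t x i)) * (om \<eta> x * om \<eta> (?t x i))))"
      by (simp only: lin sum.distrib)
    moreover have "(\<Sum>i\<in>UNIV. p i * (\<Sum>x\<in>V. (r (tshift N x (- dir i)) * (K - r x) - r x * (K - r (?t x i))) * ?oh \<eta> x))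
       = (\<Sum>x\<in>V. flux x * ?oh \<eta> x)"
      unfolding flux_def sum_distrib_right sum_distrib_left by (subst sum.swap) (simp only: mult.assoc)
    moreover have "(\<Sum>i\<in>UNIV. p i * (\<Sum>x\<in>V. (1 - odds x (?t x i)) * (om \<eta> x * om \<eta> (?t x i))))
       = (\<Sum>j\<in>UNIV. \<Sum>x\<in>V. c j x * (om \<eta> x * om \<eta> (tshift N x (e j))))"
    proof -
      have "(\<Sum>x\<in>V. (1 - odds x (tshift N x (- e j))) * (om \<eta> x * om \<eta> (tshift N x (- e j))))
         = (\<Sum>x\<in>V. (1 - odds (tshift N x (e j)) x) * (om \<eta> x * om \<eta> (tshift N x (e j))))" for j
      proof -
        have "(\<Sum>x\<in>V. (1 - odds x (tshift N x (- e j))) * (om \<eta> x * om \<eta> (tshift N x (- e j))))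
           = (\<Sum>x\<in>V. (1 - odds (tshift N x (e j)) x) * (om \<eta> (tshift N x (e j)) * om \<eta> x))"
          using sum_tshift_subst[of "\<lambda>x y. (1 - odds x y) * (om \<eta> x * om \<eta> y)" "- e j"] by (simp only: minus_minus)
        also have "\<dots> = (\<Sum>x\<in>V. (1 - odds (tshift N x (e j)) x) * (om \<eta> x * om \<eta> (tshift N x (e j))))"
          by (rule sum.cong[OF refl], rule arg_cong[where f = "(*) _"], rule mult.commute)
        finally show ?thesis .
      qed
      note reflect = this
      have "(\<Sum>i\<in>UNIV. p i * (\<Sum>x\<in>V. (1 - odds x (?t x i)) * (om \<eta> x * om \<eta> (?t x i))))
         = (\<Sum>j\<in>UNIV. p (Inl j) * (\<Sum>x\<in>V. (1 - odds x (tshift N x (e j))) * (om \<eta> x * om \<eta> (tshift N x (e j)))))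
          + (\<Sum>j\<in>UNIV. p (Inr j) * (\<Sum>x\<in>V. (1 - odds (tshift N x (e j)) x) * (om \<eta> x * om \<eta> (tshift N x (e j)))))"
        unfolding UNIV_Plus_UNIV[symmetric] by (subst sum.Plus) (simp_all add: reflect)
      then show ?thesis
        unfolding c_def by (simp only: sum.distrib[symmetric] sum_distrib_left distrib_right mult.assoc)
    qed
    ultimately show ?thesis by simp
  qed
  have c_le: "\<bar>c j x\<bar> \<le> P * \<epsilon>" if x: "x \<in> V" for j x
  proof -
    have "\<bar>1 - odds x (tshift N x (e j))\<bar> \<le> \<epsilon>" using odds[OF x, of "Inl j"] by (simp add: abs_minus_commute)
    moreover have "\<bar>1 - odds (tshift N x (e j)) x\<bar> \<le> \<epsilon>"
      using odds[OF tshift_in_sites[OF N(1), of x "e j"], of "Inr j"] x by (simp add: abs_minus_commute)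
    ultimately have "\<bar>c j x\<bar> \<le> p (Inl j) * \<epsilon> + p (Inr j) * \<epsilon>"
      unfolding c_def by (intro order_trans[OF abs_triangle_ineq] add_mono) (auto simp: abs_mult p_nonneg intro!: mult_left_mono)
    also have "\<dots> \<le> P * \<epsilon>" using p_le_P(2)[of j] eps by (simp add: distrib_right[symmetric])
    finally show ?thesis .
  qed
  have "?Eu (\<lambda>\<eta>. \<Sum>i\<in>UNIV. \<Sum>x\<in>V. p i * ?g \<eta> x (?t x i))
     = ?Eu (\<lambda>\<eta>. \<Sum>x\<in>V. flux x * ?oh \<eta> x) + ?Eu (\<lambda>\<eta>. \<Sum>j\<in>UNIV. \<Sum>x\<in>V. c j x * (om \<eta> x * om \<eta> (tshift N x (e j))))"
    unfolding expand by (simp add: distrib_left sum.distrib)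
  moreover have "?Eu (\<lambda>\<eta>. \<Sum>j\<in>UNIV. \<Sum>x\<in>V. c j x * (om \<eta> x * om \<eta> (tshift N x (e j))))
     \<le> D + C * (\<epsilon>\<^sup>2 * (G + 1) * (card cube * H + card V) + \<epsilon> * (H + card V / card cube))"
    unfolding D_def C_def H_def by (rule quadratic_estimate[where u = u, OF u u1 c_le flow G])
  ultimately show ?thesis using prod by linarith
qed

end

section \<open>Finite Markov processes\<close>

text \<open>The weights \<open>v\<close> need not be the initial law of the given process: the
  semigroup is also run from the mixture.\<close>

definition evolve :: "'s set \<Rightarrow> (real \<Rightarrow> 's \<Rightarrow> 's pmf) \<Rightarrow> ('s \<Rightarrow> real) \<Rightarrow> real \<Rightarrow> 's \<Rightarrow> real" where
  "evolve S P v t \<eta> = (\<Sum>\<xi>\<in>S. v \<xi> * pmf (P t \<xi>) \<eta>)"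

locale finite_markov =
  fixes S :: "'s set" and P :: "real \<Rightarrow> 's \<Rightarrow> 's pmf" and L :: "('s \<Rightarrow> real) \<Rightarrow> 's \<Rightarrow> real"
  assumes fin: "finite S" and sg: "markov_semigroup S P" and gen: "has_generator S P L"
begin

lemma set_P: "t \<ge> 0 \<Longrightarrow> \<xi> \<in> S \<Longrightarrow> set_pmf (P t \<xi>) \<subseteq> S"
  using sg by (simp add: markov_semigroup_def)

lemma expectation_P:
  "t \<ge> 0 \<Longrightarrow> \<xi> \<in> S \<Longrightarrow> measure_pmf.expectation (P t \<xi>) g = (\<Sum>\<eta>\<in>S. pmf (P t \<xi>) \<eta> * g \<eta>)"
  for g :: "'s \<Rightarrow> real"
  using set_P[of t \<xi>] fin by (subst integral_measure_pmf[of S]) auto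

lemma sum_evolve:
  "t \<ge> 0 \<Longrightarrow> (\<Sum>\<eta>\<in>S. evolve S P v t \<eta> * g \<eta>) = (\<Sum>\<xi>\<in>S. v \<xi> * measure_pmf.expectation (P t \<xi>) g)"
  for g :: "'s \<Rightarrow> real"
  unfolding evolve_def sum_distrib_right
  by (subst sum.swap) (simp add: expectation_P sum_distrib_left mult_ac)

lemma evolve_nonneg: "(\<And>\<xi>. \<xi> \<in> S \<Longrightarrow> v \<xi> \<ge> 0) \<Longrightarrow> evolve S P v t \<eta> \<ge> 0"
  unfolding evolve_def by (intro sum_nonneg) auto

lemma evolve_mass: "t \<ge> 0 \<Longrightarrow> (\<Sum>\<eta>\<in>S. evolve S P v t \<eta>) = (\<Sum>\<xi>\<in>S. v \<xi>)"
  using sum_evolve[of t v "\<lambda>_. 1"] by simp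

lemma evolve_0: "\<eta> \<in> S \<Longrightarrow> evolve S P v 0 \<eta> = v \<eta>"
proof -
  assume "\<eta> \<in> S"
  have "evolve S P v 0 \<eta> = (\<Sum>\<xi>\<in>S. if \<xi> = \<eta> then v \<eta> else 0)"
    unfolding evolve_def using sg by (intro sum.cong) (auto simp: markov_semigroup_def pmf_return)
  then show ?thesis using \<open>\<eta> \<in> S\<close> fin by simp
qed

lemma evolve_add:
  assumes "s \<ge> 0" "h \<ge> 0"
  shows "(\<Sum>\<eta>\<in>S. evolve S P v (s + h) \<eta> * g \<eta>) = (\<Sum>\<eta>\<in>S. evolve S P v s \<eta> * measure_pmf.expectation (P h \<eta>) g)"
proof -
  have "measure_pmf.expectation (P (s + h) \<xi>) g = measure_pmf.expectation (P s \<xi>) (\<lambda>\<zeta>. measure_pmf.expectation (P h \<zeta>) g)"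
    if \<xi>: "\<xi> \<in> S" for \<xi>
  proof -
    have "P (s + h) \<xi> = bind_pmf (P s \<xi>) (P h)" using sg assms \<xi> by (simp add: markov_semigroup_def)
    then have "pmf (P (s + h) \<xi>) \<eta> = (\<Sum>\<zeta>\<in>S. pmf (P s \<xi>) \<zeta> * pmf (P h \<zeta>) \<eta>)" for \<eta>
      using assms \<xi> by (simp add: pmf_bind expectation_P)
    then have "measure_pmf.expectation (P (s + h) \<xi>) g = (\<Sum>\<eta>\<in>S. (\<Sum>\<zeta>\<in>S. pmf (P s \<xi>) \<zeta> * pmf (P h \<zeta>) \<eta>) * g \<eta>)"
      using assms \<xi> by (simp add: expectation_P)
    also have "\<dots> = (\<Sum>\<zeta>\<in>S. pmf (P s \<xi>) \<zeta> * (\<Sum>\<eta>\<in>S. pmf (P h \<zeta>) \<eta> * g \<eta>))"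
      unfolding sum_distrib_right by (subst sum.swap) (simp add: sum_distrib_left mult_ac)
    also have "\<dots> = measure_pmf.expectation (P s \<xi>) (\<lambda>\<zeta>. measure_pmf.expectation (P h \<zeta>) g)"
      using assms \<xi> by (simp add: expectation_P)
    finally show ?thesis .
  qed
  then show ?thesis using assms by (simp add: sum_evolve)
qed

text \<open>Both one-sided difference quotients at \<open>t\<close> are averages, under the law at the smaller time, of
  difference quotients of the semigroup at \<open>0\<close>.\<close>

lemma evolve_has_derivative:
  assumes v0: "\<And>\<xi>. \<xi> \<in> S \<Longrightarrow> v \<xi> \<ge> 0" and v1: "(\<Sum>\<xi>\<in>S. v \<xi>) = 1" and t: "t \<ge> 0"
  shows "((\<lambda>t. \<Sum>\<eta>\<in>S. evolve S P v t \<eta> * g \<eta>) has_real_derivative (\<Sum>\<eta>\<in>S. evolve S P v t \<eta> * L g \<eta>)) (at t within {0..})"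
proof -
  let ?V = "\<lambda>t g. \<Sum>\<eta>\<in>S. evolve S P v t \<eta> * g \<eta>"
  let ?E = "\<lambda>h g \<eta>. measure_pmf.expectation (P h \<eta>) g"
  define d where "d = (\<lambda>h. \<Sum>\<eta>\<in>S. \<bar>(?E h g \<eta> - g \<eta>) / h - L g \<eta>\<bar>)"
  define d' where "d' = (\<lambda>h. \<Sum>\<eta>\<in>S. \<bar>?E h (L g) \<eta> - L g \<eta>\<bar>)"
  have Vbound: "\<bar>?V s f - ?V s f'\<bar> \<le> (\<Sum>\<eta>\<in>S. \<bar>f \<eta> - f' \<eta>\<bar>)" if "s \<ge> 0" for s f f'
  proof -
    have le1: "evolve S P v s \<eta> \<le> 1" if "\<eta> \<in> S" for \<eta>
    proof -
      have "evolve S P v s \<eta> \<le> (\<Sum>\<eta>\<in>S. evolve S P v s \<eta>)"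
        using fin that by (intro member_le_sum evolve_nonneg v0) auto
      then show ?thesis using evolve_mass[OF \<open>s \<ge> 0\<close>] v1 by simp
    qed
    have "\<bar>?V s f - ?V s f'\<bar> = \<bar>\<Sum>\<eta>\<in>S. evolve S P v s \<eta> * (f \<eta> - f' \<eta>)\<bar>"
      by (simp add: sum_subtractf algebra_simps)
    also have "\<dots> \<le> (\<Sum>\<eta>\<in>S. \<bar>f \<eta> - f' \<eta>\<bar>)"
    proof (rule order_trans[OF sum_abs], rule sum_mono)
      fix \<eta> assume "\<eta> \<in> S"
      then show "\<bar>evolve S P v s \<eta> * (f \<eta> - f' \<eta>)\<bar> \<le> \<bar>f \<eta> - f' \<eta>\<bar>"
        using le1 evolve_nonneg[OF v0] by (simp add: abs_mult mult_left_le_one_le)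
    qed
    finally show ?thesis .
  qed
  have lim_gen: "((\<lambda>h. (?E h f \<eta> - f \<eta>) / h) \<longlongrightarrow> L f \<eta>) (at_right 0)" if "\<eta> \<in> S" for f :: "'s \<Rightarrow> real" and \<eta>
    using gen that by (simp add: has_generator_def)
  have d0: "(d \<longlongrightarrow> 0) (at_right 0)"
    unfolding d_def
    by (intro tendsto_null_sum tendsto_rabs_zero) (auto intro!: LIM_zero lim_gen)
  have "((\<lambda>h. ?E h f \<eta> - f \<eta>) \<longlongrightarrow> 0) (at_right 0)" if "\<eta> \<in> S" for f :: "'s \<Rightarrow> real" and \<eta>
  proof -
    have "((\<lambda>h. (?E h f \<eta> - f \<eta>) / h * h) \<longlongrightarrow> L f \<eta> * 0) (at_right 0)"
      by (intro tendsto_mult lim_gen that) (simp add: tendsto_ident_at)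
    moreover have "\<forall>\<^sub>F h in at_right 0. (?E h f \<eta> - f \<eta>) / h * h = ?E h f \<eta> - f \<eta>"
      by (auto simp: eventually_at_filter)
    ultimately show ?thesis using Lim_transform_eventually by fastforce
  qed
  note E0 = this
  have d'0: "(d' \<longlongrightarrow> 0) (at_right 0)"
    unfolding d'_def by (intro tendsto_null_sum tendsto_rabs_zero E0)
  \<comment> \<open>The term \<open>d'\<close> serves the case \<open>r = b\<close>, the left-hand
    quotient, where \<open>L g\<close> is averaged under the law at the later time.\<close>
  have quot: "\<bar>(?V b g - ?V a g) / (b - a) - ?V r (L g)\<bar> \<le> d (b - a) + d' (b - a)"
    if ab: "0 \<le> a" "a < b" and r: "r = a \<or> r = b" for a b r
  proof -
    have h: "b - a > 0" and b: "b = a + (b - a)" using ab by auto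
    have "?V b g = ?V a (?E (b - a) g)" using evolve_add[of a "b - a" v g] ab by simp
    then have "(?V b g - ?V a g) / (b - a) = ?V a (\<lambda>\<eta>. (?E (b - a) g \<eta> - g \<eta>) / (b - a))"
      by (simp add: sum_subtractf[symmetric] sum_divide_distrib algebra_simps diff_divide_distrib)
    then have 1: "\<bar>(?V b g - ?V a g) / (b - a) - ?V a (L g)\<bar> \<le> d (b - a)"
      unfolding d_def using Vbound[OF ab(1), of "\<lambda>\<eta>. (?E (b - a) g \<eta> - g \<eta>) / (b - a)" "L g"] by (simp only:)
    have "?V b (L g) = ?V a (?E (b - a) (L g))" using evolve_add[of a "b - a" v "L g"] ab by simp
    then have 2: "\<bar>?V b (L g) - ?V a (L g)\<bar> \<le> d' (b - a)"
      unfolding d'_def using Vbound[OF ab(1), of "?E (b - a) (L g)" "L g"] by simp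
    have 3: "d' (b - a) \<ge> 0" unfolding d'_def by (intro sum_nonneg) auto
    from r show ?thesis
    proof
      assume "r = a" then show ?thesis using 1 3 by simp
    next
      assume rb: "r = b"
      show ?thesis unfolding rb using 1 2 by linarith
    qed
  qed
  have "((\<lambda>s. (?V s g - ?V t g) / (s - t)) \<longlongrightarrow> ?V t (L g)) (at t within {0..})"
  proof (rule LIM_zero_cancel, rule Lim_null_comparison)
    show "\<forall>\<^sub>F s in at t within {0..}. norm ((?V s g - ?V t g) / (s - t) - ?V t (L g)) \<le> d \<bar>s - t\<bar> + d' \<bar>s - t\<bar>"
      unfolding eventually_at_filter
    proof (intro always_eventually allI impI)
      fix s :: real assume s: "s \<noteq> t" "s \<in> {0..}"
      show "norm ((?V s g - ?V t g) / (s - t) - ?V t (L g)) \<le> d \<bar>s - t\<bar> + d' \<bar>s - t\<bar>"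
      proof (cases "s < t")
        case True
        have "(?V s g - ?V t g) / (s - t) = (?V t g - ?V s g) / (t - s)"
          using True by (simp add: field_simps)
        then show ?thesis using quot[of s t t] s True by simp
      next
        case False
        then show ?thesis using quot[of t s t] s t by simp
      qed
    qed
    have "((\<lambda>s. \<bar>s - t\<bar>) \<longlongrightarrow> 0) (at t within {0..})"
      by (auto intro!: tendsto_eq_intros)
    moreover have "\<forall>\<^sub>F s in at t within {0..}. \<bar>s - t\<bar> \<in> {0<..} \<and> \<bar>s - t\<bar> \<noteq> 0"
      by (auto simp: eventually_at_filter)
    ultimately have "filterlim (\<lambda>s. \<bar>s - t\<bar>) (at_right 0) (at t within {0..})"
      by (auto simp: filterlim_at)
    then show "((\<lambda>s. d \<bar>s - t\<bar> + d' \<bar>s - t\<bar>) \<longlongrightarrow> 0) (at t within {0..})"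
      using tendsto_add[OF filterlim_compose[OF d0] filterlim_compose[OF d'0]] by fastforce
  qed
  then show ?thesis by (simp add: has_field_derivative_iff)
qed

text \<open>Off-diagonal entries of a generator are nonnegative, being limits of probabilities
  divided by time. The mass \<open>w\<close> at \<eta> therefore satisfies
  \<open>w' \<ge> c * w\<close>, and \<open>exp (- c * s) * w s\<close> cannot decrease from its
  positive initial value.\<close>

lemma evolve_pos:
  assumes v0: "\<And>\<xi>. \<xi> \<in> S \<Longrightarrow> v \<xi> > 0" and v1: "(\<Sum>\<xi>\<in>S. v \<xi>) = 1" and t: "t \<ge> 0" and \<eta>: "\<eta> \<in> S"
  shows "evolve S P v t \<eta> > 0"
proof -
  define g where "g = (\<lambda>\<zeta>. if \<zeta> = \<eta> then 1 else 0 :: real)"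
  define c where "c = L g \<eta>"
  have v0': "\<And>\<xi>. \<xi> \<in> S \<Longrightarrow> v \<xi> \<ge> 0" using v0 by (auto intro: less_imp_le)
  let ?w = "\<lambda>t. evolve S P v t \<eta>"
  have w: "(\<Sum>\<zeta>\<in>S. evolve S P v s \<zeta> * g \<zeta>) = ?w s" for s
    using \<eta> fin by (simp add: g_def if_distrib cong: if_cong)
  have offdiag: "L g \<xi> \<ge> 0" if "\<xi> \<in> S" "\<xi> \<noteq> \<eta>" for \<xi>
  proof (rule tendsto_lowerbound)
    show "((\<lambda>h. (measure_pmf.expectation (P h \<xi>) g - g \<xi>) / h) \<longlongrightarrow> L g \<xi>) (at_right 0)"
      using gen that by (simp add: has_generator_def)
    show "\<forall>\<^sub>F h in at_right 0. 0 \<le> (measure_pmf.expectation (P h \<xi>) g - g \<xi>) / h"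
      unfolding eventually_at_filter using that
      by (auto simp: g_def intro!: always_eventually divide_nonneg_nonneg Bochner_Integration.integral_nonneg)
  qed simp
  have der: "(?w has_real_derivative (\<Sum>\<zeta>\<in>S. evolve S P v s \<zeta> * L g \<zeta>)) (at s within {0..})" if "s \<ge> 0" for s
    using evolve_has_derivative[OF v0' v1 that, of g] by (simp add: w)
  have lower: "(\<Sum>\<zeta>\<in>S. evolve S P v s \<zeta> * L g \<zeta>) \<ge> c * ?w s" if "s \<ge> 0" for s
  proof -
    have "(\<Sum>\<zeta>\<in>S. evolve S P v s \<zeta> * L g \<zeta>) = ?w s * c + (\<Sum>\<zeta>\<in>S - {\<eta>}. evolve S P v s \<zeta> * L g \<zeta>)"
      using fin \<eta> by (simp add: sum.remove c_def)
    moreover have "(\<Sum>\<zeta>\<in>S - {\<eta>}. evolve S P v s \<zeta> * L g \<zeta>) \<ge> 0"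
      using offdiag by (intro sum_nonneg mult_nonneg_nonneg evolve_nonneg v0') auto
    ultimately show ?thesis by (simp add: mult.commute)
  qed
  define y where "y = (\<lambda>s. exp (- c * s) * ?w s)"
  have yder: "(y has_real_derivative (exp (- c * s) * ((\<Sum>\<zeta>\<in>S. evolve S P v s \<zeta> * L g \<zeta>) - c * ?w s))) (at s within {0..})" if "s \<ge> 0" for s
    unfolding y_def by (auto intro!: derivative_eq_intros der that simp: algebra_simps)
  have "y 0 \<le> y t"
  proof (rule DERIV_nonneg_imp_increasing_open[OF t])
      fix s :: real assume s: "0 < s" "s < t"
      have "at s within {0..} = at s" using s by (intro at_within_interior) auto
      then show "\<exists>y'. (y has_real_derivative y') (at s) \<and> 0 \<le> y'"
        using yder[of s] lower[of s] s by (metis diff_ge_0_iff_ge exp_ge_zero less_imp_le mult_nonneg_nonneg)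
    next
      have "continuous_on {0..} y"
        using yder by (intro DERIV_continuous_on) auto
      then show "continuous_on {0..t} y" by (rule continuous_on_subset) auto
  qed
  moreover have "y 0 > 0" using v0[OF \<eta>] evolve_0[OF \<eta>] by (simp add: y_def)
  ultimately have "y t > 0" by simp
  then show ?thesis by (simp add: y_def zero_less_mult_iff)
qed

end

text \<open>The Markov property from time 0, integrated: the conditional expectation has the same
  mean as \<open>f (X t)\<close>, and its explicit form is summed over the finitely many values of
  \<open>X 0\<close>.\<close>

lemma markov_process_law:
  fixes S :: "'s set" and X :: "real \<Rightarrow> 'a \<Rightarrow> 's"
  assumes fin: "finite S" and mp: "markov_process S L M X"
  obtains P where "markov_semigroup S P" "has_generator S P L"
    "\<And>t \<eta>. t \<ge> 0 \<Longrightarrow> \<eta> \<in> S \<Longrightarrow> measure (distr M (count_space S) (X t)) {\<eta>} =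
       evolve S P (\<lambda>\<xi>. measure (distr M (count_space S) (X 0)) {\<xi>}) t \<eta>"
proof -
  from mp obtain P where P: "markov_semigroup S P" "has_generator S P L"
    and mk: "\<And>f s t. 0 \<le> s \<Longrightarrow> s \<le> t \<Longrightarrow> (AE \<omega> in M.
              real_cond_exp M (natural_filtration S M X s) (\<lambda>\<omega>. f (X t \<omega>)) \<omega> =
              measure_pmf.expectation (P (t - s) (X s \<omega>)) f)"
    and ps: "prob_space M" and meas: "\<And>t. t \<ge> 0 \<Longrightarrow> X t \<in> measurable M (count_space S)"
    unfolding markov_process_def by blast
  interpret prob_space M by (rule ps)
  let ?F = "natural_filtration S M X 0"
  have sub: "subalgebra M ?F"
    unfolding subalgebra_def natural_filtration_def
  proof (intro conjI)
    have sets: "{X r -` A \<inter> space M | r A. 0 \<le> r \<and> r \<le> 0 \<and> A \<subseteq> S} \<subseteq> sets M"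
      using meas by (auto intro!: measurable_sets)
    then have "sigma_sets (space M) {X r -` A \<inter> space M | r A. 0 \<le> r \<and> r \<le> 0 \<and> A \<subseteq> S} \<subseteq> sets M"
      by (rule sets.sigma_sets_subset)
    moreover have "{X r -` A \<inter> space M | r A. 0 \<le> r \<and> r \<le> 0 \<and> A \<subseteq> S} \<subseteq> Pow (space M)" by auto
    ultimately show "sets (sigma (space M) {X r -` A \<inter> space M | r A. 0 \<le> r \<and> r \<le> 0 \<and> A \<subseteq> S}) \<subseteq> sets M"
      by simp
  qed (auto simp: space_measure_of_conv)
  interpret sigma_finite_subalgebra M ?F
    using sub finite_measure_axioms
    by (intro finite_measure_subalgebra_is_sigma_finite) (simp add: finite_measure_subalgebra_def finite_measure_subalgebra_axioms_def)
  have "measure (distr M (count_space S) (X t)) {\<eta>} =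
       evolve S P (\<lambda>\<xi>. measure (distr M (count_space S) (X 0)) {\<xi>}) t \<eta>" if t: "t \<ge> 0" and \<eta>: "\<eta> \<in> S" for t \<eta>
  proof -
    define f where "f = (indicator {\<eta>} :: 's \<Rightarrow> real)"
    have fX: "(\<lambda>\<omega>. f (X t \<omega>)) \<in> borel_measurable M"
      by (rule measurable_compose[OF meas[OF t]]) simp
    have int: "integrable M (\<lambda>\<omega>. f (X t \<omega>))"
    proof (rule integrable_const_bound[of _ 1])
      show "AE \<omega> in M. norm (f (X t \<omega>)) \<le> 1" by (simp add: f_def indicator_def)
    qed (rule fX)
    have "measure (distr M (count_space S) (X t)) {\<eta>} = (\<integral>\<omega>. f (X t \<omega>) \<partial>M)"
    proof -
      have "(\<integral>\<omega>. f (X t \<omega>) \<partial>M) = (\<integral>\<omega>. indicator (X t -` {\<eta>} \<inter> space M) \<omega> \<partial>M)"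
        by (intro Bochner_Integration.integral_cong) (auto simp: f_def indicator_def)
      also have "\<dots> = measure M (X t -` {\<eta>} \<inter> space M)" using meas[OF t] \<eta> by (simp)
      finally show ?thesis using meas[OF t] \<eta> by (simp add: measure_distr)
    qed
    also have "\<dots> = (\<integral>\<omega>. real_cond_exp M ?F (\<lambda>\<omega>. f (X t \<omega>)) \<omega> \<partial>M)"
      by (rule real_cond_exp_int(2)[OF int, symmetric])
    also have "\<dots> = (\<integral>\<omega>. measure_pmf.expectation (P t (X 0 \<omega>)) f \<partial>M)"
    proof (rule integral_cong_AE)
      show "(\<lambda>\<omega>. measure_pmf.expectation (P t (X 0 \<omega>)) f) \<in> borel_measurable M"
        by (rule measurable_compose[OF meas[of 0]]) simp_all
    qed (use mk[of 0 t f] t in simp_all)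
    also have "\<dots> = (\<integral>\<omega>. (\<Sum>\<xi>\<in>S. indicator (X 0 -` {\<xi>} \<inter> space M) \<omega> * pmf (P t \<xi>) \<eta>) \<partial>M)"
    proof (intro Bochner_Integration.integral_cong refl)
      fix \<omega> assume \<omega>: "\<omega> \<in> space M"
      then have X0: "X 0 \<omega> \<in> S" using measurable_space[OF meas[of 0]] by auto
      have "measure_pmf.expectation (P t (X 0 \<omega>)) f = pmf (P t (X 0 \<omega>)) \<eta>"
        by (simp add: f_def pmf.rep_eq)
      also have "\<dots> = (\<Sum>\<xi>\<in>S. if X 0 \<omega> = \<xi> then pmf (P t \<xi>) \<eta> else 0)" using X0 fin by simp
      also have "\<dots> = (\<Sum>\<xi>\<in>S. indicator (X 0 -` {\<xi>} \<inter> space M) \<omega> * pmf (P t \<xi>) \<eta>)"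
        using \<omega> by (intro sum.cong) (auto simp: indicator_def)
      finally show "measure_pmf.expectation (P t (X 0 \<omega>)) f = (\<Sum>\<xi>\<in>S. indicator (X 0 -` {\<xi>} \<inter> space M) \<omega> * pmf (P t \<xi>) \<eta>)" .
    qed
    also have "\<dots> = (\<Sum>\<xi>\<in>S. measure M (X 0 -` {\<xi>} \<inter> space M) * pmf (P t \<xi>) \<eta>)"
      using meas[of 0] by (subst Bochner_Integration.integral_sum) (auto simp: less_top[symmetric])
    also have "\<dots> = evolve S P (\<lambda>\<xi>. measure (distr M (count_space S) (X 0)) {\<xi>}) t \<eta>"
      unfolding evolve_def using meas[of 0] by (intro sum.cong refl) (simp add: measure_distr)
    finally show ?thesis .
  qed
  with P show ?thesis using that by blast
qed

section \<open>Smooth profiles\<close>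

lemma torus_periodic_int_axis:
  assumes "torus_periodic f"
  shows "f (u + of_int k *\<^sub>R axis i 1) = f u"
proof (induction k arbitrary: u rule: int_induct[where k = 0])
  case base
  then show ?case by simp
next
  case (step1 k)
  have "f (u + of_int (k + 1) *\<^sub>R axis i 1) = f ((u + of_int k *\<^sub>R axis i 1) + axis i 1)"
    by (simp add: scaleR_add_left add.assoc)
  then show ?case using assms step1 by (simp add: torus_periodic_def)
next
  case (step2 k)
  have "f (u + of_int k *\<^sub>R axis i 1) = f ((u + of_int (k - 1) *\<^sub>R axis i 1) + axis i 1)"
    by (simp add: scaleR_diff_left add.assoc)
  then show ?case using assms step2 by (simp add: torus_periodic_def)
qed

lemma torus_periodic_int:
  assumes f: "torus_periodic f" and k: "\<And>i. k $ i \<in> \<int>"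
  shows "f (u + k) = f u"
proof -
  have "f (u + (\<Sum>i\<in>I. (k $ i) *\<^sub>R axis i 1)) = f u" if "finite I" for I
    using that
  proof (induction I)
    case (insert i I)
    obtain z where z: "k $ i = of_int z" using k[of i] by (auto elim: Ints_cases)
    have "f (u + (\<Sum>i\<in>insert i I. (k $ i) *\<^sub>R axis i 1)) = f ((u + (\<Sum>i\<in>I. (k $ i) *\<^sub>R axis i 1)) + of_int z *\<^sub>R axis i 1)"
      using insert.hyps by (simp add: z add_ac)
    then show ?case using torus_periodic_int_axis[OF f] insert.IH by simp
  qed simp
  from this[of UNIV] show ?thesis using basis_expansion[of k] by (simp add: scalar_mult_eq_scaleR)
qed

text \<open>One representative \<open>u0\<close> serves all periodic functions and all displacements
  at once, as is needed to compare values at neighbouring points.\<close>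

lemma torus_periodic_unit_cube:
  fixes u :: "real ^ 'd::finite"
  obtains u0 where "\<And>i. 0 \<le> u0 $ i \<and> u0 $ i < 1"
    "\<And>(f :: real ^ 'd \<Rightarrow> 'b) v. torus_periodic f \<Longrightarrow> f (u + v) = f (u0 + v)"
proof
  let ?u0 = "\<chi> i. frac (u $ i)"
  show "0 \<le> ?u0 $ i \<and> ?u0 $ i < 1" for i by (simp add: frac_lt_1)
  fix f :: "real ^ 'd \<Rightarrow> 'b" and v assume f: "torus_periodic f"
  have eq: "u + v = (?u0 + v) + (\<chi> i. of_int \<lfloor>u $ i\<rfloor>)" by (simp add: vec_eq_iff frac_def)
  show "f (u + v) = f (?u0 + v)" unfolding eq by (rule torus_periodic_int[OF f]) simp
qed

text \<open>What the lattice estimates take from the Burgers solution: size, Lipschitz and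
  second-order Taylor bounds along the axes, with \<open>g\<close> as spatial gradient, and the
  chain rule in a moving frame, where the Burgers equation has already replaced the time derivative
  by \<open>2 * \<rho> * (m \<bullet> g)\<close>. The frame has velocity \<open>w\<close>, and
  \<open>a\<close> is the ratio of Burgers time to process time.\<close>

definition profile_bounds ::
  "real ^ 'd::finite \<Rightarrow> real \<Rightarrow> (real \<Rightarrow> real ^ 'd \<Rightarrow> real) \<Rightarrow> (real \<Rightarrow> real ^ 'd \<Rightarrow> real ^ 'd) \<Rightarrow> real \<Rightarrow> bool" where
  "profile_bounds m S \<rho> g C \<longleftrightarrow> C > 0 \<and>
    (\<forall>s\<in>{0..S}. \<forall>u. \<bar>\<rho> s u\<bar> \<le> C \<and>
       (\<forall>j h. \<bar>h\<bar> \<le> 1 \<longrightarrow> \<bar>\<rho> s (u + h *\<^sub>R axis j 1) - \<rho> s u\<bar> \<le> C * \<bar>h\<bar> \<and>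
          \<bar>\<rho> s (u + h *\<^sub>R axis j 1) - \<rho> s u - h * g s u $ j\<bar> \<le> C * h\<^sup>2)) \<and>
    (\<forall>a w u T t. 0 \<le> a \<longrightarrow> a * T \<le> S \<longrightarrow> t \<in> {0..T} \<longrightarrow>
       ((\<lambda>t. \<rho> (a * t) (u - t *\<^sub>R w)) has_real_derivative
          (2 * a * \<rho> (a * t) (u - t *\<^sub>R w) * (m \<bullet> g (a * t) (u - t *\<^sub>R w)) - w \<bullet> g (a * t) (u - t *\<^sub>R w)))
         (at t within {0..T}))"

lemma second_order_taylor:
  fixes \<phi> \<psi> \<psi>' :: "real \<Rightarrow> real"
  assumes d: "\<And>r. \<bar>r\<bar> \<le> \<bar>h\<bar> \<Longrightarrow> (\<phi> has_real_derivative \<psi> r) (at r)" "\<And>r. \<bar>r\<bar> \<le> \<bar>h\<bar> \<Longrightarrow> (\<psi> has_real_derivative \<psi>' r) (at r)"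
    and M: "\<And>r. \<bar>r\<bar> \<le> \<bar>h\<bar> \<Longrightarrow> \<bar>\<psi>' r\<bar> \<le> M" "\<And>r. \<bar>r\<bar> \<le> \<bar>h\<bar> \<Longrightarrow> \<bar>\<psi> r\<bar> \<le> M"
  shows "\<bar>\<phi> h - \<phi> 0\<bar> \<le> M * \<bar>h\<bar>" "\<bar>\<phi> h - \<phi> 0 - h * \<psi> 0\<bar> \<le> M * h\<^sup>2"
proof -
  let ?I = "{- \<bar>h\<bar>..\<bar>h\<bar>}"
  have I: "convex ?I" "0 \<in> ?I" "h \<in> ?I" by auto
  have "norm (\<phi> h - \<phi> 0) \<le> M * norm (h - 0)"
    by (rule field_differentiable_bound[OF I(1), where f' = \<psi>]) (use I in \<open>auto intro!: has_field_derivative_at_within d M\<close>)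
  then show "\<bar>\<phi> h - \<phi> 0\<bar> \<le> M * \<bar>h\<bar>" by simp
  have M0: "M \<ge> 0" using M(1)[of 0] abs_ge_zero[of "\<psi>' 0"] by linarith
  have \<psi>: "\<bar>\<psi> r - \<psi> 0\<bar> \<le> M * \<bar>h\<bar>" if "r \<in> ?I" for r
  proof -
    have "norm (\<psi> r - \<psi> 0) \<le> M * norm (r - 0)"
      by (rule field_differentiable_bound[OF I(1), where f' = \<psi>']) (use I that in \<open>auto intro!: has_field_derivative_at_within d M\<close>)
    also have "\<dots> \<le> M * \<bar>h\<bar>" using that M0 by (intro mult_left_mono) auto
    finally show ?thesis by simp
  qed
  have der: "((\<lambda>r. \<phi> r - r * \<psi> 0) has_real_derivative \<psi> r - \<psi> 0) (at r within ?I)" if "r \<in> ?I" for r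
  proof -
    have "(\<phi> has_real_derivative \<psi> r) (at r within ?I)"
      using that by (intro has_field_derivative_at_within[OF d(1)]) auto
    from DERIV_diff[OF this DERIV_cmult_right[OF DERIV_ident, of "\<psi> 0"]] show ?thesis by simp
  qed
  have "norm ((\<phi> h - h * \<psi> 0) - (\<phi> 0 - 0 * \<psi> 0)) \<le> (M * \<bar>h\<bar>) * norm (h - 0)"
    by (rule field_differentiable_bound[OF I(1), where f' = "\<lambda>r. \<psi> r - \<psi> 0" and f = "\<lambda>r. \<phi> r - r * \<psi> 0"])
      (use I in \<open>auto intro: der \<psi>\<close>)
  then show "\<bar>\<phi> h - \<phi> 0 - h * \<psi> 0\<bar> \<le> M * h\<^sup>2" by (simp add: power2_eq_square algebra_simps)
qed

text \<open>Two derivatives are extracted from smoothness and bounded on a compact set; periodicity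
  carries the bounds to the whole space. The Burgers equation is stated with its own derivatives,
  which are identified with the components of the gradient \<open>G\<close> by uniqueness.\<close>

lemma burgers_profile_bounds:
  fixes m :: "real ^ 'd::finite"
  assumes b: "smooth_burgers_solution m \<rho>ini S \<rho>" and S: "S > 0"
  obtains g C where "profile_bounds m S \<rho> g C"
proof -
  let ?D = "{0..S} \<times> (UNIV :: (real ^ 'd) set)"
  let ?f = "\<lambda>(s, u). \<rho> s u"
  have sm: "\<And>k. Ck_on k ?D ?f" and per: "\<And>s. s \<in> {0..S} \<Longrightarrow> torus_periodic (\<rho> s)"
    and burg: "\<And>s u. s \<in> {0..S} \<Longrightarrow> \<exists>D G. ((\<lambda>r. \<rho> r u) has_real_derivative D) (at s within {0..S}) \<and>
        GDERIV (\<lambda>v. (\<rho> s v)\<^sup>2) u :> G \<and> D - m \<bullet> G = 0"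
    using b unfolding smooth_burgers_solution_def smooth_on_def by blast+
  have "Ck_on (Suc (Suc 0)) ?D ?f" by (rule sm)
  then obtain G where G: "\<And>x. x \<in> ?D \<Longrightarrow> (?f has_derivative (\<lambda>h. h \<bullet> G x)) (at x within ?D)"
    and G1: "\<And>b. b \<in> Basis \<Longrightarrow> Ck_on (Suc 0) ?D (\<lambda>x. G x \<bullet> b)" unfolding Ck_on.simps(2)[of "Suc 0"] by blast
  have "\<forall>b\<in>Basis. \<exists>G'. (\<forall>x\<in>?D. ((\<lambda>x. G x \<bullet> b) has_derivative (\<lambda>h. h \<bullet> G' x)) (at x within ?D)) \<and> continuous_on ?D (\<lambda>x. G' x \<bullet> b)"
    using G1 unfolding Ck_on.simps by blast
  then obtain G' where G': "\<And>b x. b \<in> Basis \<Longrightarrow> x \<in> ?D \<Longrightarrow> ((\<lambda>x. G x \<bullet> b) has_derivative (\<lambda>h. h \<bullet> G' b x)) (at x within ?D)"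
    and G'c: "\<And>b. b \<in> Basis \<Longrightarrow> continuous_on ?D (\<lambda>x. G' b x \<bullet> b)" by metis
  have Gc: "continuous_on ?D (\<lambda>x. G x \<bullet> b)" if "b \<in> Basis" for b
    using G'[OF that] by (auto simp: continuous_on_eq_continuous_within intro: has_derivative_continuous)
  have fc: "continuous_on ?D ?f" using sm[of 0] by simp
  define g where "g = (\<lambda>s u. snd (G (s, u)))"
  define e where "e = (\<lambda>j. (0, axis j 1) :: real \<times> (real ^ 'd))"
  have eB: "e j \<in> Basis" for j by (simp add: e_def Basis_prod_def axis_inverse)
  have eG: "G (s, u) \<bullet> e j = g s u $ j" for s u j
    by (simp add: e_def g_def inner_prod_def inner_axis)
  have line: "((\<lambda>r. F (s, u + r *\<^sub>R axis j 1)) has_real_derivative (e j \<bullet> F' (s, u + r *\<^sub>R axis j 1))) (at r)"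
    if F: "\<And>x. x \<in> ?D \<Longrightarrow> (F has_derivative (\<lambda>h. h \<bullet> F' x)) (at x within ?D)" and s: "s \<in> {0..S}"
    for F :: "real \<times> (real ^ 'd) \<Rightarrow> real" and F' s u j r
  proof -
    have "((\<lambda>r. F (s, u + r *\<^sub>R axis j 1)) has_derivative (\<lambda>h. (0, h *\<^sub>R axis j 1) \<bullet> F' (s, u + r *\<^sub>R axis j 1))) (at r within UNIV)"
    proof (rule has_derivative_in_compose[where g = F and f = "\<lambda>r. (s, u + r *\<^sub>R axis j 1)"])
      show "((\<lambda>r. (s, u + r *\<^sub>R axis j 1)) has_derivative (\<lambda>h. (0, h *\<^sub>R axis j 1))) (at r)"
        by (auto intro!: derivative_eq_intros)
      show "(F has_derivative (\<lambda>h. h \<bullet> F' (s, u + r *\<^sub>R axis j 1))) (at (s, u + r *\<^sub>R axis j 1) within range (\<lambda>r. (s, u + r *\<^sub>R axis j 1)))"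
        using s by (intro has_derivative_subset[OF F]) auto
    qed
    moreover have "(\<lambda>h. (0, h *\<^sub>R axis j 1) \<bullet> F' (s, u + r *\<^sub>R axis j 1)) = (*) (e j \<bullet> F' (s, u + r *\<^sub>R axis j 1))"
      by (auto simp: e_def inner_prod_def)
    ultimately show ?thesis by (simp add: has_field_derivative_def)
  qed
  have d1: "((\<lambda>r. \<rho> s (u + r *\<^sub>R axis j 1)) has_real_derivative g s (u + r *\<^sub>R axis j 1) $ j) (at r)" if "s \<in> {0..S}" for s u j r
    using line[OF G that, of u j r] eG[of s "u + r *\<^sub>R axis j 1" j] by (simp add: inner_commute)
  have d2: "((\<lambda>r. g s (u + r *\<^sub>R axis j 1) $ j) has_real_derivative G' (e j) (s, u + r *\<^sub>R axis j 1) \<bullet> e j) (at r)" if "s \<in> {0..S}" for s u j r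
    using line[OF G'[OF eB[of j]] that, of u j r] unfolding eG by (simp add: inner_commute)
  \<comment> \<open>Large enough for the unit cube and every displacement of length at most 1 along
    an axis.\<close>
  define B where "B = {0..S} \<times> cbox ((\<chi> i. - 1) :: real ^ 'd) (\<chi> i. 2)"
  have Bc: "compact B" "B \<subseteq> ?D" unfolding B_def by (auto intro!: compact_Times)
  have bdd: "\<exists>c. \<forall>x\<in>B. \<bar>F x\<bar> \<le> c" if "continuous_on ?D F" for F :: "real \<times> (real ^ 'd) \<Rightarrow> real"
  proof -
    have "bounded (F ` B)" by (intro compact_imp_bounded compact_continuous_image continuous_on_subset[OF that] Bc)
    then show ?thesis unfolding bounded_iff by auto
  qed
  obtain c0 where c0: "\<And>x. x \<in> B \<Longrightarrow> \<bar>?f x\<bar> \<le> c0" using bdd[OF fc] by blast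
  have "\<forall>j. \<exists>c. \<forall>x\<in>B. \<bar>G x \<bullet> e j\<bar> \<le> c" using bdd[OF Gc[OF eB]] by blast
  then obtain c1 where c1: "\<And>j x. x \<in> B \<Longrightarrow> \<bar>G x \<bullet> e j\<bar> \<le> c1 j" by metis
  have "\<forall>j. \<exists>c. \<forall>x\<in>B. \<bar>G' (e j) x \<bullet> e j\<bar> \<le> c" using bdd[OF G'c[OF eB]] by blast
  then obtain c2 where c2: "\<And>j x. x \<in> B \<Longrightarrow> \<bar>G' (e j) x \<bullet> e j\<bar> \<le> c2 j" by metis
  define C where "C = 1 + \<bar>c0\<bar> + (\<Sum>j\<in>UNIV. \<bar>c1 j\<bar> + \<bar>c2 j\<bar>)"
  have Cj: "\<bar>c1 j\<bar> + \<bar>c2 j\<bar> \<le> (\<Sum>j\<in>UNIV. \<bar>c1 j\<bar> + \<bar>c2 j\<bar>)" for j by (rule member_le_sum) auto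
  have C: "C > 0" "c0 \<le> C" "c1 j \<le> C" "c2 j \<le> C" for j
    using Cj[of j] sum_nonneg[of UNIV "\<lambda>j. \<bar>c1 j\<bar> + \<bar>c2 j\<bar>"] by (auto simp: C_def)
  have bounds: "\<bar>\<rho> s u\<bar> \<le> C \<and>
       (\<forall>j h. \<bar>h\<bar> \<le> 1 \<longrightarrow> \<bar>\<rho> s (u + h *\<^sub>R axis j 1) - \<rho> s u\<bar> \<le> C * \<bar>h\<bar> \<and>
          \<bar>\<rho> s (u + h *\<^sub>R axis j 1) - \<rho> s u - h * g s u $ j\<bar> \<le> C * h\<^sup>2)" if s: "s \<in> {0..S}" for s u
  proof -
    obtain u0 where u0: "\<And>i. 0 \<le> u0 $ i \<and> u0 $ i < 1"
      and eq: "\<And>(f :: real ^ 'd \<Rightarrow> real) v. torus_periodic f \<Longrightarrow> f (u + v) = f (u0 + v)"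
      using torus_periodic_unit_cube[of u] by metis
    have eq\<rho>: "\<rho> s (u + v) = \<rho> s (u0 + v)" for v by (rule eq[OF per[OF s]])
    \<comment> \<open>Periodicity is given for \<rho>; that of its gradient follows since
      derivatives along the axes are unique.\<close>
    have geq: "g s u $ j = g s u0 $ j" for j
    proof -
      have "(\<lambda>r. \<rho> s (u + r *\<^sub>R axis j 1)) = (\<lambda>r. \<rho> s (u0 + r *\<^sub>R axis j 1))" using eq\<rho> by auto
      then show ?thesis using d1[OF s, of u j 0] d1[OF s, of u0 j 0] DERIV_unique by fastforce
    qed
    have inB: "(s, u0 + h *\<^sub>R axis j 1) \<in> B" if "\<bar>h\<bar> \<le> 1" for h j
    proof -
      have "- 1 \<le> u0 $ i + h * (axis j 1 :: real ^ 'd) $ i \<and> u0 $ i + h * (axis j 1 :: real ^ 'd) $ i \<le> 2" for i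
        using u0[of i] that by (auto simp: axis_def)
      then show ?thesis using s by (auto simp: B_def mem_box_cart)
    qed
    have "\<bar>\<rho> s u\<bar> \<le> C"
      using c0[OF inB[of 0]] C(2) eq\<rho>[of 0] by auto
    moreover have "\<bar>\<rho> s (u + h *\<^sub>R axis j 1) - \<rho> s u\<bar> \<le> C * \<bar>h\<bar>" "\<bar>\<rho> s (u + h *\<^sub>R axis j 1) - \<rho> s u - h * g s u $ j\<bar> \<le> C * h\<^sup>2"
      if h: "\<bar>h\<bar> \<le> 1" for h j
    proof -
      let ?\<phi> = "\<lambda>r. \<rho> s (u0 + r *\<^sub>R axis j 1)" and ?\<psi> = "\<lambda>r. g s (u0 + r *\<^sub>R axis j 1) $ j"
      let ?\<psi>' = "\<lambda>r. G' (e j) (s, u0 + r *\<^sub>R axis j 1) \<bullet> e j"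
      have b1: "\<bar>?\<psi> r\<bar> \<le> C" "\<bar>?\<psi>' r\<bar> \<le> C" if "\<bar>r\<bar> \<le> \<bar>h\<bar>" for r
        using c1[OF inB[of r j], of j] c2[OF inB[of r j], of j] that h C(3,4)[of j] unfolding eG by auto
      have "\<bar>?\<phi> h - ?\<phi> 0\<bar> \<le> C * \<bar>h\<bar>" "\<bar>?\<phi> h - ?\<phi> 0 - h * ?\<psi> 0\<bar> \<le> C * h\<^sup>2"
        using second_order_taylor[of h ?\<phi> ?\<psi> ?\<psi>' C, OF d1[OF s] d2[OF s] b1(2,1)] by blast+
      then show "\<bar>\<rho> s (u + h *\<^sub>R axis j 1) - \<rho> s u\<bar> \<le> C * \<bar>h\<bar>" "\<bar>\<rho> s (u + h *\<^sub>R axis j 1) - \<rho> s u - h * g s u $ j\<bar> \<le> C * h\<^sup>2"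
        using eq\<rho>[of 0] eq\<rho>[of "h *\<^sub>R axis j 1"] geq by simp_all
    qed
    ultimately show ?thesis by blast
  qed
  have fstG: "fst (G (s, u)) = 2 * \<rho> s u * (m \<bullet> g s u)" if s: "s \<in> {0..S}" for s u
  proof -
    obtain D Gq where Dq: "((\<lambda>r. \<rho> r u) has_real_derivative D) (at s within {0..S})"
        "GDERIV (\<lambda>v. (\<rho> s v)\<^sup>2) u :> Gq" "D - m \<bullet> Gq = 0" using burg[OF s] by blast
    have "((\<lambda>r. ?f (r, u)) has_derivative (\<lambda>h. (h, 0) \<bullet> G (s, u))) (at s within {0..S})"
    proof (rule has_derivative_in_compose[where g = ?f and f = "\<lambda>r. (r, u)"])
      show "((\<lambda>r. (r, u)) has_derivative (\<lambda>h. (h, 0))) (at s within {0..S})" by (auto intro!: derivative_eq_intros)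
      show "(?f has_derivative (\<lambda>h. h \<bullet> G (s, u))) (at (s, u) within (\<lambda>r. (r, u)) ` {0..S})"
        using s by (intro has_derivative_subset[OF G]) auto
    qed
    moreover have "(\<lambda>h. (h, 0) \<bullet> G (s, u)) = (*) (fst (G (s, u)))" by (auto simp: inner_prod_def)
    ultimately have "((\<lambda>r. \<rho> r u) has_real_derivative fst (G (s, u))) (at s within {0..S})"
      by (simp add: has_field_derivative_def)
    \<comment> \<open>\<open>S > 0\<close> makes the time derivative within the interval unique,
      also at the end points.\<close>
    moreover have "at s within {0..S} \<noteq> bot" using s S by (simp add: trivial_limit_within islimpt_Icc)
    ultimately have D: "D = fst (G (s, u))" using Dq(1) has_field_derivative_unique by blast
    have "((\<lambda>v. ?f (s, v)) has_derivative (\<lambda>h. (0, h) \<bullet> G (s, u))) (at u within UNIV)"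
    proof (rule has_derivative_in_compose[where g = ?f and f = "\<lambda>v. (s, v)"])
      show "((\<lambda>v. (s, v)) has_derivative (\<lambda>h. (0, h))) (at u within UNIV)" by (auto intro!: derivative_eq_intros)
      show "(?f has_derivative (\<lambda>h. h \<bullet> G (s, u))) (at (s, u) within range (\<lambda>v. (s, v)))"
        using s by (intro has_derivative_subset[OF G]) auto
    qed
    moreover have "(\<lambda>h. (0, h) \<bullet> G (s, u)) = (\<lambda>h. h \<bullet> g s u)" by (auto simp: inner_prod_def g_def)
    ultimately have "(\<rho> s has_derivative (\<lambda>h. h \<bullet> g s u)) (at u)" by simp
    then have "((\<lambda>v. (\<rho> s v)\<^sup>2) has_derivative (\<lambda>h. 2 * \<rho> s u * (h \<bullet> g s u))) (at u)"
      by (auto intro!: derivative_eq_intros simp: power2_eq_square)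
    then have "(\<lambda>h. 2 * \<rho> s u * (h \<bullet> g s u)) = (\<lambda>h. h \<bullet> Gq)"
      using Dq(2) has_derivative_unique unfolding gderiv_def by (metis (no_types, lifting))
    then have "m \<bullet> Gq = 2 * \<rho> s u * (m \<bullet> g s u)" by metis
    then show ?thesis using D Dq(3) by simp
  qed
  have chain: "((\<lambda>t. \<rho> (a * t) (u - t *\<^sub>R w)) has_real_derivative
          (2 * a * \<rho> (a * t) (u - t *\<^sub>R w) * (m \<bullet> g (a * t) (u - t *\<^sub>R w)) - w \<bullet> g (a * t) (u - t *\<^sub>R w)))
         (at t within {0..T})" if a: "0 \<le> a" "a * T \<le> S" and t: "t \<in> {0..T}" for a w u T t
  proof -
    have inD: "a * t \<in> {0..S}" if "t \<in> {0..T}" for t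
    proof -
      have "a * t \<le> a * T" using that a by (intro mult_left_mono) auto
      then show ?thesis using that a by auto
    qed
    let ?x = "(a * t, u - t *\<^sub>R w)"
    have "((\<lambda>t. ?f (a * t, u - t *\<^sub>R w)) has_derivative (\<lambda>h. (a * h, - (h *\<^sub>R w)) \<bullet> G ?x)) (at t within {0..T})"
    proof (rule has_derivative_in_compose[where g = ?f and f = "\<lambda>t. (a * t, u - t *\<^sub>R w)"])
      show "((\<lambda>t. (a * t, u - t *\<^sub>R w)) has_derivative (\<lambda>h. (a * h, - (h *\<^sub>R w)))) (at t within {0..T})"
        by (auto intro!: derivative_eq_intros)
      show "(?f has_derivative (\<lambda>h. h \<bullet> G ?x)) (at ?x within (\<lambda>t. (a * t, u - t *\<^sub>R w)) ` {0..T})"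
        using inD[OF t] inD by (intro has_derivative_subset[OF G]) auto
    qed
    moreover have "(\<lambda>h. (a * h, - (h *\<^sub>R w)) \<bullet> G ?x) = (*) (a * fst (G ?x) - w \<bullet> g (a * t) (u - t *\<^sub>R w))"
      by (auto simp: inner_prod_def g_def algebra_simps)
    ultimately show ?thesis
      using fstG[OF inD[OF t], of "u - t *\<^sub>R w"] by (simp add: has_field_derivative_def mult_ac)
  qed
  have "profile_bounds m S \<rho> g C"
    unfolding profile_bounds_def using C(1) bounds chain by blast
  then show ?thesis using that by blast
qed

section \<open>Differential inequality for the relative entropy\<close>

context torus_model
begin

text \<open>The new term is linear, with coefficients of size \<beta> after the time derivative of
  the profile is subtracted. Its mean is estimated by \<open>X \<le> X^2 / q + q\<close>, where
  \<open>q\<close> is proportional to the variance bound: the entropy then enters with coefficient 1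
  and \<beta> appears only in the additive constant.\<close>

lemma entropy_derivative_bound:
  fixes \<phi> :: "'d \<Rightarrow> int ^ 'd \<Rightarrow> real" and G H C a \<beta> \<delta> :: real and dr :: "int ^ 'd \<Rightarrow> real"
  assumes u: "\<And>\<eta>. \<eta> \<in> \<Omega> \<Longrightarrow> u \<eta> > 0" and u1: "(\<Sum>\<eta>\<in>\<Omega>. u \<eta>) = 1"
    and flow: "\<And>g. g 0 - avg cube g = (\<Sum>j\<in>UNIV. \<Sum>v\<in>cube. \<phi> j v * (g v - g (v + e j)))"
    and G: "(\<Sum>j\<in>UNIV. \<Sum>v\<in>cube. (\<phi> j v)\<^sup>2) \<le> G"
    and a: "a \<ge> 0" and \<beta>: "\<beta> > 0" "\<And>x. x \<in> V \<Longrightarrow> \<bar>a * flux x - dr x\<bar> \<le> \<beta>"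
    and \<delta>: "\<delta> > 0" "\<And>x. x \<in> V \<Longrightarrow> \<delta> \<le> r x \<and> r x \<le> K - \<delta>"
  defines "H \<equiv> ent \<Omega> u \<nu>"
    and "C \<equiv> (3 / (2 * p0) + (K + 1)) * 4 * (real CARD('d))\<^sup>2 * K\<^sup>2 * P\<^sup>2 + (K + 1) * CARD('d) + CARD('d) * K\<^sup>2 * (P\<^sup>2 + 1)"
  shows "a * (\<Sum>\<eta>\<in>\<Omega>. u \<eta> * generator p K N (\<lambda>\<eta>. ln (u \<eta> / \<nu> \<eta>)) \<eta>)
       - (\<Sum>\<eta>\<in>\<Omega>. u \<eta> * (\<Sum>x\<in>V. dr x * (K * om \<eta> x / (r x * (K - r x)))))
    \<le> (1 + a * C * (\<epsilon>\<^sup>2 * (G + 1) * card cube + \<epsilon>)) * H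
      + (1 + (K\<^sup>2 * \<beta> / \<delta>\<^sup>2)\<^sup>2 * card V + a * C * (\<epsilon>\<^sup>2 * (G + 1) * card V + \<epsilon> * (card V / card cube)))"
proof -
  have u0: "\<And>\<eta>. \<eta> \<in> \<Omega> \<Longrightarrow> u \<eta> \<ge> 0" using u by (simp add: less_imp_le)
  have Kp: "real K > 0" using K by simp
  define b where "b = (\<lambda>x. (a * flux x - dr x) * (K / (r x * (K - r x))))"
  define s where "s = (\<beta> * (K / \<delta>\<^sup>2))\<^sup>2 * card V"
  define q where "q = K\<^sup>2 * s"
  have "V \<noteq> {}" using N tshift_in_sites[of N 0 0] by auto
  then have cV: "card V > 0" by (simp add: card_gt_0_iff)
  have s: "s > 0" unfolding s_def using \<beta> \<delta> Kp cV by simp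
  have q: "q > 0" unfolding q_def using s Kp by simp
  have b_le: "(b x)\<^sup>2 \<le> (\<beta> * (K / \<delta>\<^sup>2))\<^sup>2" if x: "x \<in> V" for x
  proof -
    have rx: "r x > 0" "K - r x > 0" "\<delta> \<le> r x" "\<delta> \<le> K - r x" using r[OF x] \<delta>(2)[OF x] by auto
    have "\<delta>\<^sup>2 \<le> r x * (K - r x)" unfolding power2_eq_square using rx \<delta>(1) by (intro mult_mono) auto
    then have "K / (r x * (K - r x)) \<le> K / \<delta>\<^sup>2" using rx \<delta> Kp by (intro divide_left_mono) auto
    moreover have "0 \<le> K / (r x * (K - r x))" using rx Kp by simp
    ultimately have "\<bar>b x\<bar> \<le> \<beta> * (K / \<delta>\<^sup>2)"
      unfolding b_def abs_mult abs_of_nonneg[OF \<open>0 \<le> K / (r x * (K - r x))\<close>]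
      using \<beta>(2)[OF x] \<beta>(1) by (intro mult_mono) auto
    then show ?thesis using abs_le_square_iff[of "b x" "\<beta> * (K / \<delta>\<^sup>2)"] \<beta>(1) by simp
  qed
  have "(\<Sum>\<eta>\<in>\<Omega>. u \<eta> * (\<Sum>z\<in>{()}. (centred V r b \<eta>)\<^sup>2)) \<le> K\<^sup>2 * s * (1 * ent \<Omega> u \<nu> + card {()})"
  proof (rule order_trans[OF sum_centred_squares[where u = u and a = "\<lambda>_. b" and Z = "{()}" and m = 1 and s = s]])
    have "(\<Sum>x\<in>V. (b x)\<^sup>2) \<le> (\<Sum>x\<in>V. (\<beta> * (K / \<delta>\<^sup>2))\<^sup>2)" by (intro sum_mono b_le)
    then show "(\<Sum>x\<in>V. (b x)\<^sup>2) \<le> s" by (simp add: s_def mult.commute)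
    show "card {z \<in> {()}. b x \<noteq> 0} \<le> 1" for x by (rule order_trans[OF card_mono[of "{()}"]]) auto
  qed (use u0 u1 s in auto)
  then have X2: "(\<Sum>\<eta>\<in>\<Omega>. u \<eta> * (centred V r b \<eta>)\<^sup>2) \<le> q * (H + 1)" by (simp add: q_def H_def)
  have "(\<Sum>\<eta>\<in>\<Omega>. u \<eta> * centred V r b \<eta>) \<le> (\<Sum>\<eta>\<in>\<Omega>. u \<eta> * ((centred V r b \<eta>)\<^sup>2 / q + q))"
  proof (intro sum_mono mult_left_mono u0)
    fix \<eta>
    have "centred V r b \<eta> / q \<le> (centred V r b \<eta> / q)\<^sup>2 + 1"
    proof -
      have "y \<le> y\<^sup>2 + 1" for y :: real
        using sum_squares_bound[of y 1] zero_le_power2[of y] unfolding power_one mult_1_right by linarith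
      then show ?thesis .
    qed
    then have "q * (centred V r b \<eta> / q) \<le> q * ((centred V r b \<eta> / q)\<^sup>2 + 1)" using q by (intro mult_left_mono) auto
    then show "centred V r b \<eta> \<le> (centred V r b \<eta>)\<^sup>2 / q + q"
      using q by (simp add: power2_eq_square distrib_left)
  qed
  also have "\<dots> = (\<Sum>\<eta>\<in>\<Omega>. u \<eta> * (centred V r b \<eta>)\<^sup>2) / q + q"
    using u1 by (simp add: distrib_left sum.distrib sum_divide_distrib sum_distrib_right[symmetric])
  also have "\<dots> \<le> (H + 1) + q"
    using divide_right_mono[OF X2, of q] q by simp
  also have "q = (K\<^sup>2 * \<beta> / \<delta>\<^sup>2)\<^sup>2 * card V"
    unfolding q_def s_def by (simp add: power2_eq_square)
  finally have lin: "(\<Sum>\<eta>\<in>\<Omega>. u \<eta> * centred V r b \<eta>) \<le> H + 1 + (K\<^sup>2 * \<beta> / \<delta>\<^sup>2)\<^sup>2 * card V" .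
  have split: "(\<Sum>\<eta>\<in>\<Omega>. u \<eta> * centred V r b \<eta>)
     = a * (\<Sum>\<eta>\<in>\<Omega>. u \<eta> * (\<Sum>x\<in>V. flux x * (K * om \<eta> x / (r x * (K - r x)))))
       - (\<Sum>\<eta>\<in>\<Omega>. u \<eta> * (\<Sum>x\<in>V. dr x * (K * om \<eta> x / (r x * (K - r x)))))"
    unfolding sum_distrib_left[of a] sum_subtractf[symmetric]
  proof (rule sum.cong[OF refl])
    fix \<eta>
    have "centred V r b \<eta> = a * (\<Sum>x\<in>V. flux x * (K * om \<eta> x / (r x * (K - r x)))) - (\<Sum>x\<in>V. dr x * (K * om \<eta> x / (r x * (K - r x))))"
      unfolding centred_def sum_distrib_left[of a] sum_subtractf[symmetric]
      by (intro sum.cong refl) (simp add: b_def left_diff_distrib diff_divide_distrib mult.assoc)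
    then show "u \<eta> * centred V r b \<eta> = a * (u \<eta> * (\<Sum>x\<in>V. flux x * (K * om \<eta> x / (r x * (K - r x)))))
        - u \<eta> * (\<Sum>x\<in>V. dr x * (K * om \<eta> x / (r x * (K - r x))))"
      by (simp add: right_diff_distrib mult_ac)
  qed
  define Q where "Q = C * (\<epsilon>\<^sup>2 * (G + 1) * (card cube * H + card V) + \<epsilon> * (H + card V / card cube))"
  have "(\<Sum>\<eta>\<in>\<Omega>. u \<eta> * generator p K N (\<lambda>\<eta>. ln (u \<eta> / \<nu> \<eta>)) \<eta>)
    \<le> (\<Sum>\<eta>\<in>\<Omega>. u \<eta> * (\<Sum>x\<in>V. flux x * (K * om \<eta> x / (r x * (K - r x))))) + Q"
    unfolding Q_def C_def H_def by (rule entropy_production_estimate[where u = u, OF u u1 flow G])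
  then have "a * (\<Sum>\<eta>\<in>\<Omega>. u \<eta> * generator p K N (\<lambda>\<eta>. ln (u \<eta> / \<nu> \<eta>)) \<eta>)
    \<le> a * (\<Sum>\<eta>\<in>\<Omega>. u \<eta> * (\<Sum>x\<in>V. flux x * (K * om \<eta> x / (r x * (K - r x))))) + a * Q"
    unfolding distrib_left[symmetric] using a by (rule mult_left_mono)
  moreover have "a * Q = a * C * (\<epsilon>\<^sup>2 * (G + 1) * card cube + \<epsilon>) * H + a * C * (\<epsilon>\<^sup>2 * (G + 1) * card V + \<epsilon> * (card V / card cube))"
    unfolding Q_def by (simp add: algebra_simps)
  ultimately show ?thesis using lin split by (simp add: distrib_right)
qed

end

lemma DERIV_ln_comp:
  fixes g :: "real \<Rightarrow> real"
  assumes "(g has_real_derivative d) (at x within A)" "g x > 0"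
  shows "((\<lambda>x. ln (g x)) has_real_derivative 1 / g x * d) (at x within A)"
  by (rule DERIV_chain2[where g = g, OF DERIV_ln_divide[OF assms(2)] assms(1)])

lemma ln_binom_weight:
  assumes bp: "binomial_product K V r" and \<eta>: "\<eta> \<in> confs K V"
  shows "ln (binom_weight K V r \<eta>)
     = (\<Sum>x\<in>V. ln (K choose \<eta> x) + \<eta> x * ln (r x / K) + (real K - \<eta> x) * ln (1 - r x / K))"
proof -
  interpret binomial_product K V r by (rule bp)
  have pos: "real (K choose \<eta> x) > 0" "r x / K > 0" "1 - r x / K > 0" if "x \<in> V" for x
    using prob_bounds[OF that] confs_le[OF \<eta>, of x] by auto
  have "ln (binom_weight K V r \<eta>) = (\<Sum>x\<in>V. ln ((K choose \<eta> x) * (r x / K) ^ \<eta> x * (1 - r x / K) ^ (K - \<eta> x)))"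
    unfolding weight_eq[OF \<eta>]
  proof (rule ln_prod)
    fix x assume x: "x \<in> V"
    have "0 < real (K choose \<eta> x) * (r x / K) ^ \<eta> x * (1 - r x / K) ^ (K - \<eta> x)"
      by (intro mult_pos_pos zero_less_power pos[OF x])
    then show "real (K choose \<eta> x) * (r x / K) ^ \<eta> x * (1 - r x / K) ^ (K - \<eta> x) \<noteq> 0" by (rule less_imp_neq[symmetric])
  qed (rule V)
  also have "\<dots> = (\<Sum>x\<in>V. ln (K choose \<eta> x) + \<eta> x * ln (r x / K) + (real K - \<eta> x) * ln (1 - r x / K))"
  proof (intro sum.cong refl)
    fix x assume x: "x \<in> V"
    define A B D where "A = real (K choose \<eta> x)" and "B = r x / K" and "D = 1 - r x / K"
    have p: "A > 0" "B > 0" "D > 0" using pos[OF x] by (auto simp: A_def B_def D_def)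
    have "ln (A * B ^ \<eta> x * D ^ (K - \<eta> x)) = ln A + \<eta> x * ln B + (K - \<eta> x) * ln D"
      using p by (simp add: ln_mult ln_realpow)
    then show "ln ((K choose \<eta> x) * (r x / K) ^ \<eta> x * (1 - r x / K) ^ (K - \<eta> x))
       = ln (K choose \<eta> x) + \<eta> x * ln (r x / K) + (real K - \<eta> x) * ln (1 - r x / K)"
      using confs_le[OF \<eta>, of x] by (simp add: A_def B_def D_def of_nat_diff)
  qed
  finally show ?thesis .
qed

text \<open>The binomial coefficients do not depend on time, and each site contributes the score of
  the binomial law, the same variable as in the linear part of
  \<open>flux_expansion\<close>.\<close>

lemma ln_binom_weight_has_derivative:
  assumes bp: "\<And>t. t \<in> I \<Longrightarrow> binomial_product K V (r t)" and \<eta>: "\<eta> \<in> confs K V" and t: "t \<in> I"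
    and dr: "\<And>x. x \<in> V \<Longrightarrow> ((\<lambda>t. r t x) has_real_derivative dr x) (at t within I)"
  shows "((\<lambda>t. ln (binom_weight K V (r t) \<eta>)) has_real_derivative
     (\<Sum>x\<in>V. dr x * (K * (\<eta> x - r t x) / (r t x * (K - r t x))))) (at t within I)"
proof -
  interpret binomial_product K V "r t" by (rule bp[OF t])
  have Kp: "real K > 0" using K by simp
  have summand: "((\<lambda>t. ln (K choose \<eta> x) + \<eta> x * ln (r t x / K) + (real K - \<eta> x) * ln (1 - r t x / K)) has_real_derivative
     dr x * (K * (\<eta> x - r t x) / (r t x * (K - r t x)))) (at t within I)" if x: "x \<in> V" for x
  proof -
    have pos: "0 < r t x" "0 < K - r t x" "0 < r t x / K" "0 < 1 - r t x / K" using r[OF x] prob_bounds[OF x] by auto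
    have "((\<lambda>t. r t x / K) has_real_derivative dr x / K) (at t within I)"
      by (rule DERIV_cdivide[OF dr[OF x]])
    then have l1: "((\<lambda>t. ln (r t x / K)) has_real_derivative 1 / (r t x / K) * (dr x / K)) (at t within I)"
      using pos(3) by (intro DERIV_ln_comp)
    have "((\<lambda>t. 1 - r t x / K) has_real_derivative 0 - dr x / K) (at t within I)"
      by (intro DERIV_diff DERIV_const DERIV_cdivide dr x)
    then have l2: "((\<lambda>t. ln (1 - r t x / K)) has_real_derivative 1 / (1 - r t x / K) * (0 - dr x / K)) (at t within I)"
      using pos(4) by (intro DERIV_ln_comp)
    have "((\<lambda>t. ln (K choose \<eta> x) + \<eta> x * ln (r t x / K) + (real K - \<eta> x) * ln (1 - r t x / K)) has_real_derivative
      0 + \<eta> x * (1 / (r t x / K) * (dr x / K)) + (real K - \<eta> x) * (1 / (1 - r t x / K) * (0 - dr x / K))) (at t within I)"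
      by (intro DERIV_add DERIV_const DERIV_cmult l1 l2)
    moreover have "0 + \<eta> x * (1 / (r t x / K) * (dr x / K)) + (real K - \<eta> x) * (1 / (1 - r t x / K) * (0 - dr x / K))
      = dr x * (K * (\<eta> x - r t x) / (r t x * (K - r t x)))"
    proof -
      have e1: "1 / (r t x / K) * (dr x / K) = dr x / r t x" using Kp by simp
      have e2: "1 / (1 - r t x / K) * (0 - dr x / K) = - dr x / (K - r t x)" using Kp pos by (simp add: field_simps)
      show ?thesis unfolding e1 e2 using pos by (simp add: divide_simps) (simp add: algebra_simps)
    qed
    ultimately show ?thesis by simp
  qed
  have "((\<lambda>t. \<Sum>x\<in>V. ln (K choose \<eta> x) + \<eta> x * ln (r t x / K) + (real K - \<eta> x) * ln (1 - r t x / K)) has_real_derivative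
     (\<Sum>x\<in>V. dr x * (K * (\<eta> x - r t x) / (r t x * (K - r t x))))) (at t within I)"
    by (rule DERIV_sum[OF summand])
  then show ?thesis
    by (rule has_field_derivative_transform_within[OF _ zero_less_one t]) (simp add: ln_binom_weight[OF bp \<eta>])
qed

text \<open>Differentiating the logarithm of \<open>u\<close> produces the sum of \<open>u'\<close>,
  which vanishes by conservation of mass; the other terms are the generator acting on the
  logarithmic density and the derivative of the reference weights.\<close>

lemma (in finite_markov) entropy_has_derivative:
  assumes v0: "\<And>\<xi>. \<xi> \<in> S \<Longrightarrow> v \<xi> > 0" and v1: "(\<Sum>\<xi>\<in>S. v \<xi>) = 1" and t: "t \<in> {0..T}"
    and w: "\<And>t \<eta>. t \<in> {0..T} \<Longrightarrow> \<eta> \<in> S \<Longrightarrow> w t \<eta> > 0"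
    and dw: "\<And>\<eta>. \<eta> \<in> S \<Longrightarrow> ((\<lambda>t. ln (w t \<eta>)) has_real_derivative w' \<eta>) (at t within {0..T})"
  defines "u \<equiv> evolve S P v"
  shows "((\<lambda>t. ent S (u t) (w t)) has_real_derivative
      ((\<Sum>\<eta>\<in>S. u t \<eta> * L (\<lambda>\<eta>. ln (u t \<eta> / w t \<eta>)) \<eta>) - (\<Sum>\<eta>\<in>S. u t \<eta> * w' \<eta>))) (at t within {0..T})"
proof -
  have v0': "\<And>\<xi>. \<xi> \<in> S \<Longrightarrow> v \<xi> \<ge> 0" using v0 by (auto intro: less_imp_le)
  have T0: "t \<ge> 0" "{0..T} \<subseteq> {0..}" using t by auto
  define d where "d = (\<lambda>g. \<Sum>\<eta>\<in>S. u t \<eta> * L g \<eta>)"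
  have D: "((\<lambda>t. \<Sum>\<eta>\<in>S. u t \<eta> * g \<eta>) has_real_derivative d g) (at t within {0..})" for g
    using evolve_has_derivative[OF v0' v1 T0(1), of g] by (simp add: u_def d_def)
  define u' where "u' = (\<lambda>\<eta>. d (\<lambda>\<zeta>. if \<zeta> = \<eta> then 1 else 0))"
  have du: "((\<lambda>t. u t \<eta>) has_real_derivative u' \<eta>) (at t within {0..})" if "\<eta> \<in> S" for \<eta>
    using D[of "\<lambda>\<zeta>. if \<zeta> = \<eta> then 1 else 0"] that fin unfolding u'_def
    by (simp add: if_distrib cong: if_cong)
  have "at t within {0..} \<noteq> bot"
  proof -
    have "t islimpt {t..t + 1}" by (simp add: islimpt_Icc)
    then have "t islimpt {0..}" by (rule islimpt_subset) (use T0(1) in auto)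
    then show ?thesis by (simp add: trivial_limit_within)
  qed
  note nontriv = this
  \<comment> \<open>Both sides are derivatives of the same function, so linearity of
    \<open>L\<close> is not invoked. This allows a test function that itself depends on the current
    time.\<close>
  have dual: "(\<Sum>\<eta>\<in>S. u' \<eta> * g \<eta>) = d g" for g
  proof -
    have "((\<lambda>t. \<Sum>\<eta>\<in>S. u t \<eta> * g \<eta>) has_real_derivative (\<Sum>\<eta>\<in>S. u' \<eta> * g \<eta>)) (at t within {0..})"
      by (rule DERIV_sum) (rule DERIV_cmult_right[OF du])
    then show ?thesis by (rule has_field_derivative_unique[OF _ D nontriv])
  qed
  have "((\<lambda>t. \<Sum>\<eta>\<in>S. u t \<eta> * 1) has_real_derivative 0) (at t within {0..})"
  proof (rule has_field_derivative_transform_within[OF DERIV_const[of 1] zero_less_one])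
    show "t \<in> {0..}" using T0 by simp
    show "1 = (\<Sum>\<eta>\<in>S. u t \<eta> * 1)" if "t \<in> {0..}" for t
      using evolve_mass[of t v] v1 that by (simp add: u_def)
  qed
  then have mass: "d (\<lambda>_. 1) = 0"
    using has_field_derivative_unique[OF D[of "\<lambda>_. 1"] _ nontriv] by blast
  have upos: "u t \<eta> > 0" if "t \<in> {0..T}" "\<eta> \<in> S" for t \<eta>
    unfolding u_def using that by (intro evolve_pos v0 v1) auto
  have each: "((\<lambda>t. u t \<eta> * (ln (u t \<eta>) - ln (w t \<eta>))) has_real_derivative
     (u' \<eta> * ln (u t \<eta> / w t \<eta>) + u' \<eta> * 1 - u t \<eta> * w' \<eta>)) (at t within {0..T})" if \<eta>: "\<eta> \<in> S" for \<eta>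
  proof -
    have du': "((\<lambda>t. u t \<eta>) has_real_derivative u' \<eta>) (at t within {0..T})"
      by (rule has_field_derivative_subset[OF du[OF \<eta>] T0(2)])
    have "((\<lambda>t. u t \<eta> * (ln (u t \<eta>) - ln (w t \<eta>))) has_real_derivative
       u' \<eta> * (ln (u t \<eta>) - ln (w t \<eta>)) + (1 / u t \<eta> * u' \<eta> - w' \<eta>) * u t \<eta>) (at t within {0..T})"
      by (intro DERIV_mult DERIV_diff du' dw \<eta> DERIV_ln_comp upos[OF t \<eta>])
    moreover have "u' \<eta> * (ln (u t \<eta>) - ln (w t \<eta>)) + (1 / u t \<eta> * u' \<eta> - w' \<eta>) * u t \<eta>
       = u' \<eta> * ln (u t \<eta> / w t \<eta>) + u' \<eta> * 1 - u t \<eta> * w' \<eta>"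
      using upos[OF t \<eta>] w[OF t \<eta>] by (simp add: ln_div algebra_simps)
    ultimately show ?thesis by simp
  qed
  have "((\<lambda>t. \<Sum>\<eta>\<in>S. u t \<eta> * (ln (u t \<eta>) - ln (w t \<eta>))) has_real_derivative
     (\<Sum>\<eta>\<in>S. u' \<eta> * ln (u t \<eta> / w t \<eta>) + u' \<eta> * 1 - u t \<eta> * w' \<eta>)) (at t within {0..T})"
    by (rule DERIV_sum[OF each])
  moreover have "(\<Sum>\<eta>\<in>S. u' \<eta> * ln (u t \<eta> / w t \<eta>) + u' \<eta> * 1 - u t \<eta> * w' \<eta>)
     = d (\<lambda>\<eta>. ln (u t \<eta> / w t \<eta>)) - (\<Sum>\<eta>\<in>S. u t \<eta> * w' \<eta>)"
    unfolding sum_subtractf sum.distrib dual mass by simp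
  ultimately have "((\<lambda>t. \<Sum>\<eta>\<in>S. u t \<eta> * (ln (u t \<eta>) - ln (w t \<eta>))) has_real_derivative
     d (\<lambda>\<eta>. ln (u t \<eta> / w t \<eta>)) - (\<Sum>\<eta>\<in>S. u t \<eta> * w' \<eta>)) (at t within {0..T})" by simp
  then have "((\<lambda>t. ent S (u t) (w t)) has_real_derivative
     d (\<lambda>\<eta>. ln (u t \<eta> / w t \<eta>)) - (\<Sum>\<eta>\<in>S. u t \<eta> * w' \<eta>)) (at t within {0..T})"
  proof (rule has_field_derivative_transform_within[OF _ zero_less_one t])
    show "(\<Sum>\<eta>\<in>S. u t \<eta> * (ln (u t \<eta>) - ln (w t \<eta>))) = ent S (u t) (w t)" if "t \<in> {0..T}" for t
      unfolding ent_def using upos[OF that] w[OF that] by (intro sum.cong refl) (simp add: ln_div less_imp_neq[symmetric])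
  qed
  then show ?thesis by (simp add: d_def)
qed

text \<open>Adding \<open>R / B\<close> turns the affine inequality into a linear one, to which the
  integrating factor applies; \<open>B \<ge> 1\<close> then lets \<open>R\<close> replace
  \<open>R / B\<close>.\<close>

lemma gronwall_differential:
  fixes h :: "real \<Rightarrow> real"
  assumes d: "\<And>t. t \<in> {0..T} \<Longrightarrow> (h has_real_derivative h' t) (at t within {0..T})"
    and le: "\<And>t. t \<in> {0..T} \<Longrightarrow> h' t \<le> B * h t + R"
    and B: "B \<ge> 1" and R: "R \<ge> 0" and h0: "h 0 \<ge> 0" and t: "t \<in> {0..T}"
  shows "h t \<le> exp (B * T) * (h 0 + R)"
proof -
  define y where "y = (\<lambda>t. exp (- B * t) * (h t + R / B))"
  have dy: "(y has_real_derivative exp (- B * s) * (h' s - B * h s - R)) (at s within {0..T})" if "s \<in> {0..T}" for s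
  proof -
    have "((\<lambda>t. exp (- B * t)) has_real_derivative exp (- B * s) * (- B * 1)) (at s within {0..T})"
      by (intro DERIV_chain2[OF DERIV_exp] DERIV_cmult DERIV_ident)
    moreover have "((\<lambda>t. h t + R / B) has_real_derivative h' s + 0) (at s within {0..T})"
      by (intro DERIV_add DERIV_const d that)
    ultimately have "(y has_real_derivative (exp (- B * s) * (- B * 1)) * (h s + R / B) + (h' s + 0) * exp (- B * s)) (at s within {0..T})"
      unfolding y_def by (rule DERIV_mult)
    moreover have "(exp (- B * s) * (- B * 1)) * (h s + R / B) + (h' s + 0) * exp (- B * s) = exp (- B * s) * (h' s - B * h s - R)"
      using B by (simp add: algebra_simps)
    ultimately show ?thesis by simp
  qed
  have "y t \<le> y 0"
  proof (rule DERIV_nonpos_imp_decreasing_open[where f = y and a = 0 and b = t])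
    show "0 \<le> t" using t by simp
    fix s assume s: "0 < s" "s < t"
    then have "s \<in> {0..T}" "at s within {0..T} = at s" using t by (auto intro!: at_within_interior)
    then show "\<exists>y'. DERIV y s :> y' \<and> y' \<le> 0"
      using dy[of s] le[of s] by (intro exI[of _ "exp (- B * s) * (h' s - B * h s - R)"]) (auto intro!: mult_nonneg_nonpos)
  next
    have "continuous_on {0..T} y" using dy by (intro DERIV_continuous_on) auto
    then show "continuous_on {0..t} y" by (rule continuous_on_subset) (use t in auto)
  qed
  then have "exp (B * t) * y t \<le> exp (B * t) * y 0" by (intro mult_left_mono) auto
  moreover have "exp (B * t) * y t = h t + R / B" unfolding y_def by (simp flip: exp_add mult.assoc)
  moreover have "exp (B * t) * y 0 \<le> exp (B * T) * (h 0 + R)"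
  proof -
    have "R / B \<le> R" using B R by (simp add: divide_le_eq mult_le_cancel_left1)
    then show ?thesis unfolding y_def using t B R h0 by (intro mult_mono) auto
  qed
  moreover have "R / B \<ge> 0" using B R by simp
  ultimately show ?thesis by linarith
qed

section \<open>Uniform Riemann sums on the torus\<close>

lemma rescale_tshift:
  fixes f :: "real ^ 'd::finite \<Rightarrow> 'b"
  assumes f: "torus_periodic f" and N: "N > 0"
  shows "f (rescale N (tshift N x w) + v) = f (rescale N x + rescale N w + v)"
proof -
  define k :: "real ^ 'd" where "k = (\<chi> i. of_int ((x $ i + w $ i) div int N))"
  have eq: "rescale N x + rescale N w + v = (rescale N (tshift N x w) + v) + k"
  proof -
    have "real_of_int (x $ i + w $ i) = real N * of_int ((x $ i + w $ i) div int N) + of_int ((x $ i + w $ i) mod int N)" for i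
      by (metis mult_div_mod_eq of_int_add of_int_mult of_int_of_nat_eq)
    then have "(of_int (x $ i) + of_int (w $ i)) / real N = of_int ((x $ i + w $ i) div int N) + of_int ((x $ i + w $ i) mod int N) / real N" for i
      using N by (simp add: field_simps)
    then show ?thesis
      by (simp add: vec_eq_iff rescale_def tshift_def k_def add_divide_distrib[symmetric])
  qed
  show ?thesis unfolding eq by (rule torus_periodic_int[OF f, symmetric]) (simp add: k_def)
qed

lemma sum_Basis_nth: "(\<Sum>b\<in>Basis. b $ i) = (1 :: real)" for i :: "'d::finite"
proof -
  have ax: "axis i 1 \<in> (Basis :: (real ^ 'd) set)" by (auto simp: Basis_vec_def)
  have "(\<Sum>b\<in>(Basis :: (real ^ 'd) set). b $ i) = (\<Sum>b\<in>(Basis :: (real ^ 'd) set). if b = axis i 1 then 1 else 0)"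
    by (intro sum.cong refl) (simp add: cart_eq_inner_axis inner_Basis[OF _ ax])
  also have "\<dots> = 1" using ax by simp
  finally show ?thesis .
qed

lemma torus_periodic_bounded:
  fixes f :: "real ^ 'd::finite \<Rightarrow> real"
  assumes "torus_continuous f"
  obtains M where "M > 0" "\<And>u. \<bar>f u\<bar> \<le> M"
proof -
  have c: "continuous_on UNIV f" and p: "torus_periodic f" using assms by (auto simp: torus_continuous_def)
  have "bounded (f ` cbox 0 One)"
    by (intro compact_imp_bounded compact_continuous_image continuous_on_subset[OF c]) auto
  then obtain M where M: "\<And>u. u \<in> cbox 0 One \<Longrightarrow> \<bar>f u\<bar> \<le> M" unfolding bounded_iff by auto
  have "\<bar>f u\<bar> \<le> \<bar>M\<bar> + 1" for u
  proof -
    obtain u0 where u0: "\<And>i. 0 \<le> u0 $ i \<and> u0 $ i < 1" and eq: "f (u + 0) = f (u0 + 0)"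
      using torus_periodic_unit_cube[of u] p by metis
    have "u0 \<in> cbox 0 One" using u0 by (auto simp: mem_box_cart less_imp_le sum_Basis_nth)
    then show ?thesis using M[of u0] eq by simp
  qed
  then show ?thesis using that[of "\<bar>M\<bar> + 1"] by fastforce
qed

text \<open>Compactness on a cube that contains the unit cube and its displacements, followed by a
  periodic reduction of \<open>u\<close> and \<open>u + v\<close> by the same integer
  vector.\<close>

lemma torus_uniformly_continuous:
  fixes F :: "real \<Rightarrow> real ^ 'd::finite \<Rightarrow> real" and e :: real
  assumes c: "continuous_on (I \<times> UNIV) (\<lambda>(s, u). F s u)" and I: "compact I"
    and p: "\<And>s. s \<in> I \<Longrightarrow> torus_periodic (F s)" and e: "e > 0"
  obtains d where "d > 0" "\<And>s s' u v. s \<in> I \<Longrightarrow> s' \<in> I \<Longrightarrow> \<bar>s - s'\<bar> < d \<Longrightarrow> (\<forall>i. \<bar>v $ i\<bar> < d) \<Longrightarrow> \<bar>F s (u + v) - F s' u\<bar> < e"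
proof -
  let ?B = "I \<times> cbox ((\<chi> i. - 1) :: real ^ 'd) (\<chi> i. 2)"
  have "uniformly_continuous_on ?B (\<lambda>(s, u). F s u)"
    by (rule compact_uniformly_continuous) (auto intro!: continuous_on_subset[OF c] compact_Times I)
  then obtain d where d: "d > 0" "\<And>x y. x \<in> ?B \<Longrightarrow> y \<in> ?B \<Longrightarrow> dist y x < d \<Longrightarrow> dist ((\<lambda>(s, u). F s u) y) ((\<lambda>(s, u). F s u) x) < e"
    using e unfolding uniformly_continuous_on_def by metis
  \<comment> \<open>Small enough that the time difference and the d coordinates of \<open>v\<close>
    together stay below \<open>d / 2\<close>.\<close>
  define d' where "d' = min 1 (d / (2 * (CARD('d) + 1)))"
  have d': "d' > 0" "d' \<le> 1" "d' * (CARD('d) + 1) \<le> d / 2"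
  proof -
    show "d' > 0" "d' \<le> 1" using d by (auto simp: d'_def)
    have "d' * (CARD('d) + 1) \<le> d / (2 * (CARD('d) + 1)) * (CARD('d) + 1)" unfolding d'_def by (intro mult_right_mono) auto
    also have "\<dots> = d / 2" by (simp add: field_simps)
    finally show "d' * (CARD('d) + 1) \<le> d / 2" by simp
  qed
  have "\<bar>F s (u + v) - F s' u\<bar> < e" if s: "s \<in> I" "s' \<in> I" "\<bar>s - s'\<bar> < d'" and v: "\<forall>i. \<bar>v $ i\<bar> < d'" for s s' u v
  proof -
    obtain u0 where u0: "\<And>i. 0 \<le> u0 $ i \<and> u0 $ i < 1" and eq: "\<And>(f :: real ^ 'd \<Rightarrow> real) v. torus_periodic f \<Longrightarrow> f (u + v) = f (u0 + v)"
      using torus_periodic_unit_cube[of u] by metis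
    have v1: "- 1 \<le> v $ i \<and> v $ i \<le> 1" for i using v d'(2) by (smt (verit))
    have u1: "0 \<le> u0 $ i \<and> u0 $ i \<le> 1" for i using u0[of i] by auto
    have in1: "(s, u0 + v) \<in> ?B"
    proof -
      have "- 1 \<le> u0 $ i + v $ i \<and> u0 $ i + v $ i \<le> 2" for i using u1[of i] v1[of i] by auto
      then show ?thesis using s by (auto simp: mem_box_cart)
    qed
    have in2: "(s', u0) \<in> ?B"
    proof -
      have "- 1 \<le> u0 $ i \<and> u0 $ i \<le> 2" for i using u1[of i] by auto
      then show ?thesis using s by (auto simp: mem_box_cart)
    qed
    have "dist (s, u0 + v) (s', u0) \<le> \<bar>s - s'\<bar> + norm v"
      using sqrt_sum_squares_le_sum_abs[of "s - s'" "norm v"] by (simp add: dist_prod_def dist_norm dist_real_def)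
    also have "norm v \<le> (\<Sum>i\<in>UNIV. \<bar>v $ i\<bar>)" by (rule norm_le_l1_cart)
    also have "\<dots> \<le> (\<Sum>i\<in>(UNIV :: 'd set). d')" using v by (intro sum_mono) (auto intro: less_imp_le)
    finally have "dist (s, u0 + v) (s', u0) < d"
      using s(3) d' d(1) by (simp add: algebra_simps)
    from d(2)[OF in2 in1 this] have "\<bar>F s (u0 + v) - F s' u0\<bar> < e" by (simp add: dist_real_def)
    then show ?thesis using eq[OF p[OF s(1)], of v] eq[OF p[OF s(2)], of 0] by simp
  qed
  with d'(1) show ?thesis using that[of d'] by blast
qed

text \<open>The half-open cells fill the unit cube up to a null set, on which boundedness of
  \<open>g\<close> suffices. Cells are described by floors so that each point of their union lies in
  exactly one of them.\<close>

lemma riemann_sum_cells: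
  fixes g :: "real ^ 'd::finite \<Rightarrow> real" and c :: "int ^ 'd \<Rightarrow> real" and w :: real
  assumes g: "torus_continuous g" and N: "N > 0" and w: "w \<ge> 0"
    and close: "\<And>x u. x \<in> sites N \<Longrightarrow> (\<And>i. \<lfloor>N * u $ i\<rfloor> = x $ i) \<Longrightarrow> \<bar>g u - c x\<bar> \<le> w"
  shows "\<bar>(\<Sum>x\<in>sites N. c x) / N ^ CARD('d) - torus_integral g\<bar> \<le> w"
proof -
  have gc: "continuous_on UNIV g" using g by (simp add: torus_continuous_def)
  obtain M where M: "M > 0" "\<And>u. \<bar>g u\<bar> \<le> M" using torus_periodic_bounded[OF g] by blast
  let ?V = "sites N :: (int ^ 'd) set" and ?I = "cbox 0 One :: (real ^ 'd) set"
  define cell where "cell = (\<lambda>x :: int ^ 'd. {u :: real ^ 'd. \<forall>i. \<lfloor>N * u $ i\<rfloor> = x $ i})"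
  have Np: "real N > 0" using N by simp
  have meas[measurable]: "cell x \<in> sets lborel" for x
  proof -
    have "cell x = (\<Inter>i\<in>UNIV. {u \<in> space borel. \<lfloor>N * u $ i\<rfloor> = x $ i})" by (auto simp: cell_def)
    also have "\<dots> \<in> sets borel"
    proof (rule sets.finite_INT)
      fix i :: 'd
      have [measurable]: "(\<lambda>u :: real ^ 'd. u $ i) \<in> borel_measurable borel"
        by (intro borel_measurable_continuous_onI continuous_intros)
      show "{u \<in> space (borel :: (real ^ 'd) measure). \<lfloor>N * u $ i\<rfloor> = x $ i} \<in> sets borel" by measurable
    qed auto
    finally show ?thesis by simp
  qed
  \<comment> \<open>The half-open cell lies between an open and a closed box of the same volume,
    which gives its measure.\<close>
  have sandwich: "box (rescale N x) (rescale N x + (1 / N) *\<^sub>R One) \<subseteq> cell x"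
    "cell x \<subseteq> cbox (rescale N x) (rescale N x + (1 / N) *\<^sub>R One)" for x :: "int ^ 'd"
  proof -
    have fl: "\<lfloor>N * a\<rfloor> = z \<longleftrightarrow> of_int z / N \<le> a \<and> a < of_int z / N + 1 / N" for a :: real and z
      using Np by (simp add: floor_eq_iff field_simps)
    show "box (rescale N x) (rescale N x + (1 / N) *\<^sub>R One) \<subseteq> cell x"
      by (auto simp: mem_box_cart cell_def fl rescale_def sum_Basis_nth less_imp_le)
    show "cell x \<subseteq> cbox (rescale N x) (rescale N x + (1 / N) *\<^sub>R One)"
      by (auto simp: mem_box_cart cell_def fl rescale_def sum_Basis_nth less_imp_le)
  qed
  have vol: "emeasure lborel (cell x) = ennreal ((1 / N) ^ CARD('d))" for x
  proof (rule antisym)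
    have prod1: "(\<Prod>b\<in>Basis. ((rescale N x + (1 / N) *\<^sub>R One) - rescale N x) \<bullet> b) = (1 / N) ^ CARD('d)"
      by (simp add: prod_constant)
    have le: "rescale N x \<bullet> b \<le> (rescale N x + (1 / N) *\<^sub>R One) \<bullet> b" if "b \<in> Basis" for b
      using that Np by (simp add: inner_add_left)
    show "emeasure lborel (cell x) \<le> ennreal ((1 / N) ^ CARD('d))"
      using emeasure_mono[OF sandwich(2)[of x], of lborel] emeasure_lborel_cbox[OF le] prod1 by simp
    show "ennreal ((1 / N) ^ CARD('d)) \<le> emeasure lborel (cell x)"
      using emeasure_mono[OF sandwich(1)[of x], of lborel] meas[of x] emeasure_lborel_box[OF le] prod1 by simp
  qed
  have volr: "measure lborel (cell x) = (1 / N) ^ CARD('d)" for x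
    using vol[of x] Np by (simp add: measure_def)
  define Q where "Q = (\<Union>x\<in>?V. cell x)"
  have disj: "disjoint_family_on cell ?V"
    by (auto simp: disjoint_family_on_def cell_def vec_eq_iff)
  have QI: "Q \<subseteq> ?I"
  proof
    fix u assume "u \<in> Q"
    then obtain x where x: "x \<in> ?V" "u \<in> cell x" by (auto simp: Q_def)
    have "0 \<le> u $ i \<and> u $ i \<le> 1" for i
    proof -
      have "\<lfloor>N * u $ i\<rfloor> \<in> {0..<int N}" using x by (auto simp: cell_def sites_def)
      then have "0 \<le> N * u $ i" "N * u $ i < N" by (auto simp: floor_less_iff)
      then show ?thesis using Np by (auto simp: zero_le_mult_iff)
    qed
    then show "u \<in> ?I" by (simp add: mem_box_cart sum_Basis_nth)
  qed
  have Qm[measurable]: "Q \<in> sets lborel" unfolding Q_def by (intro sets.finite_UN meas) auto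
  have fI: "emeasure lborel ?I = 1" by (subst emeasure_lborel_cbox) auto
  have fin: "emeasure lborel A < \<infinity>" if "A \<subseteq> ?I" for A
    using emeasure_mono[OF that, of lborel] fI by (simp add: le_less_trans[OF _ ennreal_one_less_top])
  have "emeasure lborel Q = (\<Sum>x\<in>?V. emeasure lborel (cell x))"
    unfolding Q_def by (rule sum_emeasure[symmetric]) (use meas disj in auto)
  also have "\<dots> = ennreal (\<Sum>x\<in>?V. (1 / N) ^ CARD('d))" unfolding vol by (subst sum_ennreal) auto
  also have "(\<Sum>x\<in>?V. (1 / N) ^ CARD('d)) = 1" using Np by (simp add: card_sites power_divide)
  finally have "emeasure lborel Q = 1" by simp
  then have null: "measure lborel (?I - Q) = 0"
    using emeasure_Diff[of lborel Q ?I] QI fI Qm by (simp add: measure_def)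
  have cellint: "integrable lborel (\<lambda>u. indicator (cell x) u :: real)" for x
    by (rule integrable_real_indicator) (use vol meas[of x] in auto)
  have gint: "integrable lborel (\<lambda>u. indicator ?I u * g u)"
    using borel_integrable_compact[of ?I g] continuous_on_subset[OF gc] by (simp add: set_integrable_def)
  let ?d = "\<lambda>u. indicator ?I u * g u - (\<Sum>x\<in>?V. c x * indicator (cell x) u)"
  have intd: "integrable lborel ?d" using cellint by (intro Bochner_Integration.integrable_diff gint Bochner_Integration.integrable_sum) auto
  have "(\<integral>u. ?d u \<partial>lborel) = torus_integral g - (\<Sum>x\<in>?V. c x * (1 / N) ^ CARD('d))"
  proof -
    have "(\<integral>u. ?d u \<partial>lborel) = (\<integral>u. indicator ?I u * g u \<partial>lborel) - (\<integral>u. (\<Sum>x\<in>?V. c x * indicator (cell x) u) \<partial>lborel)"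
      using cellint by (intro Bochner_Integration.integral_diff gint Bochner_Integration.integrable_sum) auto
    also have "(\<integral>u. (\<Sum>x\<in>?V. c x * indicator (cell x) u) \<partial>lborel) = (\<Sum>x\<in>?V. c x * (1 / N) ^ CARD('d))"
      using cellint vol by (subst Bochner_Integration.integral_sum) (auto simp: volr)
    finally show ?thesis by (simp add: torus_integral_def set_lebesgue_integral_def)
  qed
  moreover have "\<bar>\<integral>u. ?d u \<partial>lborel\<bar> \<le> (\<integral>u. w * indicator ?I u + M * indicator (?I - Q) u \<partial>lborel)"
  proof (rule order_trans[OF integral_abs_bound])
    show "(\<integral>u. \<bar>?d u\<bar> \<partial>lborel) \<le> (\<integral>u. w * indicator ?I u + M * indicator (?I - Q) u \<partial>lborel)"
    proof (rule integral_mono)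
      show "integrable lborel (\<lambda>u. \<bar>?d u\<bar>)" using intd by simp
      show "integrable lborel (\<lambda>u. w * indicator ?I u + M * indicator (?I - Q) u)"
        using fin[of ?I] fin[of "?I - Q"] Qm by (intro Bochner_Integration.integrable_add integrable_mult_right integrable_real_indicator) auto
      fix u
      show "\<bar>?d u\<bar> \<le> w * indicator ?I u + M * indicator (?I - Q) u"
      proof (cases "u \<in> Q")
        case True
        then obtain x where x: "x \<in> ?V" "u \<in> cell x" by (auto simp: Q_def)
        have "(\<Sum>y\<in>?V. c y * indicator (cell y) u) = (\<Sum>y\<in>?V. if y = x then c x else 0)"
        proof (intro sum.cong refl)
          fix y :: "int ^ 'd"
          have "u \<in> cell y \<longleftrightarrow> y = x" using x by (auto simp: cell_def vec_eq_iff)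
          then show "c y * indicator (cell y) u = (if y = x then c x else 0)" by (simp add: indicator_def)
        qed
        then show ?thesis using True QI x close[of x u] by (auto simp: cell_def)
      next
        case False
        then have "(\<Sum>y\<in>?V. c y * indicator (cell y) u) = 0" by (intro sum.neutral) (auto simp: Q_def)
        then show ?thesis using M(2)[of u] False w by (auto simp: indicator_def)
      qed
    qed
  qed
  moreover have "(\<integral>u. w * indicator ?I u + M * indicator (?I - Q) u \<partial>lborel) = w"
    using fin[of ?I] fin[of "?I - Q"] Qm null fI by (subst Bochner_Integration.integral_add) (auto simp: measure_def)
  ultimately show ?thesis by (simp add: sum_divide_distrib power_divide abs_minus_commute)
qed

text \<open>Uniformity in \<open>v\<close> is essential, as the frame shift grows with N. The
  multiple of 1/N in \<open>v\<close> only permutes the sites; what remains is below 1/N in each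
  coordinate and, together with the position inside a cell, stays below 2/N, which uniform
  continuity absorbs.\<close>

lemma shifted_riemann_sum:
  fixes g :: "real ^ 'd::finite \<Rightarrow> real" and e :: real
  assumes g: "torus_continuous g" and e: "e > 0"
  shows "\<forall>\<^sub>F N in sequentially. \<forall>v. \<bar>(\<Sum>x\<in>sites N. g (rescale N x - v)) / N ^ CARD('d) - torus_integral g\<bar> \<le> e"
proof -
  have gc: "continuous_on UNIV g" and gp: "torus_periodic g" using g by (auto simp: torus_continuous_def)
  have "continuous_on ({0..0::real} \<times> UNIV) (\<lambda>(s, u). g u)"
    unfolding case_prod_beta by (intro continuous_on_compose2[OF gc] continuous_intros) auto
  then obtain d where d: "d > 0" "\<And>u v. (\<forall>i. \<bar>v $ i\<bar> < d) \<Longrightarrow> \<bar>g (u + v) - g u\<bar> < e"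
  proof -
    obtain d where "d > 0" "\<And>s s' u v. s \<in> {0..0::real} \<Longrightarrow> s' \<in> {0..0} \<Longrightarrow> \<bar>s - s'\<bar> < d \<Longrightarrow> (\<forall>i. \<bar>v $ i\<bar> < d) \<Longrightarrow> \<bar>g (u + v) - g u\<bar> < e"
      by (rule torus_uniformly_continuous[OF \<open>continuous_on ({0..0::real} \<times> UNIV) (\<lambda>(s, u). g u)\<close> _ _ e]) (use gp in auto)
    then show ?thesis using that[of d] by auto
  qed
  have "\<forall>\<^sub>F N in sequentially. N > 0 \<and> 2 / real N < d"
    using d(1) by (intro eventually_conj eventually_gt_at_top order_tendstoD(2)[OF lim_const_over_n]) auto
  then show ?thesis
  proof (rule eventually_mono)
    fix N assume N: "N > 0 \<and> 2 / real N < d"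
    then have N0: "N > 0" and Np: "real N > 0" by auto
    show "\<forall>v. \<bar>(\<Sum>x\<in>sites N. g (rescale N x - v)) / N ^ CARD('d) - torus_integral g\<bar> \<le> e"
    proof
      fix v :: "real ^ 'd"
      define k :: "int ^ 'd" where "k = (\<chi> i. \<lfloor>N * v $ i\<rfloor>)"
      define \<theta> where "\<theta> = v - rescale N k"
      have \<theta>: "0 \<le> \<theta> $ i \<and> \<theta> $ i < 1 / N" for i
      proof -
        have "\<theta> $ i = frac (N * v $ i) / N" using Np by (simp add: \<theta>_def k_def rescale_def frac_def field_simps)
        then show ?thesis using Np frac_lt_1[of "N * v $ i"] by (simp add: divide_strict_right_mono)
      qed
      have "(\<Sum>x\<in>sites N. g (rescale N x - v)) = (\<Sum>x\<in>sites N. g (rescale N (tshift N x (- k)) + - \<theta>))"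
      proof (rule sum.cong[OF refl])
        fix x :: "int ^ 'd"
        have "rescale N (- k) = - rescale N k" by (simp add: rescale_def vec_eq_iff)
        then show "g (rescale N x - v) = g (rescale N (tshift N x (- k)) + - \<theta>)"
          unfolding rescale_tshift[OF gp N0] by (simp add: \<theta>_def)
      qed
      also have "\<dots> = (\<Sum>x\<in>sites N. g (rescale N x + - \<theta>))"
        by (rule sum_tshift[OF N0, of "\<lambda>x. g (rescale N x + - \<theta>)"])
      finally have eq: "(\<Sum>x\<in>sites N. g (rescale N x - v)) = (\<Sum>x\<in>sites N. g (rescale N x + - \<theta>))" .
      show "\<bar>(\<Sum>x\<in>sites N. g (rescale N x - v)) / N ^ CARD('d) - torus_integral g\<bar> \<le> e"
        unfolding eq of_nat_power
      proof (rule riemann_sum_cells[OF g N0])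
        fix x :: "int ^ 'd" and u :: "real ^ 'd" assume u: "\<And>i. \<lfloor>N * u $ i\<rfloor> = x $ i"
        define z where "z = rescale N x + - \<theta> - u"
        have "\<bar>z $ i\<bar> < d" for i
        proof -
          have "u $ i - rescale N x $ i = frac (N * u $ i) / N"
            using Np u[of i] by (simp add: rescale_def frac_def field_simps)
          moreover have "0 \<le> frac (N * u $ i) / N" "frac (N * u $ i) / N < 1 / N"
            using Np frac_lt_1[of "N * u $ i"] by (auto simp: divide_strict_right_mono)
          moreover have "2 / real N = 1 / N + 1 / N" by simp
          moreover have "z $ i = - (u $ i - rescale N x $ i) - \<theta> $ i" by (simp add: z_def)
          ultimately show ?thesis using \<theta>[of i] N by linarith
        qed
        then have "\<bar>g (u + z) - g u\<bar> < e" using d(2) by blast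
        then show "\<bar>g u - g (rescale N x + - \<theta>)\<bar> \<le> e" by (simp add: z_def abs_minus_commute)
      qed (use e in auto)
    qed
  qed
qed

section \<open>From the macroscopic profile to the lattice\<close>

lemma rescale_dir: "rescale N (dir (Inl j)) = (1 / N) *\<^sub>R axis j 1" "rescale N (dir (Inr j)) = (- (1 / N)) *\<^sub>R axis j 1"
  "rescale N (- dir (Inl j)) = (- (1 / N)) *\<^sub>R axis j 1" "rescale N (- dir (Inr j)) = (1 / N) *\<^sub>R axis j 1"
  by (simp_all add: rescale_def vec_eq_iff axis_def)

text \<open>Neighbouring densities differ by at most \<open>A * C / N\<close>, and
  \<open>odds - 1 = K * (r x - r y) / ((K - r x) * r y)\<close> adds the part with
  \<open>\<delta>^2\<close>; this explains \<epsilon>. In \<open>flux\<close> the second-order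
  Taylor formula leaves \<open>-(K - 2 * r)\<close> times the derivative of the profile along the
  drift, with an error of order \<open>A / N^2\<close>.\<close>

lemma profile_torus_model:
  fixes p :: "'d::finite + 'd \<Rightarrow> real" and f :: "real ^ 'd \<Rightarrow> real" and g :: "real ^ 'd \<Rightarrow> real ^ 'd"
    and r :: "int ^ 'd \<Rightarrow> real" and A C \<delta> \<rho>s p0 \<epsilon> :: real and K N n :: nat
  assumes K: "K > 0" and p_nonneg: "\<And>i. p i \<ge> 0" and p0: "p0 > 0" "\<And>j. p (Inl j) \<ge> p0 \<or> p (Inr j) \<ge> p0"
    and size: "2 * 2 ^ n + 2 \<le> N" and f: "torus_periodic f"
    and C: "C > 0" "\<And>u. \<bar>f u\<bar> \<le> C"
    and f1: "\<And>u j h. \<bar>h\<bar> \<le> 1 \<Longrightarrow> \<bar>f (u + h *\<^sub>R axis j 1) - f u\<bar> \<le> C * \<bar>h\<bar>"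
    and f2: "\<And>u j h. \<bar>h\<bar> \<le> 1 \<Longrightarrow> \<bar>f (u + h *\<^sub>R axis j 1) - f u - h * g u $ j\<bar> \<le> C * h\<^sup>2"
    and A: "A > 0" "A * C \<le> \<delta>" and \<delta>: "\<delta> > 0" "2 * \<delta> \<le> \<rho>s" "\<rho>s \<le> K - 2 * \<delta>"
    and \<epsilon>: "(C + K * C / \<delta>\<^sup>2) * A / N \<le> 1"
  defines "r \<equiv> \<lambda>x. \<rho>s + A * f (rescale N x)" and "\<epsilon> \<equiv> (C + K * C / \<delta>\<^sup>2) * A / N"
  shows "torus_model K N r p n \<epsilon> p0"
    and "\<And>x. \<delta> \<le> r x \<and> r x \<le> K - \<delta>"
    and "\<And>x. \<bar>torus_model.flux K N r p x + (K - 2 * r x) * (A / N) * (drift p \<bullet> g (rescale N x))\<bar> \<le> K * (\<Sum>i\<in>UNIV. p i) * C * A / N\<^sup>2"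
proof -
  have Kp: "real K > 0" using K by simp
  have N: "N > 0" using size by linarith
  have Np: "real N > 0" "1 / real N \<le> 1" using N by auto
  show rb: "\<delta> \<le> r x \<and> r x \<le> K - \<delta>" for x
  proof -
    have "\<bar>A * f (rescale N x)\<bar> \<le> A * C" using A C(2) by (simp add: abs_mult)
    then show ?thesis unfolding r_def using A(2) \<delta> by (simp add: abs_le_iff)
  qed
  have r: "0 < r x \<and> r x < K" for x using rb[of x] \<delta>(1) by auto
  interpret bp: binomial_product K "sites N" r
    by unfold_locales (use K r in auto)
  have f_shift: "f (rescale N (tshift N x w)) = f (rescale N x + rescale N w)" for x w
    using rescale_tshift[OF f N, of x w 0] by simp
  have ah: "\<bar>1 / real N\<bar> \<le> 1" "\<bar>- (1 / real N)\<bar> \<le> 1" using Np by auto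
  have gradr: "\<bar>r x - r (tshift N x (dir i))\<bar> \<le> A * C / N" for x i
  proof -
    have "\<bar>f (rescale N x + rescale N (dir i)) - f (rescale N x)\<bar> \<le> C * (1 / N)"
    proof (cases i)
      case (Inl j)
      then show ?thesis using f1[OF ah(1), of "rescale N x" j] by (simp only: rescale_dir) simp
    next
      case (Inr j)
      then show ?thesis using f1[OF ah(2), of "rescale N x" j] by (simp only: rescale_dir) simp
    qed
    then have "A * \<bar>f (rescale N x) - f (rescale N x + rescale N (dir i))\<bar> \<le> A * (C * (1 / N))"
      using A by (intro mult_left_mono) (auto simp: abs_minus_commute)
    moreover have "\<bar>r x - r (tshift N x (dir i))\<bar> = A * \<bar>f (rescale N x) - f (rescale N x + rescale N (dir i))\<bar>"
    proof -
      have "r x - r (tshift N x (dir i)) = A * (f (rescale N x) - f (rescale N x + rescale N (dir i)))"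
        unfolding r_def f_shift by (simp add: right_diff_distrib)
      then show ?thesis using A by (simp only: abs_mult abs_of_pos)
    qed
    ultimately show ?thesis by simp
  qed
  have eps_split: "\<epsilon> = A * C / N + (K * (A * C / N)) / \<delta>\<^sup>2"
    unfolding \<epsilon>_def using Np by (simp add: field_simps)
  have ACN: "A * C / N > 0" using A C Np by simp
  show model: "torus_model K N r p n \<epsilon> p0"
  proof unfold_locales
    show "\<epsilon> \<le> 1" using \<epsilon> by (simp add: \<epsilon>_def)
    show "0 < \<epsilon>" unfolding eps_split using A C Np Kp \<delta>(1) by (intro add_pos_pos divide_pos_pos mult_pos_pos) auto
    fix x i
    show "\<bar>r x - r (tshift N x (dir i))\<bar> \<le> \<epsilon>"
    proof -
      have "0 \<le> (K * (A * C / N)) / \<delta>\<^sup>2" using ACN Kp by (intro divide_nonneg_nonneg mult_nonneg_nonneg less_imp_le[OF ACN]) auto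
      then show ?thesis using gradr[of x i] unfolding eps_split by linarith
    qed
    show "\<bar>bp.odds x (tshift N x (dir i)) - 1\<bar> \<le> \<epsilon>"
    proof -
      let ?y = "tshift N x (dir i)"
      have pos: "r x > 0" "K - r x > 0" "r ?y > 0" "K - r ?y > 0" using r[of x] r[of ?y] by auto
      have "bp.odds x ?y = (r x * (K - r ?y)) / ((K - r x) * r ?y)"
        unfolding bp.odds_def by simp
      then have "bp.odds x ?y - 1 = (r x * (K - r ?y) - (K - r x) * r ?y) / ((K - r x) * r ?y)"
        using pos by (simp add: diff_divide_distrib)
      also have "r x * (K - r ?y) - (K - r x) * r ?y = K * (r x - r ?y)" by (simp add: algebra_simps)
      finally have "\<bar>bp.odds x ?y - 1\<bar> = K * \<bar>r x - r ?y\<bar> / ((K - r x) * r ?y)"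
        using pos Kp by (simp add: abs_mult)
      also have "\<dots> \<le> K * (A * C / N) / \<delta>\<^sup>2"
      proof (rule frac_le)
        show "K * \<bar>r x - r ?y\<bar> \<le> K * (A * C / N)" using Kp gradr[of x i] by (intro mult_left_mono) auto
        show "\<delta>\<^sup>2 \<le> (K - r x) * r ?y"
          unfolding power2_eq_square using rb[of x] rb[of ?y] \<delta>(1) by (intro mult_mono) auto
      qed (use mult_nonneg_nonneg[OF less_imp_le[OF Kp] less_imp_le[OF ACN]] \<delta> in auto)
      also have "\<dots> \<le> \<epsilon>" unfolding eps_split using ACN by linarith
      finally show ?thesis .
    qed
  qed (use p_nonneg p0 size in auto)
  then interpret torus_model K N r p n \<epsilon> p0 .
  fix x :: "int ^ 'd"
  define u where "u = rescale N x"
  define \<rho> where "\<rho> = r x"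
  define a b where "a = (\<lambda>j. f (u + (1 / N) *\<^sub>R axis j 1) - f u - (1 / N) * g u $ j)"
    and "b = (\<lambda>j. f (u + (- (1 / N)) *\<^sub>R axis j 1) - f u - (- (1 / N)) * g u $ j)"
  have ab: "\<bar>a j\<bar> \<le> C / N\<^sup>2" "\<bar>b j\<bar> \<le> C / N\<^sup>2" for j
    using f2[OF ah(1), of u j] f2[OF ah(2), of u j] by (auto simp: a_def b_def power_divide)
  have rp: "\<rho>s + A * f (u + (1 / N) *\<^sub>R axis j 1) = \<rho> + A * (g u $ j / N + a j)"
    "\<rho>s + A * f (u + (- (1 / N)) *\<^sub>R axis j 1) = \<rho> + A * (- (g u $ j / N) + b j)" for j
    by (simp_all add: a_def b_def \<rho>_def r_def u_def distrib_left[symmetric])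
  have \<rho>K: "0 \<le> \<rho>" "0 \<le> K - \<rho>" using r[of x] by (auto simp: \<rho>_def)
  have err: "\<bar>s * (K - \<rho>) + \<rho> * t\<bar> \<le> K * (C / N\<^sup>2)" if "\<bar>s\<bar> \<le> C / N\<^sup>2" "\<bar>t\<bar> \<le> C / N\<^sup>2" for s t
  proof -
    have "\<bar>s * (K - \<rho>) + \<rho> * t\<bar> \<le> \<bar>s\<bar> * (K - \<rho>) + \<rho> * \<bar>t\<bar>"
      using abs_triangle_ineq[of "s * (K - \<rho>)" "\<rho> * t"] \<rho>K by (simp add: abs_mult)
    also have "\<dots> \<le> (C / N\<^sup>2) * (K - \<rho>) + \<rho> * (C / N\<^sup>2)"
      using that \<rho>K by (intro add_mono mult_right_mono mult_left_mono) auto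
    finally have "\<bar>s * (K - \<rho>) + \<rho> * t\<bar> \<le> (C / N\<^sup>2) * (K - \<rho>) + \<rho> * (C / N\<^sup>2)" .
    moreover have "c * (K - \<rho>) + \<rho> * c = K * c" for c :: real by (simp add: algebra_simps)
    ultimately show ?thesis by (simp only:)
  qed
  \<comment> \<open>The current balance at a site is affine in the neighbouring densities once its
    own density is fixed, so no product of two increments appears.\<close>
  have id: "p1 * ((\<rho> + A * (- y + s)) * (k - \<rho>) - \<rho> * (k - (\<rho> + A * (y + t)))) + p2 * ((\<rho> + A * (y + t)) * (k - \<rho>) - \<rho> * (k - (\<rho> + A * (- y + s))))
      = - ((k - 2 * \<rho>) * A) * ((p1 - p2) * y) + A * (p1 * (s * (k - \<rho>) + \<rho> * t) + p2 * (t * (k - \<rho>) + \<rho> * s))"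
    for p1 p2 y s t k :: real
    by (simp add: algebra_simps)
  have "flux x = (\<Sum>j\<in>UNIV. p (Inl j) * ((\<rho> + A * (- (g u $ j / N) + b j)) * (K - \<rho>) - \<rho> * (K - (\<rho> + A * (g u $ j / N + a j))))
       + p (Inr j) * ((\<rho> + A * (g u $ j / N + a j)) * (K - \<rho>) - \<rho> * (K - (\<rho> + A * (- (g u $ j / N) + b j)))))"
    unfolding flux_def UNIV_Plus_UNIV[symmetric]
    by (subst sum.Plus) (simp_all only: sum.distrib[symmetric] o_def r_def f_shift rescale_dir u_def[symmetric] rp \<rho>_def[unfolded r_def u_def[symmetric], symmetric] finite_UNIV finite)
  also have "\<dots> = (\<Sum>j\<in>UNIV. - ((K - 2 * \<rho>) * (A / N)) * ((p (Inl j) - p (Inr j)) * g u $ j)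
       + A * (p (Inl j) * (b j * (K - \<rho>) + \<rho> * a j) + p (Inr j) * (a j * (K - \<rho>) + \<rho> * b j)))"
    unfolding id by simp
  also have "\<dots> = - ((K - 2 * \<rho>) * (A / N)) * (drift p \<bullet> g u)
       + A * (\<Sum>j\<in>UNIV. p (Inl j) * (b j * (K - \<rho>) + \<rho> * a j) + p (Inr j) * (a j * (K - \<rho>) + \<rho> * b j))"
    by (simp only: sum.distrib sum_distrib_left[symmetric] inner_vec_def drift_def vec_lambda_beta inner_real_def)
  finally have fl: "flux x + (K - 2 * \<rho>) * (A / N) * (drift p \<bullet> g u)
     = A * (\<Sum>j\<in>UNIV. p (Inl j) * (b j * (K - \<rho>) + \<rho> * a j) + p (Inr j) * (a j * (K - \<rho>) + \<rho> * b j))" by simp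
  have "\<bar>\<Sum>j\<in>UNIV. p (Inl j) * (b j * (K - \<rho>) + \<rho> * a j) + p (Inr j) * (a j * (K - \<rho>) + \<rho> * b j)\<bar>
     \<le> (\<Sum>j\<in>UNIV. p (Inl j) * (K * (C / N\<^sup>2)) + p (Inr j) * (K * (C / N\<^sup>2)))"
  proof (rule order_trans[OF sum_abs], rule sum_mono)
    fix j
    have "\<bar>p (Inl j) * (b j * (K - \<rho>) + \<rho> * a j)\<bar> \<le> p (Inl j) * (K * (C / N\<^sup>2))"
      unfolding abs_mult abs_of_nonneg[OF p_nonneg] by (intro mult_left_mono err ab p_nonneg)
    moreover have "\<bar>p (Inr j) * (a j * (K - \<rho>) + \<rho> * b j)\<bar> \<le> p (Inr j) * (K * (C / N\<^sup>2))"
      unfolding abs_mult abs_of_nonneg[OF p_nonneg] by (intro mult_left_mono err ab p_nonneg)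
    ultimately show "\<bar>p (Inl j) * (b j * (K - \<rho>) + \<rho> * a j) + p (Inr j) * (a j * (K - \<rho>) + \<rho> * b j)\<bar>
       \<le> p (Inl j) * (K * (C / N\<^sup>2)) + p (Inr j) * (K * (C / N\<^sup>2))" by linarith
  qed
  also have "\<dots> = (\<Sum>i\<in>UNIV. p i) * (K * (C / N\<^sup>2))"
    unfolding UNIV_Plus_UNIV[symmetric] by (subst sum.Plus) (simp_all add: sum.distrib sum_distrib_right distrib_right sum_divide_distrib add_divide_distrib)
  finally have "A * \<bar>\<Sum>j\<in>UNIV. p (Inl j) * (b j * (K - \<rho>) + \<rho> * a j) + p (Inr j) * (a j * (K - \<rho>) + \<rho> * b j)\<bar>
     \<le> A * ((\<Sum>i\<in>UNIV. p i) * (K * (C / N\<^sup>2)))" using A by (intro mult_left_mono) auto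
  then show "\<bar>flux x + (K - 2 * r x) * (A / N) * (drift p \<bullet> g (rescale N x))\<bar> \<le> K * (\<Sum>i\<in>UNIV. p i) * C * A / N\<^sup>2"
    using A fl by (simp add: \<rho>_def u_def abs_mult mult_ac)
qed

section \<open>Entropy growth and the choice of scales\<close>

text \<open>The constant of \<open>entropy_production_estimate\<close>, taken out of the locale to
  make visible that it depends neither on N nor on the cube or \<epsilon>.\<close>

definition production_constant :: "nat \<Rightarrow> ('d::finite + 'd \<Rightarrow> real) \<Rightarrow> real \<Rightarrow> real" where
  "production_constant K p p0 =
     (3 / (2 * p0) + real (K + 1)) * 4 * (real CARD('d))\<^sup>2 * real (K\<^sup>2) * (\<Sum>i\<in>UNIV. p i)\<^sup>2
     + real ((K + 1) * CARD('d)) + real (CARD('d) * K\<^sup>2) * ((\<Sum>i\<in>UNIV. p i)\<^sup>2 + 1)"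

lemma production_constant_nonneg: "p0 > 0 \<Longrightarrow> production_constant K p p0 \<ge> 0"
  unfolding production_constant_def by (intro add_nonneg_nonneg mult_nonneg_nonneg) auto

text \<open>All estimates for one N, assembled along time. The products \<open>N * W\<close> and
  \<open>W * A\<close> are the speed N^(1+\<kappa>) and the Burgers rate \<open>a\<close>; with them
  the first-order part of the accelerated flux is exactly the time derivative of the profile, and
  the Taylor error gives \<beta>. The last two conclusions only unfold the profile.\<close>

lemma entropy_growth:
  fixes p :: "'d::finite + 'd \<Rightarrow> real" and m :: "real ^ 'd" and K N n :: nat
    and \<rho> :: "real \<Rightarrow> real ^ 'd \<Rightarrow> real" and \<phi> :: "'d \<Rightarrow> int ^ 'd \<Rightarrow> real"
    and \<alpha> \<kappa> \<rho>s lam C \<delta> p0 T S G B R t A W a \<epsilon> PP Q :: real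
    and V :: "(int ^ 'd) set" and r :: "real \<Rightarrow> int ^ 'd \<Rightarrow> real" and v :: "(int ^ 'd \<Rightarrow> nat) \<Rightarrow> real"
  defines "V \<equiv> sites N"
  defines "A \<equiv> real N powr (- \<alpha>)" and "W \<equiv> real N powr \<kappa>" and "a \<equiv> real N powr (\<kappa> - \<alpha>)"
    and "\<epsilon> \<equiv> (C + K * C / \<delta>\<^sup>2) * A / N" and "PP \<equiv> (\<Sum>i\<in>UNIV. p i)"
    and "r \<equiv> \<lambda>t x. perturbed_profile m lam \<rho>s \<alpha> \<kappa> \<rho> N t (rescale N x)"
    and "Q \<equiv> production_constant K p p0"
  assumes K: "K > 0" and p_nonneg: "\<And>i. p i \<ge> 0" and p0: "p0 > 0" "\<And>j. p (Inl j) \<ge> p0 \<or> p (Inr j) \<ge> p0"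
    and m: "m = drift p" and lam: "lam = K - 2 * \<rho>s"
    and per: "\<And>s. s \<in> {0..S} \<Longrightarrow> torus_periodic (\<rho> s)" and pb: "profile_bounds m S \<rho> g C"
    and size: "2 * 2 ^ n + 2 \<le> N" and AC: "A * C \<le> \<delta>" and \<delta>: "\<delta> > 0" "2 * \<delta> \<le> \<rho>s" "\<rho>s \<le> K - 2 * \<delta>"
    and \<epsilon>: "\<epsilon> \<le> 1" and aT: "a * T \<le> S"
    and flow: "\<And>g. g 0 - avg (sites (2 ^ n)) g = (\<Sum>j\<in>UNIV. \<Sum>v\<in>sites (2 ^ n). \<phi> j v * (g v - g (v + axis j 1)))"
    and G: "(\<Sum>j\<in>UNIV. \<Sum>v\<in>sites (2 ^ n). (\<phi> j v)\<^sup>2) \<le> G"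
    and sg: "markov_semigroup (confs K V) P"
    and gen: "has_generator (confs K V) P (\<lambda>f \<eta>. real N powr (1 + \<kappa>) * generator p K N f \<eta>)"
    and v0: "\<And>\<eta>. \<eta> \<in> confs K V \<Longrightarrow> v \<eta> > 0" and v1: "(\<Sum>\<eta>\<in>confs K V. v \<eta>) = 1"
    and B: "1 + N * W * Q * (\<epsilon>\<^sup>2 * (G + 1) * (2 ^ n) ^ CARD('d) + \<epsilon>) \<le> B"
    and R: "1 + (K\<^sup>2 * (K * PP * C * A * W / N) / \<delta>\<^sup>2)\<^sup>2 * N ^ CARD('d)
       + N * W * Q * (\<epsilon>\<^sup>2 * (G + 1) * N ^ CARD('d) + \<epsilon> * (N ^ CARD('d) / (2 ^ n) ^ CARD('d))) \<le> R"
    and t: "t \<in> {0..T}"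
  shows "ent (confs K V) (evolve (confs K V) P v t) (binom_weight K V (r t))
    \<le> exp (B * T) * (ent (confs K V) v (binom_weight K V (r 0)) + R)"
    and "binomial_product K V (r t)" and "\<And>x. r t x = \<rho>s + A * \<rho> (a * t) (rescale N x - t *\<^sub>R ((W * lam) *\<^sub>R m))"
proof -
  let ?\<Omega> = "confs K V"
  define w where "w = (W * lam) *\<^sub>R m"
  define f where "f = (\<lambda>t u. \<rho> (a * t) (u - t *\<^sub>R w))"
  define gt where "gt = (\<lambda>t u. g (a * t) (u - t *\<^sub>R w))"
  have N: "N > 0" using size by linarith
  have Np: "real N > 0" using N by simp
  have AW: "A > 0" "W > 0" "a = W * A" "real N powr (1 + \<kappa>) = N * W" "a \<ge> 0"
    using Np by (auto simp: A_def W_def a_def powr_add[symmetric] powr_one' intro: less_imp_le) (simp add: powr_add)?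
  have C: "C > 0" using pb by (simp add: profile_bounds_def)
  have Kp: "real K > 0" using K by simp
  have T0: "T \<ge> 0" "0 \<in> {0..T}" using t by auto
  have inS: "a * t \<in> {0..S}" if "t \<in> {0..T}" for t
  proof -
    have "a * t \<le> a * T" using that AW(5) by (intro mult_left_mono) auto
    then show ?thesis using aT that AW(5) by auto
  qed
  have r_eq: "r t x = \<rho>s + A * f t (rescale N x)" for t x
    unfolding r_def perturbed_profile_def f_def w_def A_def[symmetric] W_def[symmetric] a_def[symmetric]
    by (simp add: mult.commute mult.left_commute)
  show "r t x = \<rho>s + A * \<rho> (a * t) (rescale N x - t *\<^sub>R ((W * lam) *\<^sub>R m))" for x
    using r_eq[of t x] by (simp add: f_def w_def)
  have rfun: "r t = (\<lambda>x. \<rho>s + A * f t (rescale N x))" for t using r_eq by (intro ext)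
  have fper: "torus_periodic (f t)" if "t \<in> {0..T}" for t
    unfolding torus_periodic_def f_def
  proof (intro allI)
    fix u i
    have "u + axis i 1 - t *\<^sub>R w = (u - t *\<^sub>R w) + axis i 1" by simp
    then show "\<rho> (a * t) (u + axis i 1 - t *\<^sub>R w) = \<rho> (a * t) (u - t *\<^sub>R w)"
      using per[OF inS[OF that]] unfolding torus_periodic_def by (simp only:)
  qed
  have bounds: "\<bar>f t u\<bar> \<le> C" "\<bar>h\<bar> \<le> 1 \<Longrightarrow> \<bar>f t (u + h *\<^sub>R axis j 1) - f t u\<bar> \<le> C * \<bar>h\<bar>"
     "\<bar>h\<bar> \<le> 1 \<Longrightarrow> \<bar>f t (u + h *\<^sub>R axis j 1) - f t u - h * gt t u $ j\<bar> \<le> C * h\<^sup>2" if "t \<in> {0..T}" for t u h j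
  proof -
    have sh: "u + h *\<^sub>R axis j 1 - t *\<^sub>R w = (u - t *\<^sub>R w) + h *\<^sub>R axis j 1" by simp
    show "\<bar>f t u\<bar> \<le> C" using pb inS[OF that] unfolding profile_bounds_def f_def by blast
    show "\<bar>h\<bar> \<le> 1 \<Longrightarrow> \<bar>f t (u + h *\<^sub>R axis j 1) - f t u\<bar> \<le> C * \<bar>h\<bar>"
      "\<bar>h\<bar> \<le> 1 \<Longrightarrow> \<bar>f t (u + h *\<^sub>R axis j 1) - f t u - h * gt t u $ j\<bar> \<le> C * h\<^sup>2"
      using pb inS[OF that] unfolding profile_bounds_def f_def gt_def sh by blast+
  qed
  have model: "torus_model K N (r t) p n \<epsilon> p0" if "t \<in> {0..T}" for t
    unfolding rfun \<epsilon>_def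
    by (rule profile_torus_model(1)[where f = "f t" and g = "gt t", OF K p_nonneg p0 size fper[OF that] C bounds[OF that] AW(1) AC \<delta> \<epsilon>[unfolded \<epsilon>_def]])
  have rb: "\<delta> \<le> r t x \<and> r t x \<le> K - \<delta>" if "t \<in> {0..T}" for t x
    unfolding rfun
    by (rule profile_torus_model(2)[where f = "f t" and g = "gt t", OF K p_nonneg p0 size fper[OF that] C bounds[OF that] AW(1) AC \<delta> \<epsilon>[unfolded \<epsilon>_def]])
  have fl: "\<bar>torus_model.flux K N (r t) p x + (K - 2 * r t x) * (A / N) * (m \<bullet> gt t (rescale N x))\<bar> \<le> K * PP * C * A / N\<^sup>2"
    if "t \<in> {0..T}" for t x
    unfolding rfun PP_def m
    by (rule profile_torus_model(3)[where f = "f t" and g = "gt t", OF K p_nonneg p0 size fper[OF that] C bounds[OF that] AW(1) AC \<delta> \<epsilon>[unfolded \<epsilon>_def]])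
  have bp: "binomial_product K V (r t)" if "t \<in> {0..T}" for t
    using torus_model.axioms(1)[OF model[OF that]] by (simp add: V_def)
  show "binomial_product K V (r t)" by (rule bp[OF t])
  define dr where "dr = (\<lambda>t x. A * (2 * a * f t (rescale N x) * (m \<bullet> gt t (rescale N x)) - w \<bullet> gt t (rescale N x)))"
  have der_r: "((\<lambda>t. r t x) has_real_derivative dr t x) (at t within {0..T})" if "t \<in> {0..T}" for t x
  proof -
    have "((\<lambda>t. f t (rescale N x)) has_real_derivative 2 * a * f t (rescale N x) * (m \<bullet> gt t (rescale N x)) - w \<bullet> gt t (rescale N x)) (at t within {0..T})"
      using pb AW(5) aT that unfolding profile_bounds_def f_def gt_def by blast
    from DERIV_add[OF DERIV_const[of \<rho>s] DERIV_cmult[OF this, of A]] show ?thesis unfolding r_eq dr_def by simp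
  qed
  define \<beta> where "\<beta> = K * PP * C * A * W / N"
  have PP: "PP > 0"
  proof -
    have "p0 \<le> p (Inl undefined) + p (Inr undefined)"
      using p0(2)[of undefined] p_nonneg[of "Inl undefined"] p_nonneg[of "Inr undefined"] by linarith
    also have "\<dots> = (\<Sum>i\<in>{Inl undefined, Inr undefined}. p i)" by simp
    also have "\<dots> \<le> PP" unfolding PP_def by (intro sum_mono2) (auto simp: p_nonneg)
    finally show ?thesis using p0(1) by simp
  qed
  have \<beta>: "\<beta> > 0" unfolding \<beta>_def using Kp PP C AW Np by simp
  have fluxdr: "\<bar>N * W * torus_model.flux K N (r t) p x - dr t x\<bar> \<le> \<beta>" if "t \<in> {0..T}" for t x
  proof -
    define y where "y = m \<bullet> gt t (rescale N x)"
    have wg: "w \<bullet> gt t (rescale N x) = W * lam * y" by (simp add: w_def y_def)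
    \<comment> \<open>The cancellation that dictates the profile:
      \<open>K - 2 * r = lam - 2 * A * f\<close>, where \<open>lam\<close> yields the moving frame
      and the rest, by \<open>a = W * A\<close>, the Burgers nonlinearity.\<close>
    have "dr t x = - (N * W * ((K - 2 * r t x) * (A / N) * y))"
      unfolding dr_def wg y_def[symmetric] r_eq lam AW(3) using Np by (simp add: algebra_simps)
    then have "N * W * torus_model.flux K N (r t) p x - dr t x
       = N * W * (torus_model.flux K N (r t) p x + (K - 2 * r t x) * (A / N) * y)" by (simp add: distrib_left)
    then have "\<bar>N * W * torus_model.flux K N (r t) p x - dr t x\<bar>
       = N * W * \<bar>torus_model.flux K N (r t) p x + (K - 2 * r t x) * (A / N) * y\<bar>"
      using Np AW by (simp add: abs_mult)
    also have "\<dots> \<le> N * W * (K * PP * C * A / N\<^sup>2)"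
      using fl[OF that, of x] Np AW unfolding y_def by (intro mult_left_mono) auto
    also have "\<dots> = \<beta>" unfolding \<beta>_def using Np by (simp add: power2_eq_square)
    finally show ?thesis .
  qed
  interpret fm: finite_markov ?\<Omega> P "\<lambda>f \<eta>. real N powr (1 + \<kappa>) * generator p K N f \<eta>"
    by unfold_locales (use sg gen in \<open>auto intro!: finite_confs simp: V_def\<close>)
  define u where "u = evolve ?\<Omega> P v"
  define \<nu> where "\<nu> = (\<lambda>t. binom_weight K V (r t))"
  define h where "h = (\<lambda>t. ent ?\<Omega> (u t) (\<nu> t))"
  define h' where "h' = (\<lambda>t. (\<Sum>\<eta>\<in>?\<Omega>. u t \<eta> * (real N powr (1 + \<kappa>) * generator p K N (\<lambda>\<eta>. ln (u t \<eta> / \<nu> t \<eta>)) \<eta>))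
      - (\<Sum>\<eta>\<in>?\<Omega>. u t \<eta> * (\<Sum>x\<in>V. dr t x * (K * (\<eta> x - r t x) / (r t x * (K - r t x))))))"
  have upos: "u t \<eta> > 0" if "t \<in> {0..T}" "\<eta> \<in> ?\<Omega>" for t \<eta>
    unfolding u_def using that by (intro fm.evolve_pos v0 v1) auto
  have umass: "(\<Sum>\<eta>\<in>?\<Omega>. u t \<eta>) = 1" if "t \<in> {0..T}" for t
    unfolding u_def using that v1 by (simp add: fm.evolve_mass)
  have \<nu>pos: "\<nu> t \<eta> > 0" if "t \<in> {0..T}" "\<eta> \<in> ?\<Omega>" for t \<eta>
    unfolding \<nu>_def by (rule binomial_product.weight_pos[OF bp[OF that(1)] that(2)])
  have \<nu>mass: "(\<Sum>\<eta>\<in>?\<Omega>. \<nu> t \<eta>) = 1" if "t \<in> {0..T}" for t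
    unfolding \<nu>_def by (rule binomial_product.sum_weight[OF bp[OF that]])
  have h0: "h t \<ge> 0" if "t \<in> {0..T}" for t
    unfolding h_def
    by (rule ent_nonneg[OF fm.fin _ umass[OF that] \<nu>pos[OF that] \<nu>mass[OF that]]) (use upos[OF that] in \<open>auto intro: less_imp_le\<close>)
  have der: "(h has_real_derivative h' t) (at t within {0..T})" if tT: "t \<in> {0..T}" for t
    unfolding h_def h'_def u_def
  proof (rule fm.entropy_has_derivative[OF v0 v1 tT \<nu>pos])
    fix \<eta> assume "\<eta> \<in> ?\<Omega>"
    then show "((\<lambda>t. ln (\<nu> t \<eta>)) has_real_derivative (\<Sum>x\<in>V. dr t x * (K * (\<eta> x - r t x) / (r t x * (K - r t x))))) (at t within {0..T})"
      unfolding \<nu>_def by (intro ln_binom_weight_has_derivative bp tT der_r)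
  qed
  have le: "h' t \<le> B * h t + R" if tT: "t \<in> {0..T}" for t
  proof -
    interpret tm: torus_model K N "r t" p n \<epsilon> p0 by (rule model[OF tT])
    have PPP: "tm.P = PP" by (simp add: tm.P_def PP_def)
    have "h' t = N * W * (\<Sum>\<eta>\<in>?\<Omega>. u t \<eta> * generator p K N (\<lambda>\<eta>. ln (u t \<eta> / \<nu> t \<eta>)) \<eta>)
      - (\<Sum>\<eta>\<in>?\<Omega>. u t \<eta> * (\<Sum>x\<in>V. dr t x * (K * (\<eta> x - r t x) / (r t x * (K - r t x)))))"
      unfolding h'_def AW(4) sum_distrib_left by (simp add: mult_ac)
    also have "\<dots> \<le> (1 + N * W * Q * (\<epsilon>\<^sup>2 * (G + 1) * card (sites (2 ^ n) :: (int ^ 'd) set) + \<epsilon>)) * h t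
      + (1 + (K\<^sup>2 * \<beta> / \<delta>\<^sup>2)\<^sup>2 * card V + N * W * Q * (\<epsilon>\<^sup>2 * (G + 1) * card V + \<epsilon> * (card V / card (sites (2 ^ n) :: (int ^ 'd) set))))"
      unfolding h_def \<nu>_def V_def Q_def production_constant_def PPP[symmetric, unfolded PP_def]
      by (rule tm.entropy_derivative_bound[where u = "u t" and dr = "dr t" and \<beta> = \<beta> and \<delta> = \<delta> and a = "N * W" and \<phi> = \<phi> and G = G,
            OF upos[OF tT, unfolded V_def] umass[OF tT, unfolded V_def] flow G _ \<beta> fluxdr[OF tT] \<delta>(1) rb[OF tT]])
        (use Np AW in auto)
    also have "\<dots> \<le> B * h t + R"
    proof (rule add_mono)
      show "(1 + N * W * Q * (\<epsilon>\<^sup>2 * (G + 1) * card (sites (2 ^ n) :: (int ^ 'd) set) + \<epsilon>)) * h t \<le> B * h t"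
        using B h0[OF tT] by (intro mult_right_mono) (simp_all add: card_sites)
      show "1 + (K\<^sup>2 * \<beta> / \<delta>\<^sup>2)\<^sup>2 * card V + N * W * Q * (\<epsilon>\<^sup>2 * (G + 1) * card V + \<epsilon> * (card V / card (sites (2 ^ n) :: (int ^ 'd) set))) \<le> R"
        using R by (simp add: card_sites V_def \<beta>_def)
    qed
    finally show ?thesis .
  qed
  have Q0: "Q \<ge> 0" unfolding Q_def by (rule production_constant_nonneg[OF p0(1)])
  have G0: "G \<ge> 0" using order_trans[OF _ G] by (simp add: sum_nonneg)
  have \<epsilon>0: "\<epsilon> \<ge> 0" unfolding \<epsilon>_def using C AW Np \<delta> by simp
  have B1: "B \<ge> 1"
    using order_trans[OF _ B, of 1] Q0 G0 \<epsilon>0 AW by simp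
  have R0: "R \<ge> 0"
    using order_trans[OF _ R, of 0] Q0 G0 \<epsilon>0 AW by simp
  have "h t \<le> exp (B * T) * (h 0 + R)"
    by (rule gronwall_differential[OF der le B1 R0 h0[OF T0(2)] t])
  moreover have "h 0 = ent ?\<Omega> v (binom_weight K V (r 0))"
    unfolding h_def ent_def \<nu>_def u_def by (intro sum.cong refl) (simp add: fm.evolve_0)
  ultimately show "ent ?\<Omega> (evolve ?\<Omega> P v t) (binom_weight K V (r t)) \<le> exp (B * T) * (ent ?\<Omega> v (binom_weight K V (r 0)) + R)"
    by (simp add: h_def u_def \<nu>_def)
qed

text \<open>With cubes of side \<open>N\<^sup>b\<close>, the condition \<open>\<kappa> + \<alpha> < b d\<close> controls the products of cube averages,
  the next one the coefficient of the entropy in the cost of the flow, and the last one its constant part.\<close>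

lemma block_exponent_exists:
  fixes \<alpha> \<kappa> ch :: real and d :: nat
  assumes \<alpha>: "0 < \<alpha>" "\<alpha> < d / 2" and \<kappa>: "0 < \<kappa>" "\<kappa> \<le> \<alpha>"
    and d1: "d = 1 \<Longrightarrow> \<kappa> < 1 - 2 * \<alpha>" and d2: "d \<ge> 2 \<Longrightarrow> \<kappa> < 1"
  defines "ch \<equiv> (if d = 1 then 1 else 0 :: real)"
  obtains b :: real where "0 < b" "b < 1" "\<kappa> + \<alpha> < b * d" "b * d + b * ch + \<kappa> - 1 - 2 * \<alpha> < 0" "\<kappa> - 1 + b * ch < 0"
proof (cases "d = 1")
  case True
  \<comment> \<open>The interval for \<open>b\<close> is open because
    \<open>2 * \<kappa> + \<alpha> \<le> \<kappa> + 2 * \<alpha> < 1\<close>.\<close>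
  have "\<kappa> + \<alpha> < min (1 - \<kappa>) ((1 + 2 * \<alpha> - \<kappa>) / 2)" using d1[OF True] \<kappa> \<alpha> by (simp add: min_def)
  then obtain b where "\<kappa> + \<alpha> < b" "b < min (1 - \<kappa>) ((1 + 2 * \<alpha> - \<kappa>) / 2)" using dense by blast
  then show ?thesis using that[of b] True \<kappa> \<alpha> by (simp add: ch_def)
next
  case False
  have "d \<noteq> 0" using \<alpha> by auto
  then have d: "d \<ge> 2" using False by simp
  \<comment> \<open>The unknown is now the product \<open>b * d\<close>; the bound d stands for
    \<open>b < 1\<close>, and the other one follows from
    \<open>2 * \<kappa> \<le> \<kappa> + \<alpha> < 1 + \<alpha>\<close>.\<close>
  have "\<kappa> + \<alpha> < min (1 + 2 * \<alpha> - \<kappa>) d" using d2[OF d] \<kappa> \<alpha> by (simp add: min_def)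
  then obtain y where y: "\<kappa> + \<alpha> < y" "y < min (1 + 2 * \<alpha> - \<kappa>) d" using dense by blast
  have "d > 0" using d by simp
  then show ?thesis using that[of "y / d"] y False d2[OF d] \<kappa> \<alpha> by (simp add: ch_def)
qed

text \<open>Rounding the side down to a power of two costs at most a factor 2, and the number of
  doublings is logarithmic in N.\<close>

lemma dyadic_scale:
  fixes b :: real and N n :: nat
  assumes b: "0 < b" "b < 1" and N: "N \<ge> 2"
  defines "n \<equiv> nat \<lfloor>b * log 2 N\<rfloor>"
  shows "2 ^ n \<le> real N powr b" "real N powr b \<le> 2 * 2 ^ n" "n \<le> log 2 N"
proof -
  have l: "log 2 N \<ge> 1" using N by (simp add: le_log_iff)
  have bl: "0 \<le> b * log 2 N" using b l by simp
  have n: "real n \<le> b * log 2 N" "b * log 2 N < real n + 1"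
    using bl unfolding n_def by (auto simp: of_nat_nat)
  have e: "real N powr b = 2 powr (b * log 2 N)"
    using N by (simp add: powr_def log_def)
  show "2 ^ n \<le> real N powr b" unfolding e powr_realpow[symmetric, of 2, simplified] using n(1) by (intro powr_mono) auto
  have "2 powr (b * log 2 N) \<le> 2 powr (real n + 1)" using n(2) by (intro powr_mono) auto
  also have "\<dots> = 2 * 2 ^ n" by (simp add: powr_add powr_realpow)
  finally show "real N powr b \<le> 2 * 2 ^ n" unfolding e .
  have "b * log 2 N \<le> 1 * log 2 N" using b l by (intro mult_right_mono) auto
  then show "n \<le> log 2 N" using n(1) by simp
qed

lemma log_square_powr_tendsto_0:
  assumes "\<eta> < 0"
  shows "(\<lambda>N::nat. (c * (log 2 (real N))\<^sup>2 + 1) * real N powr \<eta>) \<longlonglongrightarrow> 0"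
proof -
  have "((\<lambda>x::real. (c * (log 2 x)\<^sup>2 + 1) * x powr \<eta>) \<longlongrightarrow> 0) at_top"
    using assms by real_asymp
  then show ?thesis by (rule filterlim_compose[OF _ filterlim_real_sequentially])
qed

lemma powr_tendsto_0: "\<eta> < 0 \<Longrightarrow> (\<lambda>N::nat. real N powr \<eta>) \<longlonglongrightarrow> 0"
  using log_square_powr_tendsto_0[of \<eta> 0] by simp

text \<open>The coefficient of the entropy is bounded independently of N, and the remainder is
  \<open>U N\<close> times the target N^(d-2\<alpha>). The Burgers time N^(\<kappa>-\<alpha>) T lies
  below \<open>S\<close> for large N: it equals T if \<kappa> = \<alpha> and tends to 0
  otherwise.\<close>

lemma scales_exist:
  fixes \<alpha> \<kappa> C \<delta> E Q c T S :: real and d :: nat and G :: "nat \<Rightarrow> real"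
  assumes \<alpha>: "0 < \<alpha>" "\<alpha> < d / 2" and \<kappa>: "0 < \<kappa>" "\<kappa> \<le> \<alpha>"
    and d1: "d = 1 \<Longrightarrow> \<kappa> < 1 - 2 * \<alpha>" and d2: "d \<ge> 2 \<Longrightarrow> \<kappa> < 1"
    and pos: "\<delta> > 0" "E \<ge> 0" "Q \<ge> 0" and S: "S > 0" "\<kappa> = \<alpha> \<Longrightarrow> T \<le> S"
  defines "G \<equiv> \<lambda>n. (real (n * d))\<^sup>2 * (if d = 1 then 2 ^ n else 1 :: real)"
  obtains n :: "nat \<Rightarrow> nat" and U :: "nat \<Rightarrow> real"
  where "U \<longlonglongrightarrow> 0"
    and "\<forall>\<^sub>F N in sequentially. N \<ge> 2 \<and> 2 * 2 ^ n N + 2 \<le> N \<and> real N powr (- \<alpha>) * C \<le> \<delta>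
      \<and> E * real N powr (- \<alpha>) / N \<le> 1 \<and> real N powr (\<kappa> - \<alpha>) * T \<le> S
      \<and> 1 + N * real N powr \<kappa> * Q * ((E * real N powr (- \<alpha>) / N)\<^sup>2 * (G (n N) + 1) * (2 ^ n N) ^ d + E * real N powr (- \<alpha>) / N)
          \<le> 1 + Q * (E\<^sup>2 + E)
      \<and> 1 + (c * real N powr (- \<alpha>) * real N powr \<kappa> / N)\<^sup>2 * N ^ d
          + N * real N powr \<kappa> * Q * ((E * real N powr (- \<alpha>) / N)\<^sup>2 * (G (n N) + 1) * N ^ d + E * real N powr (- \<alpha>) / N * (N ^ d / (2 ^ n N) ^ d))
          \<le> U N * real N powr (d - 2 * \<alpha>)"
proof -
  define ch where "ch = (if d = 1 then 1 else 0 :: real)"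
  obtain b :: real where b: "0 < b" "b < 1" and e1: "\<kappa> + \<alpha> < b * d" and e2: "b * d + b * ch + \<kappa> - 1 - 2 * \<alpha> < 0"
    and e3: "\<kappa> - 1 + b * ch < 0"
    unfolding ch_def by (rule block_exponent_exists[OF \<alpha> \<kappa> d1 d2])
  define n where "n = (\<lambda>N::nat. nat \<lfloor>b * log 2 N\<rfloor>)"
  define Lg where "Lg = (\<lambda>N::nat. (real d)\<^sup>2 * (log 2 (real N))\<^sup>2 + 1)"
  \<comment> \<open>Each summand is one part of the remainder divided by N^(d-2\<alpha>): the
    additive constant 1, the linear Taylor error, the cost of the flow, and the products of cube
    averages, where \<open>2 ^ d\<close> pays for the rounding of the side.\<close>
  define U where "U = (\<lambda>N::nat. real N powr (2 * \<alpha> - d) + c\<^sup>2 * real N powr (2 * \<kappa> - 2)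
     + Q * E\<^sup>2 * (Lg N * real N powr (\<kappa> - 1 + b * ch)) + Q * E * 2 ^ d * real N powr (\<kappa> + \<alpha> - b * d))"
  have \<kappa>1: "\<kappa> < 1" using e3 b by (auto simp: ch_def split: if_splits)
  have lim: "U \<longlonglongrightarrow> 0"
  proof -
    have "U \<longlonglongrightarrow> 0 + c\<^sup>2 * 0 + Q * E\<^sup>2 * 0 + Q * E * 2 ^ d * 0"
      unfolding U_def Lg_def using \<alpha> \<kappa>1 e1 e3
      by (intro tendsto_add tendsto_mult tendsto_const powr_tendsto_0 log_square_powr_tendsto_0) auto
    then show ?thesis by simp
  qed
  have ev_b: "\<forall>\<^sub>F N in sequentially. 2 * real N powr b + 2 \<le> real N"
  proof -
    have "((\<lambda>x::real. (2 * x powr b + 2) / x) \<longlongrightarrow> 0) at_top" using b by real_asymp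
    then have "(\<lambda>N::nat. (2 * real N powr b + 2) / real N) \<longlonglongrightarrow> 0" by (rule filterlim_compose[OF _ filterlim_real_sequentially])
    then have "\<forall>\<^sub>F N::nat in sequentially. (2 * real N powr b + 2) / real N < 1" by (rule order_tendstoD) simp
    then show ?thesis using eventually_gt_at_top[of 0] by eventually_elim (simp add: divide_less_eq)
  qed
  have ev_C: "\<forall>\<^sub>F N::nat in sequentially. real N powr (- \<alpha>) * C < \<delta>"
    using \<alpha> pos by (intro order_tendstoD(2)[where y = 0] tendsto_mult_left_zero powr_tendsto_0) auto
  have ev_E: "\<forall>\<^sub>F N::nat in sequentially. E * real N powr (- \<alpha>) < 1"
    using \<alpha> by (intro order_tendstoD(2)[where y = 0] tendsto_mult_right_zero powr_tendsto_0) auto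
  have ev_T: "\<forall>\<^sub>F N::nat in sequentially. real N powr (\<kappa> - \<alpha>) * T \<le> S"
  proof (cases "\<kappa> = \<alpha>")
    case True
    show ?thesis by (rule eventually_mono[OF eventually_gt_at_top[of 0]]) (use True S(2) in simp)
  next
    case False
    then have "\<forall>\<^sub>F N::nat in sequentially. real N powr (\<kappa> - \<alpha>) * T < S"
      using \<kappa> S by (intro order_tendstoD(2)[where y = 0] tendsto_mult_left_zero powr_tendsto_0) auto
    then show ?thesis by (rule eventually_mono) simp
  qed
  have ev_L: "\<forall>\<^sub>F N::nat in sequentially. Lg N * real N powr (b * d + b * ch + \<kappa> - 1 - 2 * \<alpha>) < 1"
    unfolding Lg_def using e2 by (intro order_tendstoD(2)[where y = 0] log_square_powr_tendsto_0) auto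
  have "\<forall>\<^sub>F N in sequentially. N \<ge> 2 \<and> 2 * 2 ^ n N + 2 \<le> N \<and> real N powr (- \<alpha>) * C \<le> \<delta>
      \<and> E * real N powr (- \<alpha>) / N \<le> 1 \<and> real N powr (\<kappa> - \<alpha>) * T \<le> S
      \<and> 1 + N * real N powr \<kappa> * Q * ((E * real N powr (- \<alpha>) / N)\<^sup>2 * (G (n N) + 1) * (2 ^ n N) ^ d + E * real N powr (- \<alpha>) / N)
          \<le> 1 + Q * (E\<^sup>2 + E)
      \<and> 1 + (c * real N powr (- \<alpha>) * real N powr \<kappa> / N)\<^sup>2 * N ^ d
          + N * real N powr \<kappa> * Q * ((E * real N powr (- \<alpha>) / N)\<^sup>2 * (G (n N) + 1) * N ^ d + E * real N powr (- \<alpha>) / N * (N ^ d / (2 ^ n N) ^ d))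
          \<le> U N * real N powr (d - 2 * \<alpha>)"
    using ev_b ev_C ev_E ev_T ev_L eventually_ge_at_top[of 2]
  proof eventually_elim
    case (elim N)
    \<comment> \<open>Every power of N is expressed through these quantities, so that comparing
      exponents becomes rational algebra.\<close>
    define x y w z zc L where "x = real N" and "y = real N powr \<alpha>" and "w = real N powr \<kappa>" and "z = real N powr b"
      and "zc = real N powr (b * ch)" and "L = (2 ^ n N :: real)"
    have x: "x \<ge> 2" using elim by (simp add: x_def)
    have p: "x > 0" "y > 0" "w > 0" "z > 0" "zc > 0" "L > 0" using x by (auto simp: x_def y_def w_def z_def zc_def L_def)
    have ds: "L \<le> z" "z \<le> 2 * L" "real (n N) \<le> log 2 N"
      using dyadic_scale[OF b elim(6)] by (auto simp: n_def L_def z_def)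
    have zc: "zc = (if d = 1 then z else 1)" using x by (simp add: zc_def ch_def z_def x_def)
    have xp: "x powr (real k) = x ^ k" for k using p by (simp add: powr_realpow)
    have P: "real N powr (- \<alpha>) = 1 / y" "real N powr (d - 2 * \<alpha>) = x ^ d / y\<^sup>2" "real N powr (2 * \<alpha> - d) = y\<^sup>2 / x ^ d"
      "real N powr (2 * \<kappa> - 2) = w\<^sup>2 / x\<^sup>2" "real N powr (\<kappa> - 1 + b * ch) = w * zc / x"
      "real N powr (\<kappa> + \<alpha> - b * d) = w * y / z ^ d"
      "real N powr (b * d + b * ch + \<kappa> - 1 - 2 * \<alpha>) = z ^ d * zc * w / (x * y\<^sup>2)"
    proof -
      have y2: "real N powr (2 * \<alpha>) = y\<^sup>2" "real N powr (2 * \<kappa>) = w\<^sup>2"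
        using p by (simp_all add: y_def w_def powr_power mult.commute)
      have zd: "real N powr (b * d) = z ^ d" using p by (simp add: z_def powr_power mult.commute)
      have xd: "real N powr real d = x ^ d" "real N powr 2 = x\<^sup>2" "real N powr 1 = x"
        using p xp[of d] xp[of 2] by (simp_all add: x_def)
      show "real N powr (- \<alpha>) = 1 / y" by (simp add: y_def powr_minus_divide)
      show "real N powr (d - 2 * \<alpha>) = x ^ d / y\<^sup>2" "real N powr (2 * \<alpha> - d) = y\<^sup>2 / x ^ d"
        "real N powr (2 * \<kappa> - 2) = w\<^sup>2 / x\<^sup>2" "real N powr (\<kappa> - 1 + b * ch) = w * zc / x"
        "real N powr (\<kappa> + \<alpha> - b * d) = w * y / z ^ d"
        "real N powr (b * d + b * ch + \<kappa> - 1 - 2 * \<alpha>) = z ^ d * zc * w / (x * y\<^sup>2)"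
        unfolding powr_add powr_diff y2 zd xd y_def[symmetric] w_def[symmetric] zc_def[symmetric]
        by simp_all
    qed
    have wy: "w \<le> y" unfolding w_def y_def using \<kappa> x by (intro powr_mono) (auto simp: x_def)
    have G1: "0 \<le> G (n N) + 1" "G (n N) + 1 \<le> Lg N * zc"
    proof -
      have z1: "1 \<le> zc" unfolding zc_def using b x by (intro ge_one_powr_ge_zero) (auto simp: x_def ch_def)
      have "(real (n N))\<^sup>2 \<le> (log 2 N)\<^sup>2" using ds(3) by (intro power_mono) auto
      then have "(real (n N * d))\<^sup>2 \<le> (real d)\<^sup>2 * (log 2 N)\<^sup>2"
        by (simp add: power_mult_distrib mult.commute mult_left_mono)
      moreover have "(if d = 1 then 2 ^ n N else 1 :: real) \<le> zc" using ds(1) by (simp add: zc L_def)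
      ultimately have "G (n N) \<le> ((real d)\<^sup>2 * (log 2 N)\<^sup>2) * zc" unfolding G_def by (intro mult_mono) auto
      then show "G (n N) + 1 \<le> Lg N * zc" using z1 by (simp add: Lg_def distrib_right)
      show "0 \<le> G (n N) + 1" by (simp add: G_def)
    qed
    have Ld: "L ^ d \<le> z ^ d" using ds p by (intro power_mono) auto
    have Lginv: "1 / L ^ d \<le> 2 ^ d / z ^ d"
    proof -
      have "z ^ d \<le> (2 * L) ^ d" using ds p by (intro power_mono) auto
      then show ?thesis using p by (simp add: divide_simps power_mult_distrib mult.commute)
    qed
    have s1: "2 * 2 ^ n N + 2 \<le> N"
    proof -
      have "2 * L + 2 \<le> real N" using elim(1) ds(1) by (simp add: z_def)
      then have "real (2 * 2 ^ n N + 2) \<le> real N" by (simp add: L_def)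
      then show ?thesis by (simp only: of_nat_le_iff)
    qed
    have s2: "E * real N powr (- \<alpha>) / N \<le> 1"
    proof -
      have "E * real N powr (- \<alpha>) / N \<le> E * real N powr (- \<alpha>) / 1"
        using pos elim(6) by (intro divide_left_mono) auto
      then show ?thesis using elim(3) by simp
    qed
    have sB: "1 + N * real N powr \<kappa> * Q * ((E * real N powr (- \<alpha>) / N)\<^sup>2 * (G (n N) + 1) * (2 ^ n N) ^ d + E * real N powr (- \<alpha>) / N)
          \<le> 1 + Q * (E\<^sup>2 + E)"
    proof -
      have "N * real N powr \<kappa> * Q * ((E * real N powr (- \<alpha>) / N)\<^sup>2 * (G (n N) + 1) * (2 ^ n N) ^ d + E * real N powr (- \<alpha>) / N)
        = Q * (E\<^sup>2 * (w / (x * y\<^sup>2) * ((G (n N) + 1) * L ^ d)) + E * (w / y))"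
        unfolding P(1) w_def[symmetric] L_def[symmetric] unfolding x_def[symmetric] using p by (simp add: field_simps power2_eq_square)
      also have "\<dots> \<le> Q * (E\<^sup>2 * 1 + E * 1)"
      proof (intro mult_left_mono add_mono)
        have "w / (x * y\<^sup>2) * ((G (n N) + 1) * L ^ d) \<le> w / (x * y\<^sup>2) * ((Lg N * zc) * z ^ d)"
          using p G1 Ld by (intro mult_left_mono mult_mono) auto
        also have "\<dots> = Lg N * (z ^ d * zc * w / (x * y\<^sup>2))" by simp
        also have "\<dots> \<le> 1" using elim(5) unfolding P(7) by simp
        finally show "w / (x * y\<^sup>2) * ((G (n N) + 1) * L ^ d) \<le> 1" .
        show "w / y \<le> 1" using wy p by simp
      qed (use pos in auto)
      finally show ?thesis by simp
    qed
    have sR: "1 + (c * real N powr (- \<alpha>) * real N powr \<kappa> / N)\<^sup>2 * N ^ d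
          + N * real N powr \<kappa> * Q * ((E * real N powr (- \<alpha>) / N)\<^sup>2 * (G (n N) + 1) * N ^ d + E * real N powr (- \<alpha>) / N * (N ^ d / (2 ^ n N) ^ d))
          \<le> U N * real N powr (d - 2 * \<alpha>)"
    proof -
      let ?X = "x ^ d / y\<^sup>2"
      have X: "?X \<ge> 0" using p by simp
      have "1 + (c * real N powr (- \<alpha>) * real N powr \<kappa> / N)\<^sup>2 * N ^ d
          + N * real N powr \<kappa> * Q * ((E * real N powr (- \<alpha>) / N)\<^sup>2 * (G (n N) + 1) * N ^ d + E * real N powr (- \<alpha>) / N * (N ^ d / (2 ^ n N) ^ d))
        = (y\<^sup>2 / x ^ d + c\<^sup>2 * (w\<^sup>2 / x\<^sup>2) + Q * E\<^sup>2 * (w / x * (G (n N) + 1)) + Q * E * (w * y * (1 / L ^ d))) * ?X"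
        unfolding P(1) w_def[symmetric] L_def[symmetric] of_nat_power unfolding x_def[symmetric] using p by (simp add: field_simps power2_eq_square)
      also have "\<dots> \<le> (y\<^sup>2 / x ^ d + c\<^sup>2 * (w\<^sup>2 / x\<^sup>2) + Q * E\<^sup>2 * (w / x * (Lg N * zc)) + Q * E * (w * y * (2 ^ d / z ^ d))) * ?X"
        using p pos G1 Lginv by (intro mult_right_mono[OF _ X] add_mono mult_left_mono order_refl) auto
      also have "\<dots> = U N * real N powr (d - 2 * \<alpha>)"
        unfolding U_def P by (simp add: mult_ac)
      finally show ?thesis .
    qed
    show ?case using s1 s2 sB sR elim by simp
  qed
  then show ?thesis using that[OF lim] by blast
qed

section \<open>Deviations, the mixed initial law and the limit\<close>

text \<open>Chebyshev's inequality, the second moment being controlled by the entropy through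
  \<open>sum_centred_squares\<close> with a single functional.\<close>

lemma (in binomial_product) deviation_bound:
  fixes \<psi> :: "'v \<Rightarrow> real" and M \<theta> :: real
  assumes u0: "\<And>\<eta>. \<eta> \<in> \<Omega> \<Longrightarrow> u \<eta> \<ge> 0" and u1: "(\<Sum>\<eta>\<in>\<Omega>. u \<eta>) = 1"
    and M: "\<And>x. x \<in> V \<Longrightarrow> \<bar>\<psi> x\<bar> \<le> M" and \<theta>: "\<theta> > 0"
  shows "(\<Sum>\<eta>\<in>{\<eta> \<in> \<Omega>. \<bar>centred V r \<psi> \<eta>\<bar> > \<theta>}. u \<eta>) \<le> K\<^sup>2 * (M\<^sup>2 * card V) * (ent \<Omega> u \<nu> + 1) / \<theta>\<^sup>2"
proof -
  let ?A = "{\<eta> \<in> \<Omega>. \<bar>centred V r \<psi> \<eta>\<bar> > \<theta>}"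
  have "\<theta>\<^sup>2 * (\<Sum>\<eta>\<in>?A. u \<eta>) = (\<Sum>\<eta>\<in>?A. u \<eta> * \<theta>\<^sup>2)" by (simp add: sum_distrib_left mult.commute)
  also have "\<dots> \<le> (\<Sum>\<eta>\<in>?A. u \<eta> * (centred V r \<psi> \<eta>)\<^sup>2)"
  proof (intro sum_mono mult_left_mono)
    fix \<eta> assume \<eta>: "\<eta> \<in> ?A"
    then show "0 \<le> u \<eta>" using u0 by auto
    have "\<theta>\<^sup>2 \<le> \<bar>centred V r \<psi> \<eta>\<bar>\<^sup>2" using \<eta> \<theta> by (intro power_mono) auto
    then show "\<theta>\<^sup>2 \<le> (centred V r \<psi> \<eta>)\<^sup>2" by simp
  qed
  also have "\<dots> \<le> (\<Sum>\<eta>\<in>\<Omega>. u \<eta> * (\<Sum>z\<in>{()}. (centred V r \<psi> \<eta>)\<^sup>2))"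
    using finite_\<Omega> u0 by (simp, intro sum_mono2) auto
  also have "\<dots> \<le> K\<^sup>2 * (M\<^sup>2 * card V) * (1 * ent \<Omega> u \<nu> + card {()})"
  proof (rule order_trans[OF sum_centred_squares[where u = u and a = "\<lambda>_. \<psi>" and Z = "{()}" and m = 1 and s = "M\<^sup>2 * card V"]])
    have "(\<Sum>x\<in>V. (\<psi> x)\<^sup>2) \<le> (\<Sum>x\<in>V. M\<^sup>2)"
    proof (rule sum_mono)
      fix x assume "x \<in> V"
      then have "\<bar>\<psi> x\<bar>\<^sup>2 \<le> M\<^sup>2" using M by (intro power_mono) auto
      then show "(\<psi> x)\<^sup>2 \<le> M\<^sup>2" by simp
    qed
    then show "(\<Sum>x\<in>V. (\<psi> x)\<^sup>2) \<le> M\<^sup>2 * card V" by (simp add: mult.commute)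
    show "card {z \<in> {()}. \<psi> x \<noteq> 0} \<le> 1" for x by (rule order_trans[OF card_mono[of "{()}"]]) auto
  qed (use u0 u1 in auto)
  finally have "\<theta>\<^sup>2 * (\<Sum>\<eta>\<in>?A. u \<eta>) \<le> K\<^sup>2 * (M\<^sup>2 * card V) * (ent \<Omega> u \<nu> + 1)" by simp
  then show ?thesis using \<theta> by (simp add: pos_le_divide_eq mult.commute)
qed

lemma rel_entropy_eq_ent:
  assumes "\<And>\<eta>. \<eta> \<in> S \<Longrightarrow> pmf \<nu> \<eta> > 0"
  shows "rel_entropy S M \<nu> = ent S (\<lambda>\<eta>. measure M {\<eta>}) (pmf \<nu>)"
  unfolding rel_entropy_def ent_def Let_def
proof (rule sum.cong[OF refl])
  fix \<eta> assume "\<eta> \<in> S"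
  from assms[OF this] show "measure M {\<eta>} / pmf \<nu> \<eta> * ln (measure M {\<eta>} / pmf \<nu> \<eta>) * pmf \<nu> \<eta>
      = measure M {\<eta>} * ln (measure M {\<eta>} / pmf \<nu> \<eta>)" by simp
qed

lemma xlnx_tangent:
  fixes f y :: real
  assumes "f \<ge> 0" "y > 0"
  shows "y * ln y + (ln y + 1) * (f - y) \<le> f * ln f"
proof (cases "f = 0")
  case True
  then show ?thesis using assms by (simp add: algebra_simps)
next
  case False
  then have f: "f > 0" using assms by simp
  have "ln (y / f) \<le> y / f - 1" using f assms by (intro ln_le_minus_one) simp
  then have "f * (ln y - ln f) \<le> f * (y / f - 1)" using f assms by (intro mult_left_mono) (auto simp: ln_div)
  then show ?thesis using f by (simp add: algebra_simps)
qed

text \<open>The tangent of \<open>x * ln x\<close> at the midpoint \<open>y\<close> of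
  \<open>f\<close> and 1 is evaluated at these two points: the linear terms cancel in the sum and
  \<open>1 * ln 1\<close> is 0.\<close>

lemma ent_mixture_le:
  fixes u v :: "'s \<Rightarrow> real"
  assumes u: "\<And>\<eta>. \<eta> \<in> S \<Longrightarrow> u \<eta> \<ge> 0" and v: "\<And>\<eta>. \<eta> \<in> S \<Longrightarrow> v \<eta> > 0"
  shows "ent S (\<lambda>\<eta>. (u \<eta> + v \<eta>) / 2) v \<le> ent S u v / 2"
  unfolding ent_def sum_divide_distrib
proof (rule sum_mono)
  fix \<eta> assume \<eta>: "\<eta> \<in> S"
  define f y where "f = u \<eta> / v \<eta>" and "y = (f + 1) / 2"
  have f: "f \<ge> 0" "u \<eta> = f * v \<eta>" using u[OF \<eta>] v[OF \<eta>] by (auto simp: f_def)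
  have y: "y > 0" using f by (simp add: y_def)
  have "y * ln y + (ln y + 1) * (f - y) \<le> f * ln f" "y * ln y + (ln y + 1) * (1 - y) \<le> 1 * ln 1"
    by (intro xlnx_tangent f y zero_le_one)+
  moreover have "(f - y) = - (1 - y)" unfolding y_def by (simp add: field_simps)
  ultimately have "2 * (y * ln y) \<le> f * ln f" by (simp add: algebra_simps)
  then have "v \<eta> * (2 * (y * ln y)) \<le> v \<eta> * (f * ln f)" using v[OF \<eta>] by (intro mult_left_mono) auto
  moreover have "(u \<eta> + v \<eta>) / 2 = y * v \<eta>" by (simp add: f(2) y_def field_simps)
  ultimately show "(u \<eta> + v \<eta>) / 2 * ln ((u \<eta> + v \<eta>) / 2 / v \<eta>) \<le> u \<eta> * ln (u \<eta> / v \<eta>) / 2"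
    using v[OF \<eta>] f(2) by (simp add: mult_ac)
qed

lemma evolve_half:
  assumes "\<And>\<xi>. \<xi> \<in> S \<Longrightarrow> v \<xi> \<ge> 0"
  shows "evolve S P u t \<eta> \<le> 2 * evolve S P (\<lambda>\<xi>. (u \<xi> + v \<xi>) / 2) t \<eta>"
  unfolding evolve_def sum_distrib_left
proof (rule sum_mono)
  fix \<xi> assume "\<xi> \<in> S"
  then have "0 \<le> v \<xi> * pmf (P t \<xi>) \<eta>" using assms by simp
  then show "u \<xi> * pmf (P t \<xi>) \<eta> \<le> 2 * ((u \<xi> + v \<xi>) / 2 * pmf (P t \<xi>) \<eta>)" by (simp add: distrib_right)
qed

lemma product_binomial_pmf:
  "pmf (product_binomial K N f) = binom_weight K (sites N) (\<lambda>x. f (rescale N x))"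
  by (simp add: product_binomial_def binom_weight_def)

lemma configs_eq_confs: "configs K N = confs K (sites N)"
  by (simp add: configs_def confs_def)

text \<open>The time \<open>s N\<close> is first replaced by its limit, uniformly in the position,
  and then the Riemann sum of a fixed function converges uniformly in the shift; each error takes
  half of \<open>e\<close>.\<close>

lemma profile_sum_limit:
  fixes \<rho> :: "real \<Rightarrow> real ^ 'd::finite \<Rightarrow> real" and s :: "nat \<Rightarrow> real" and S s' e :: real
  assumes c: "continuous_on ({0..S} \<times> UNIV) (\<lambda>(s, u). \<rho> s u)"
    and per: "\<And>s. s \<in> {0..S} \<Longrightarrow> torus_periodic (\<rho> s)" and \<phi>: "torus_continuous \<phi>"
    and s: "s \<longlonglongrightarrow> s'" and sS: "\<forall>\<^sub>F N in sequentially. s N \<in> {0..S}" and s': "s' \<in> {0..S}" and e: "e > 0"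
  shows "\<forall>\<^sub>F N in sequentially. \<forall>v. \<bar>(\<Sum>x\<in>sites N. \<rho> (s N) (rescale N x - v) * \<phi> (rescale N x - v)) / N ^ CARD('d)
     - torus_integral (\<lambda>u. \<rho> s' u * \<phi> u)\<bar> \<le> e"
proof -
  obtain M where M: "M > 0" "\<And>u. \<bar>\<phi> u\<bar> \<le> M" using torus_periodic_bounded[OF \<phi>] by blast
  have "continuous_on UNIV (\<lambda>u. (\<lambda>(s, u). \<rho> s u) (s', u))"
    by (rule continuous_on_compose2[OF c]) (use s' in \<open>auto intro!: continuous_intros\<close>)
  then have g: "torus_continuous (\<lambda>u. \<rho> s' u * \<phi> u)"
    using \<phi> per[OF s'] unfolding torus_continuous_def torus_periodic_def by (auto intro!: continuous_on_mult)
  have eM: "e / (2 * M) > 0" using e M by simp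
  obtain \<delta> where \<delta>: "\<delta> > 0" "\<And>s s' u v. s \<in> {0..S} \<Longrightarrow> s' \<in> {0..S} \<Longrightarrow> \<bar>s - s'\<bar> < \<delta> \<Longrightarrow> (\<forall>i. \<bar>v $ i\<bar> < \<delta>) \<Longrightarrow> \<bar>\<rho> s (u + v) - \<rho> s' u\<bar> < e / (2 * M)"
    by (rule torus_uniformly_continuous[OF c _ per eM]) auto
  have "\<forall>\<^sub>F N in sequentially. dist (s N) s' < \<delta>" using s \<delta>(1) by (rule tendstoD)
  then show ?thesis
    using sS shifted_riemann_sum[OF g half_gt_zero[OF e]] eventually_gt_at_top[of 0]
  proof eventually_elim
    case (elim N)
    show ?case
    proof
      fix v :: "real ^ 'd"
      let ?y = "\<lambda>x. rescale N x - v"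
      have Np: "real N ^ CARD('d) > 0" using elim by simp
      have "\<bar>(\<Sum>x\<in>sites N. \<rho> (s N) (?y x) * \<phi> (?y x)) - (\<Sum>x\<in>sites N. \<rho> s' (?y x) * \<phi> (?y x))\<bar>
         \<le> (\<Sum>x\<in>(sites N :: (int ^ 'd) set). e / 2)"
        unfolding sum_subtractf[symmetric]
      proof (rule order_trans[OF sum_abs], rule sum_mono)
        fix x :: "int ^ 'd"
        have "\<bar>\<rho> (s N) (?y x + 0) - \<rho> s' (?y x)\<bar> < e / (2 * M)"
          using elim s' \<delta>(1) by (intro \<delta>(2)) (auto simp: dist_real_def)
        then have "\<bar>\<rho> (s N) (?y x) - \<rho> s' (?y x)\<bar> * \<bar>\<phi> (?y x)\<bar> \<le> e / (2 * M) * M"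
          using M e by (intro mult_mono) auto
        then show "\<bar>\<rho> (s N) (?y x) * \<phi> (?y x) - \<rho> s' (?y x) * \<phi> (?y x)\<bar> \<le> e / 2"
          using M(1) by (simp add: left_diff_distrib[symmetric] abs_mult)
      qed
      also have "\<dots> = e / 2 * real N ^ CARD('d)" by (simp add: card_sites)
      finally have "\<bar>(\<Sum>x\<in>sites N. \<rho> (s N) (?y x) * \<phi> (?y x)) - (\<Sum>x\<in>sites N. \<rho> s' (?y x) * \<phi> (?y x))\<bar> / real N ^ CARD('d) \<le> e / 2"
        using Np by (simp only: pos_divide_le_eq)
      then have "\<bar>(\<Sum>x\<in>sites N. \<rho> (s N) (?y x) * \<phi> (?y x)) / real N ^ CARD('d) - (\<Sum>x\<in>sites N. \<rho> s' (?y x) * \<phi> (?y x)) / real N ^ CARD('d)\<bar> \<le> e / 2"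
        using Np by (simp add: diff_divide_distrib[symmetric])
      moreover have "\<bar>(\<Sum>x\<in>sites N. \<rho> s' (?y x) * \<phi> (?y x)) / N ^ CARD('d) - torus_integral (\<lambda>u. \<rho> s' u * \<phi> u)\<bar> \<le> e / 2"
        using elim by blast
      ultimately show "\<bar>(\<Sum>x\<in>sites N. \<rho> (s N) (?y x) * \<phi> (?y x)) / N ^ CARD('d) - torus_integral (\<lambda>u. \<rho> s' u * \<phi> u)\<bar> \<le> e"
        unfolding of_nat_power by linarith
    qed
  qed
qed

theorem theorem2p2:
  fixes K :: nat
    and p :: "'d::finite + 'd \<Rightarrow> real"
    and \<rho>s \<alpha> \<kappa> lam T S :: real
    and m :: "real ^ 'd"
    and \<rho>ini :: "real ^ 'd \<Rightarrow> real"
    and \<rho> :: "real \<Rightarrow> real ^ 'd \<Rightarrow> real"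
    and M :: "nat \<Rightarrow> 'a measure"
    and X :: "nat \<Rightarrow> real \<Rightarrow> 'a \<Rightarrow> (int ^ 'd \<Rightarrow> nat)"
    and \<mu> :: "nat \<Rightarrow> real \<Rightarrow> (int ^ 'd \<Rightarrow> nat) measure"
    and \<nu> :: "nat \<Rightarrow> real \<Rightarrow> (int ^ 'd \<Rightarrow> nat) pmf"
    and H :: "nat \<Rightarrow> real \<Rightarrow> real"
  assumes K: "K > 0"
    and p_nonneg: "\<And>i. p i \<ge> 0"
    and p_pos: "\<And>i. p (Inl i) + p (Inr i) > 0"
    and m_def: "m = drift p"
    and m_nonzero: "m \<noteq> 0"
    and \<rho>s: "\<rho>s \<in> {0<..<real K}"
    and lam_def: "lam = real K - 2 * \<rho>s"
    and \<rho>ini: "torus_smooth \<rho>ini"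
    and \<alpha>: "0 < \<alpha>" "\<alpha> < real CARD('d) / 2"
    and \<kappa>: "0 < \<kappa>" "\<kappa> \<le> \<alpha>"
    and \<kappa>_d1: "CARD('d) = 1 \<Longrightarrow> \<kappa> < 1 - 2 * \<alpha>"
    and \<kappa>_d2: "CARD('d) \<ge> 2 \<Longrightarrow> \<kappa> < 1"
    and T: "T > 0"
    and S: "S > 0" "\<kappa> = \<alpha> \<Longrightarrow> T \<le> S"
    and burgers: "smooth_burgers_solution m \<rho>ini S \<rho>"
    and process: "\<And>N. N \<ge> 1 \<Longrightarrow>
          markov_process (configs K N)
            (\<lambda>f \<eta>. real N powr (1 + \<kappa>) * generator p K N f \<eta>) (M N) (X N)"
    and \<mu>_def: "\<And>N t. N \<ge> 1 \<Longrightarrow> t \<ge> 0 \<Longrightarrow>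
          \<mu> N t = distr (M N) (count_space (configs K N)) (X N t)"
    and initial_profile: "\<And>\<phi> \<epsilon>. torus_continuous \<phi> \<Longrightarrow> \<epsilon> > 0 \<Longrightarrow>
          (\<lambda>N. measure (\<mu> N 0) {\<eta> \<in> configs K N.
             \<bar>1 / real N powr (real CARD('d) - \<alpha>) *
                 (\<Sum>x\<in>sites N. (real (\<eta> x) - \<rho>s) * \<phi> (rescale N x))
               - torus_integral (\<lambda>u. \<rho>ini u * \<phi> u)\<bar> > \<epsilon>}) \<longlonglongrightarrow> 0"
    and \<nu>_def: "\<And>N t. \<nu> N t = product_binomial K N (perturbed_profile m lam \<rho>s \<alpha> \<kappa> \<rho> N t)"
    and H_def: "\<And>N t. H N t = rel_entropy (configs K N) (\<mu> N t) (\<nu> N t)"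
    and initial_entropy: "(\<lambda>N. H N 0) \<in> o(\<lambda>N. real N powr (real CARD('d) - 2 * \<alpha>))"
  shows "\<forall>t\<in>{0..T}. \<forall>\<phi>. torus_continuous \<phi> \<longrightarrow> (\<forall>\<epsilon>>0.
          (\<lambda>N. measure (\<mu> N t) {\<eta> \<in> configs K N.
             \<bar>1 / real N powr (real CARD('d) - \<alpha>) *
                 (\<Sum>x\<in>sites N. (real (\<eta> x) - \<rho>s) *
                    \<phi> (rescale N x - (real N powr \<kappa> * lam * t) *\<^sub>R m))
               - torus_integral (\<lambda>u. (if \<kappa> < \<alpha> then \<rho>ini u else \<rho> t u) * \<phi> u)\<bar> > \<epsilon>})
          \<longlonglongrightarrow> 0)"
proof (intro ballI allI impI)
  fix t :: real and \<phi> :: "real ^ 'd \<Rightarrow> real" and e :: real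
  assume t: "t \<in> {0..T}" and \<phi>: "torus_continuous \<phi>" and e: "e > 0"
  let ?d = "CARD('d)" and ?V = "\<lambda>N. sites N :: (int ^ 'd) set" and ?\<Omega> = "\<lambda>N. confs K (sites N :: (int ^ 'd) set)"
  have sm: "smooth_on ({0..S} \<times> UNIV) (\<lambda>(s, u). \<rho> s u)" and per: "\<And>s. s \<in> {0..S} \<Longrightarrow> torus_periodic (\<rho> s)"
    and init: "\<And>u. \<rho> 0 u = \<rho>ini u" using burgers unfolding smooth_burgers_solution_def by blast+
  have cont: "continuous_on ({0..S} \<times> UNIV) (\<lambda>(s, u). \<rho> s u)"
    using sm unfolding smooth_on_def by (metis Ck_on.simps(1))
  obtain g C where pb: "profile_bounds m S \<rho> g C" using burgers_profile_bounds[OF burgers S(1)] by blast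
  have C: "C > 0" using pb by (simp add: profile_bounds_def)
  \<comment> \<open>Half the distance of \<open>\<rho>s\<close> from 0 and K: a perturbation of size
    at most \<delta> leaves the margin \<delta>.\<close>
  define \<delta> where "\<delta> = min \<rho>s (K - \<rho>s) / 2"
  have \<delta>: "\<delta> > 0" "2 * \<delta> \<le> \<rho>s" "\<rho>s \<le> K - 2 * \<delta>" using \<rho>s by (auto simp: \<delta>_def min_def)
  \<comment> \<open>Positivity of the sum makes at least one of the two rates of each axis positive,
    hence the minimum over the maxima.\<close>
  define p0 where "p0 = Min (range (\<lambda>j. max (p (Inl j)) (p (Inr j))))"
  have p0: "p0 > 0" "\<And>j. p (Inl j) \<ge> p0 \<or> p (Inr j) \<ge> p0"
  proof -
    have "max (p (Inl j)) (p (Inr j)) > 0" for j using p_pos[of j] p_nonneg[of "Inl j"] p_nonneg[of "Inr j"] by linarith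
    then show "p0 > 0" unfolding p0_def by (subst Min_gr_iff) auto
    have "p0 \<le> max (p (Inl j)) (p (Inr j))" for j unfolding p0_def by (rule Min_le) auto
    then show "p (Inl j) \<ge> p0 \<or> p (Inr j) \<ge> p0" for j by (auto simp: le_max_iff_disj)
  qed
  define E where "E = C + K * C / \<delta>\<^sup>2"
  define PP where "PP = (\<Sum>i\<in>UNIV. p i)"
  define Q where "Q = production_constant K p p0"
  define c where "c = real (K\<^sup>2) * (K * PP * C) / \<delta>\<^sup>2"
  define G where "G = (\<lambda>n. (real (n * ?d))\<^sup>2 * (if ?d = 1 then 2 ^ n else 1 :: real))"
  have E: "E \<ge> 0" using C \<delta> by (simp add: E_def)
  have Q: "Q \<ge> 0" unfolding Q_def by (rule production_constant_nonneg[OF p0(1)])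
  obtain n U where U: "U \<longlonglongrightarrow> 0" and scales: "\<forall>\<^sub>F N in sequentially. N \<ge> 2 \<and> 2 * 2 ^ n N + 2 \<le> N \<and> real N powr (- \<alpha>) * C \<le> \<delta>
      \<and> E * real N powr (- \<alpha>) / N \<le> 1 \<and> real N powr (\<kappa> - \<alpha>) * T \<le> S
      \<and> 1 + N * real N powr \<kappa> * Q * ((E * real N powr (- \<alpha>) / N)\<^sup>2 * (G (n N) + 1) * (2 ^ n N) ^ ?d + E * real N powr (- \<alpha>) / N)
          \<le> 1 + Q * (E\<^sup>2 + E)
      \<and> 1 + (c * real N powr (- \<alpha>) * real N powr \<kappa> / N)\<^sup>2 * N ^ ?d
          + N * real N powr \<kappa> * Q * ((E * real N powr (- \<alpha>) / N)\<^sup>2 * (G (n N) + 1) * N ^ ?d + E * real N powr (- \<alpha>) / N * (N ^ ?d / (2 ^ n N) ^ ?d))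
          \<le> U N * real N powr (?d - 2 * \<alpha>)"
    unfolding G_def by (rule scales_exist[OF \<alpha> \<kappa> \<kappa>_d1 \<kappa>_d2 \<delta>(1) E Q S, of C c])
  define B where "B = 1 + Q * (E\<^sup>2 + E)"
  obtain M\<phi> where M\<phi>: "M\<phi> > 0" "\<And>u. \<bar>\<phi> u\<bar> \<le> M\<phi>" using torus_periodic_bounded[OF \<phi>] by blast
  \<comment> \<open>The limit of the Burgers time N^(\<kappa>-\<alpha>) t. With it the two regimes
    become one, since \<rho> at time 0 is the initial profile.\<close>
  define s' where "s' = (if \<kappa> < \<alpha> then 0 else t)"
  have \<rho>': "(if \<kappa> < \<alpha> then \<rho>ini u else \<rho> t u) = \<rho> s' u" for u by (simp add: s'_def init)
  define I where "I = torus_integral (\<lambda>u. \<rho> s' u * \<phi> u)"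
  define v where "v = (\<lambda>N. (real N powr \<kappa> * lam * t) *\<^sub>R m)"
  define s where "s = (\<lambda>N. real N powr (\<kappa> - \<alpha>) * t)"
  have s'S: "s' \<in> {0..S}" using S t \<kappa> by (auto simp: s'_def)
  have s_lim: "s \<longlonglongrightarrow> s'"
  proof (cases "\<kappa> < \<alpha>")
    case True
    then show ?thesis unfolding s_def s'_def by (auto intro!: tendsto_mult_left_zero powr_tendsto_0)
  next
    case False
    then have "\<kappa> = \<alpha>" using \<kappa> by simp
    then have "\<forall>\<^sub>F N in sequentially. s N = s'"
      unfolding s_def s'_def by (intro eventually_mono[OF eventually_gt_at_top[of 0]]) simp
    then show ?thesis by (rule tendsto_eventually)
  qed
  have s_in: "\<forall>\<^sub>F N in sequentially. s N \<in> {0..S}"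
    using scales
  proof eventually_elim
    case (elim N)
    have "real N powr (\<kappa> - \<alpha>) * t \<le> real N powr (\<kappa> - \<alpha>) * T" using t by (intro mult_left_mono) auto
    also have "\<dots> \<le> S" using elim by blast
    finally show ?case using t unfolding s_def by auto
  qed
  have riemann: "\<forall>\<^sub>F N in sequentially. \<forall>v. \<bar>(\<Sum>x\<in>sites N. \<rho> (s N) (rescale N x - v) * \<phi> (rescale N x - v)) / N ^ ?d - I\<bar> \<le> e / 2"
    unfolding I_def by (rule profile_sum_limit[OF cont _ \<phi> s_lim s_in s'S half_gt_zero[OF e]]) (rule per)
  \<comment> \<open>The factor 8 is 2, for the domination by the mixture, times 4, from squaring the
    threshold \<open>e / 2\<close>.\<close>
  define c1 where "c1 = 8 * K\<^sup>2 * M\<phi>\<^sup>2 / e\<^sup>2"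
  define bnd where "bnd = (\<lambda>N. c1 * (exp (B * T) * (\<bar>H N 0\<bar> / real N powr (?d - 2 * \<alpha>) + U N) + real N powr (2 * \<alpha> - ?d)))"
  have "(\<lambda>N. H N 0 / real N powr (?d - 2 * \<alpha>)) \<longlonglongrightarrow> 0"
    using initial_entropy by (rule smalloD_tendsto)
  then have "bnd \<longlonglongrightarrow> c1 * (exp (B * T) * (\<bar>0\<bar> + 0) + 0)"
    unfolding bnd_def using \<alpha>
    by (intro tendsto_intros U powr_tendsto_0) (auto simp: abs_divide[symmetric] dest: tendsto_rabs)
  then have bnd: "bnd \<longlonglongrightarrow> 0" by simp
  define Bad where "Bad = (\<lambda>N. {\<eta> \<in> configs K N.
             \<bar>1 / real N powr (real ?d - \<alpha>) *
                 (\<Sum>x\<in>sites N. (real (\<eta> x) - \<rho>s) * \<phi> (rescale N x - v N)) - I\<bar> > e})"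
  have main: "\<forall>\<^sub>F N in sequentially. measure (\<mu> N t) (Bad N) \<le> bnd N"
    using scales riemann
  proof eventually_elim
    case (elim N)
    have N2: "N \<ge> 2" "N \<ge> 1" and size: "2 * 2 ^ n N + 2 \<le> N" using elim by auto
    define A W where "A = real N powr (- \<alpha>)" and "W = real N powr \<kappa>"
    have Np: "real N > 0" using N2 by simp
    have Ap: "A > 0" "W > 0" using Np by (auto simp: A_def W_def)
    define r where "r = (\<lambda>t x. perturbed_profile m lam \<rho>s \<alpha> \<kappa> \<rho> N t (rescale N x))"
    have fin: "finite (?\<Omega> N)" by (rule finite_confs) simp
    obtain P where sg: "markov_semigroup (?\<Omega> N) P"
      and gen: "has_generator (?\<Omega> N) P (\<lambda>f \<eta>. real N powr (1 + \<kappa>) * generator p K N f \<eta>)"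
      and law: "\<And>t \<eta>. t \<ge> 0 \<Longrightarrow> \<eta> \<in> ?\<Omega> N \<Longrightarrow> measure (distr (M N) (count_space (?\<Omega> N)) (X N t)) {\<eta>} =
       evolve (?\<Omega> N) P (\<lambda>\<xi>. measure (distr (M N) (count_space (?\<Omega> N)) (X N 0)) {\<xi>}) t \<eta>"
      using markov_process_law[OF fin process[OF N2(2), unfolded configs_eq_confs]] by blast
    have \<mu>: "\<mu> N t = distr (M N) (count_space (?\<Omega> N)) (X N t)" if "t \<ge> 0" for t
      using \<mu>_def[OF N2(2) that] by (simp add: configs_eq_confs)
    define w0 where "w0 = (\<lambda>\<eta>. measure (\<mu> N 0) {\<eta>})"
    have law': "measure (\<mu> N t) {\<eta>} = evolve (?\<Omega> N) P w0 t \<eta>" if "t \<ge> 0" "\<eta> \<in> ?\<Omega> N" for t \<eta>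
      using law[OF that] by (simp add: \<mu> that w0_def)
    have ps: "prob_space (\<mu> N t)" if "t \<ge> 0" for t
      unfolding \<mu>[OF that] using process[OF N2(2)] that unfolding markov_process_def configs_eq_confs
      by (auto intro: prob_space.prob_space_distr)
    have msum: "measure (\<mu> N t) Y = (\<Sum>\<eta>\<in>Y. measure (\<mu> N t) {\<eta>})" if "t \<ge> 0" "Y \<subseteq> ?\<Omega> N" for t Y
    proof -
      interpret prob_space "\<mu> N t" by (rule ps[OF that(1)])
      show ?thesis using that finite_subset[OF that(2) fin]
        by (intro finite_measure_eq_sum_singleton) (auto simp: \<mu>)
    qed
    have w0: "w0 \<eta> \<ge> 0" for \<eta> by (simp add: w0_def)
    have w0_sum: "(\<Sum>\<eta>\<in>?\<Omega> N. w0 \<eta>) = 1"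
    proof -
      interpret prob_space "\<mu> N 0" by (rule ps) simp
      have "measure (\<mu> N 0) (?\<Omega> N) = 1" using prob_space by (simp add: \<mu>)
      then show ?thesis using msum[of 0 "?\<Omega> N"] by (simp add: w0_def)
    qed
    obtain f :: "'d \<Rightarrow> int ^ 'd \<Rightarrow> real" where f: "(\<Sum>j\<in>UNIV. \<Sum>v\<in>sites (2 ^ n N). (f j v)\<^sup>2) \<le> (n N * ?d)\<^sup>2 * (if ?d = 1 then 2 ^ n N else 1 :: real)"
      and flow: "\<And>h. h 0 - avg (sites (2 ^ n N)) h = (\<Sum>j\<in>UNIV. \<Sum>v\<in>sites (2 ^ n N). f j v * (h v - h (v + axis j 1)))"
    proof (rule cube_flow[where 'd = 'd and n = "n N"], goal_cases)
      case (1 f)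
      show ?case by (rule 1(1)[OF 1(2) 1(3)])
    qed
    have flowG: "(\<Sum>j\<in>UNIV. \<Sum>v\<in>sites (2 ^ n N). (f j v)\<^sup>2) \<le> G (n N)"
      using f by (simp add: G_def)
    define n0 where "n0 = binom_weight K (?V N) (r 0)"
    define w where "w = (\<lambda>\<eta>. (w0 \<eta> + n0 \<eta>) / 2)"
    define u where "u = evolve (?\<Omega> N) P w t"
    have AC: "A * C \<le> \<delta>" and \<epsilon>: "(C + K * C / \<delta>\<^sup>2) * A / N \<le> 1" and aT: "real N powr (\<kappa> - \<alpha>) * T \<le> S"
      using elim by (auto simp: A_def E_def)
    have Bb: "1 + N * W * Q * (((C + K * C / \<delta>\<^sup>2) * A / N)\<^sup>2 * (G (n N) + 1) * (2 ^ n N) ^ ?d + (C + K * C / \<delta>\<^sup>2) * A / N) \<le> B"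
      using elim by (simp add: A_def E_def W_def B_def)
    define R where "R = U N * real N powr (?d - 2 * \<alpha>)"
    have Rb: "1 + (K\<^sup>2 * (K * PP * C * A * W / N) / \<delta>\<^sup>2)\<^sup>2 * N ^ ?d
       + N * W * Q * (((C + K * C / \<delta>\<^sup>2) * A / N)\<^sup>2 * (G (n N) + 1) * N ^ ?d + (C + K * C / \<delta>\<^sup>2) * A / N * (N ^ ?d / (2 ^ n N) ^ ?d)) \<le> R"
    proof -
      have "K\<^sup>2 * (K * PP * C * A * W / N) / \<delta>\<^sup>2 = c * A * W / N" by (simp add: c_def mult_ac)
      then show ?thesis using elim by (simp add: A_def E_def W_def R_def)
    qed
    have T0: "0 \<in> {0..T}" using T by simp
    note growth_rule = entropy_growth[where N = N and n = "n N" and m = m and \<rho> = \<rho> and \<phi> = f and \<alpha> = \<alpha> and \<kappa> = \<kappa>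
        and \<rho>s = \<rho>s and lam = lam and C = C and \<delta> = \<delta> and T = T and S = S and G = "G (n N)" and B = B and R = R and P = P,
        OF K p_nonneg p0 m_def lam_def per pb size AC[unfolded A_def] \<delta> \<epsilon>[unfolded A_def] aT flow flowG sg gen _ _
          Bb[unfolded A_def W_def Q_def] Rb[unfolded A_def W_def Q_def PP_def]]
    have growth: "ent (?\<Omega> N) (evolve (?\<Omega> N) P w' t') (binom_weight K (?V N) (r t')) \<le> exp (B * T) * (ent (?\<Omega> N) w' (binom_weight K (?V N) (r 0)) + R)"
      and bp': "binomial_product K (?V N) (r t')"
      and r_eq': "\<And>x. r t' x = \<rho>s + A * \<rho> (real N powr (\<kappa> - \<alpha>) * t') (rescale N x - t' *\<^sub>R ((W * lam) *\<^sub>R m))"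
      if "t' \<in> {0..T}" "\<And>\<eta>. \<eta> \<in> ?\<Omega> N \<Longrightarrow> w' \<eta> > 0" "(\<Sum>\<eta>\<in>?\<Omega> N. w' \<eta>) = 1" for t' w'
      unfolding r_def A_def W_def using growth_rule[OF _ that(2,3,1)] by auto
    \<comment> \<open>An auxiliary positive law with which the facts about the profile, independent
      of the law, are extracted; the positivity of the mixture itself rests on them.\<close>
    define uni where "uni = (\<lambda>_ :: int ^ 'd \<Rightarrow> nat. 1 / real (card (?\<Omega> N)))"
    have "?\<Omega> N \<noteq> {}" using w0_sum by auto
    then have uni: "\<And>\<eta>. \<eta> \<in> ?\<Omega> N \<Longrightarrow> uni \<eta> > 0" "(\<Sum>\<eta>\<in>?\<Omega> N. uni \<eta>) = 1"
      using fin by (auto simp: uni_def card_gt_0_iff)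
    have bp: "binomial_product K (?V N) (r t')" if "t' \<in> {0..T}" for t' by (rule bp'[OF that uni])
    interpret b0: binomial_product K "?V N" "r 0" by (rule bp[OF T0])
    interpret bt: binomial_product K "?V N" "r t" by (rule bp[OF t])
    interpret fm: finite_markov "?\<Omega> N" P "\<lambda>f \<eta>. real N powr (1 + \<kappa>) * generator p K N f \<eta>"
      by unfold_locales (rule fin sg gen)+
    have r_eq: "r t x = \<rho>s + A * \<rho> (s N) (rescale N x - v N)" for x
      using r_eq'[OF t uni, of x] by (simp add: s_def v_def W_def mult.commute mult.left_commute)
    have n0: "n0 \<eta> > 0" if "\<eta> \<in> ?\<Omega> N" for \<eta> unfolding n0_def by (rule b0.weight_pos[OF that])
    have w: "\<And>\<eta>. \<eta> \<in> ?\<Omega> N \<Longrightarrow> w \<eta> > 0" "(\<Sum>\<eta>\<in>?\<Omega> N. w \<eta>) = 1"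
      using n0 w0 w0_sum b0.sum_weight
      by (auto simp: w_def n0_def sum.distrib sum_divide_distrib[symmetric] intro: add_nonneg_pos)
    have pmf0: "pmf (\<nu> N 0) = n0"
      unfolding \<nu>_def product_binomial_pmf n0_def r_def by simp
    have "H N 0 = ent (?\<Omega> N) w0 n0"
      unfolding H_def configs_eq_confs using n0 by (subst rel_entropy_eq_ent) (auto simp: pmf0 w0_def)
    then have "ent (?\<Omega> N) w n0 \<le> \<bar>H N 0\<bar>"
      using ent_mixture_le[of "?\<Omega> N" w0 n0] w0 n0 unfolding w_def by auto
    then have "exp (B * T) * (ent (?\<Omega> N) w n0 + R) \<le> exp (B * T) * (\<bar>H N 0\<bar> + R)" by (intro mult_left_mono) auto
    moreover have "ent (?\<Omega> N) u (binom_weight K (?V N) (r t)) \<le> exp (B * T) * (ent (?\<Omega> N) w n0 + R)"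
      using growth[OF t w] by (simp add: u_def n0_def)
    ultimately have ent_u: "ent (?\<Omega> N) u (binom_weight K (?V N) (r t)) \<le> exp (B * T) * (\<bar>H N 0\<bar> + R)" by linarith
    have u0: "u \<eta> \<ge> 0" for \<eta> unfolding u_def by (rule fm.evolve_nonneg) (use w(1) in \<open>auto intro: less_imp_le\<close>)
    have u1: "(\<Sum>\<eta>\<in>?\<Omega> N. u \<eta>) = 1" unfolding u_def using t w(2) by (simp add: fm.evolve_mass)
    define \<psi> where "\<psi> = (\<lambda>x. \<phi> (rescale N x - v N))"
    define \<theta> where "\<theta> = e / 2 * real N powr (?d - \<alpha>)"
    have \<theta>: "\<theta> > 0" using e Np by (simp add: \<theta>_def)
    \<comment> \<open>The deterministic part of the sum is within \<open>e / 2\<close> of the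
      integral, so on the bad event the centred part carries the other half.\<close>
    have sub: "Bad N \<subseteq> {\<eta> \<in> ?\<Omega> N. \<bar>centred (?V N) (r t) \<psi> \<eta>\<bar> > \<theta>}"
    proof
      fix \<eta> assume \<eta>: "\<eta> \<in> Bad N"
      define Y where "Y = real N powr (?d - \<alpha>)"
      have Y: "Y > 0" "A * real N ^ ?d = Y"
        using Np by (auto simp: Y_def A_def powr_diff powr_minus_divide powr_realpow)
      define Z where "Z = (\<Sum>x\<in>?V N. \<rho> (s N) (rescale N x - v N) * \<phi> (rescale N x - v N))"
      have split: "(\<Sum>x\<in>?V N. (real (\<eta> x) - \<rho>s) * \<phi> (rescale N x - v N)) = centred (?V N) (r t) \<psi> \<eta> + A * Z"
        unfolding centred_def Z_def \<psi>_def r_eq sum_distrib_left sum.distrib[symmetric]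
        by (intro sum.cong refl) (simp add: algebra_simps)
      have "\<bar>Z / real N ^ ?d - I\<bar> \<le> e / 2"
        using elim unfolding Z_def I_def of_nat_power by blast
      moreover have "1 / Y * (A * Z) = Z / real N ^ ?d"
        using Y Ap Np unfolding Y(2)[symmetric] by simp
      moreover have "\<bar>1 / Y * (centred (?V N) (r t) \<psi> \<eta> + A * Z) - I\<bar> > e"
        using \<eta> unfolding Bad_def split[symmetric] Y_def by simp
      moreover have "1 / Y * (centred (?V N) (r t) \<psi> \<eta> + A * Z) = centred (?V N) (r t) \<psi> \<eta> / Y + 1 / Y * (A * Z)"
        by (simp add: distrib_left)
      ultimately have "e / 2 < \<bar>centred (?V N) (r t) \<psi> \<eta> / Y\<bar>" by linarith
      then have "\<theta> < \<bar>centred (?V N) (r t) \<psi> \<eta>\<bar>" using Y by (simp add: \<theta>_def Y_def[symmetric] abs_divide pos_less_divide_eq)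
      moreover have "\<eta> \<in> ?\<Omega> N" using \<eta> by (simp add: Bad_def configs_eq_confs)
      ultimately show "\<eta> \<in> {\<eta> \<in> ?\<Omega> N. \<bar>centred (?V N) (r t) \<psi> \<eta>\<bar> > \<theta>}" by simp
    qed
    have "measure (\<mu> N t) (Bad N) = (\<Sum>\<eta>\<in>Bad N. measure (\<mu> N t) {\<eta>})"
      using t sub by (intro msum) auto
    also have "\<dots> \<le> (\<Sum>\<eta>\<in>{\<eta> \<in> ?\<Omega> N. \<bar>centred (?V N) (r t) \<psi> \<eta>\<bar> > \<theta>}. measure (\<mu> N t) {\<eta>})"
      using sub fin by (intro sum_mono2) auto
    also have "\<dots> \<le> (\<Sum>\<eta>\<in>{\<eta> \<in> ?\<Omega> N. \<bar>centred (?V N) (r t) \<psi> \<eta>\<bar> > \<theta>}. 2 * u \<eta>)"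
    proof (rule sum_mono)
      fix \<eta> assume "\<eta> \<in> {\<eta> \<in> ?\<Omega> N. \<bar>centred (?V N) (r t) \<psi> \<eta>\<bar> > \<theta>}"
      then have "measure (\<mu> N t) {\<eta>} = evolve (?\<Omega> N) P w0 t \<eta>" using t by (intro law') auto
      also have "\<dots> \<le> 2 * u \<eta>" unfolding u_def w_def by (rule evolve_half) (use n0 in \<open>auto intro: less_imp_le\<close>)
      finally show "measure (\<mu> N t) {\<eta>} \<le> 2 * u \<eta>" .
    qed
    also have "\<dots> = 2 * (\<Sum>\<eta>\<in>{\<eta> \<in> ?\<Omega> N. \<bar>centred (?V N) (r t) \<psi> \<eta>\<bar> > \<theta>}. u \<eta>)" by (simp add: sum_distrib_left)
    also have "\<dots> \<le> 2 * (K\<^sup>2 * (M\<phi>\<^sup>2 * card (?V N)) * (ent (?\<Omega> N) u (binom_weight K (?V N) (r t)) + 1) / \<theta>\<^sup>2)"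
      by (intro mult_left_mono bt.deviation_bound u0 u1 \<theta>) (auto simp: \<psi>_def M\<phi>)
    also have "\<dots> \<le> 2 * (K\<^sup>2 * (M\<phi>\<^sup>2 * card (?V N)) * (exp (B * T) * (\<bar>H N 0\<bar> + R) + 1) / \<theta>\<^sup>2)"
      using ent_u by (intro mult_left_mono divide_right_mono) auto
    also have "\<dots> = bnd N"
    proof -
      define x y where "x = real N ^ ?d" and "y = real N powr \<alpha>"
      have p: "x > 0" "y > 0" using Np by (auto simp: x_def y_def)
      have xd: "real N powr real ?d = x" using Np by (simp add: x_def powr_realpow)
      have y2: "real N powr (2 * \<alpha>) = y\<^sup>2" using Np by (simp add: y_def powr_power mult.commute)
      have P: "real N powr (?d - \<alpha>) = x / y" "real N powr (?d - 2 * \<alpha>) = x / y\<^sup>2" "real N powr (2 * \<alpha> - ?d) = y\<^sup>2 / x"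
        unfolding powr_diff xd y2 y_def[symmetric] by simp_all
      show ?thesis
        unfolding bnd_def \<theta>_def R_def P c1_def card_sites of_nat_power x_def[symmetric]
        using p e by (simp add: field_simps power2_eq_square)
    qed
    finally show ?case .
  qed
  have "(\<lambda>N. measure (\<mu> N t) (Bad N)) \<longlonglongrightarrow> 0"
    by (rule tendsto_sandwich[OF _ main tendsto_const bnd]) simp
  then show "(\<lambda>N. measure (\<mu> N t) {\<eta> \<in> configs K N.
             \<bar>1 / real N powr (real ?d - \<alpha>) *
                 (\<Sum>x\<in>sites N. (real (\<eta> x) - \<rho>s) *
                    \<phi> (rescale N x - (real N powr \<kappa> * lam * t) *\<^sub>R m))
               - torus_integral (\<lambda>u. (if \<kappa> < \<alpha> then \<rho>ini u else \<rho> t u) * \<phi> u)\<bar> > e})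
          \<longlonglongrightarrow> 0"
    unfolding Bad_def I_def v_def \<rho>' .
qed

end
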